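(* There exists $\varepsilon_0>0$ such that, given $0<\xi<1$ (with $\zeta,\beta,\gamma,\tau$ fixed for this $\xi$ as in the context), there exist a finite scale $\widetilde{L}=\widetilde{L}(\varepsilon_0,\xi)$ and $m_\xi=m(\xi,\widetilde{L})>0$ such that for all $0<\varepsilon\leq\varepsilon_0$, $$\inf_{x\in\mathbb{R}^d}\mathbb{P}\{\Lambda_L(x)\text{ is }m_\xi\text{-localizing for }H_{\varepsilon,\omega}\}\geq1-\mathrm{e}^{-L^\xi}\quad\text{for all }L\geq\widetilde{L}.$$
   Context: Anderson model: $H_{\varepsilon,\omega}=-\varepsilon\Delta+V_\omega$ on $\ell^2(\mathbb{Z}^d)$, $\varepsilon>0$, where $(\Delta\varphi)(x)=\sum_{y\in\mathbb{Z}^d,|y-x|=1}\varphi(y)$ and $V_\omega(x)=\omega_x$, with $\{\omega_x\}$ i.i.d. with non-degenerate distribution $\mu$ of bounded support, Hölder continuous of order $\alpha\in(\tfrac12,1]$: $\sup_{a}\mu([a,a+t])\leq Kt^\alpha$ for $t\in[0,1]$. Parameters: fix $\theta>\left(\tfrac{6}{2\alpha-1}+\tfrac{9}{2}\right)d$ and $q,p,\gamma_1$ with $\tfrac{3d}{2\alpha-1}<q<\tfrac12(\theta-\tfrac92 d)$, $0<p<(2\alpha-1)q-3d$, $1<\gamma_1<\min\{1+\tfrac{p}{p+2d},\tfrac{2\theta-4d}{5d+4q}\}$. Given $\xi\in(0,1)$, fix $\zeta,\beta,\gamma,\tau$ with $0<\xi<\zeta<\beta<\tfrac1\gamma<1<\gamma<\sqrt{\zeta/\xi}$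 and $\max\{\tfrac{1+\gamma_1}{2\gamma_1},\tfrac{1+\gamma\beta}{2},\tfrac{(\gamma-1)\beta+1}{\gamma}\}<\tau<1$. Notation: $\|x\|=\max_j|x_j|$; $\Lambda_L(x)=\{y\in\mathbb{Z}^d:\|y-x\|\leq L/2\}$ for $x\in\mathbb{R}^d$; $H_\Theta=\chi_\Theta H\chi_\Theta$ on $\ell^2(\Theta)$; $L_\tau=\lfloor L^\tau\rfloor$. For $x\in\Lambda_L$ and normalized $\varphi\in\ell^2(\Lambda_L)$, $\varphi$ is $(x,m)$-localized if $|\varphi(y)|\leq\mathrm{e}^{-m\|y-x\|}$ for all $y\in\Lambda_L$ with $\|y-x\|\geq L_\tau$. $\Lambda_L$ is $m$-localizing for $H$ if all eigenvalues of $H_{\Lambda_L}$ are simple with $|\lambda-\lambda'|\geq\mathrm{e}^{-L^\beta}$ for distinct eigenvalues, and there is an orthonormal basis of eigenfunctions $\{\varphi_x\}_{x\in\Lambda_L}$ of $H_{\Lambda_L}$ (with eigenvalues $\lambda_x$) such that each $\varphi_x$ is $(x,m)$-localized. *)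

theory Defs
  imports "HOL-Analysis.Analysis" "HOL-Probability.Probability"
begin

definition to_real :: "int ^ 'd \<Rightarrow> real ^ 'd" where
  "to_real y = (\<chi> j. real_of_int (y $ j))"

definition box :: "real \<Rightarrow> real ^ 'd \<Rightarrow> (int ^ 'd) set" where
  "box L x = {y. infnorm (to_real y - x) \<le> L / 2}"

text \<open>Restricted Anderson Hamiltonian H_Theta = chi_Theta (-eps Delta + V_omega) chi_Theta,
  acting on functions on Z^d (vectors in l^2(Theta) are those vanishing outside Theta);
  Delta is the (unnormalised) adjacency operator, neighbours at Euclidean distance 1.\<close>
definition H_restr :: "real \<Rightarrow> (int ^ 'd \<Rightarrow> real) \<Rightarrow> (int ^ 'd) set
    \<Rightarrow> (int ^ 'd \<Rightarrow> complex) \<Rightarrow> (int ^ 'd \<Rightarrow> complex)" where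
  "H_restr eps \<omega> \<Theta> \<phi> = (\<lambda>y. if y \<in> \<Theta> then
      - complex_of_real eps * (\<Sum>z\<in>{z\<in>\<Theta>. norm (to_real z - to_real y) = 1}. \<phi> z)
      + complex_of_real (\<omega> y) * \<phi> y
    else 0)"

definition eigenpair :: "real \<Rightarrow> (int ^ 'd \<Rightarrow> real) \<Rightarrow> (int ^ 'd) set
    \<Rightarrow> (int ^ 'd \<Rightarrow> complex) \<Rightarrow> real \<Rightarrow> bool" where
  "eigenpair eps \<omega> \<Theta> \<phi> lam \<longleftrightarrow>
     (\<forall>y. y \<notin> \<Theta> \<longrightarrow> \<phi> y = 0) \<and> (\<exists>y\<in>\<Theta>. \<phi> y \<noteq> 0) \<and>
     H_restr eps \<omega> \<Theta> \<phi> = (\<lambda>y. complex_of_real lam * \<phi> y)"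

definition eigenvalues :: "real \<Rightarrow> (int ^ 'd \<Rightarrow> real) \<Rightarrow> (int ^ 'd) set \<Rightarrow> complex set" where
  "eigenvalues eps \<omega> \<Theta> = {lam. \<exists>\<phi>. (\<forall>y. y \<notin> \<Theta> \<longrightarrow> \<phi> y = 0) \<and> (\<exists>y\<in>\<Theta>. \<phi> y \<noteq> 0) \<and>
       H_restr eps \<omega> \<Theta> \<phi> = (\<lambda>y. lam * \<phi> y)}"

definition simple_eigenvalue :: "real \<Rightarrow> (int ^ 'd \<Rightarrow> real) \<Rightarrow> (int ^ 'd) set \<Rightarrow> complex \<Rightarrow> bool" where
  "simple_eigenvalue eps \<omega> \<Theta> lam \<longleftrightarrow>
     (\<forall>\<phi> \<psi>. (\<forall>y. y \<notin> \<Theta> \<longrightarrow> \<phi> y = 0) \<and> (\<exists>y\<in>\<Theta>. \<phi> y \<noteq> 0) \<and>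
              H_restr eps \<omega> \<Theta> \<phi> = (\<lambda>y. lam * \<phi> y) \<and>
              (\<forall>y. y \<notin> \<Theta> \<longrightarrow> \<psi> y = 0) \<and>
              H_restr eps \<omega> \<Theta> \<psi> = (\<lambda>y. lam * \<psi> y)
          \<longrightarrow> (\<exists>c. \<psi> = (\<lambda>y. c * \<phi> y)))"

definition localized :: "real \<Rightarrow> real \<Rightarrow> real ^ 'd \<Rightarrow> int ^ 'd \<Rightarrow> real \<Rightarrow> (int ^ 'd \<Rightarrow> complex) \<Rightarrow> bool" where
  "localized \<tau> L x0 x m \<phi> \<longleftrightarrow>
     (\<forall>y\<in>box L x0. infnorm (to_real y - to_real x) \<ge> real_of_int \<lfloor>L powr \<tau>\<rfloor> \<longrightarrow>
        cmod (\<phi> y) \<le> exp (- m * infnorm (to_real y - to_real x)))"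

definition m_localizing :: "real \<Rightarrow> real \<Rightarrow> real \<Rightarrow> (int ^ 'd \<Rightarrow> real) \<Rightarrow> real \<Rightarrow> real \<Rightarrow> real ^ 'd \<Rightarrow> bool" where
  "m_localizing \<beta> \<tau> eps \<omega> m L x0 \<longleftrightarrow>
     (\<forall>lam\<in>eigenvalues eps \<omega> (box L x0). simple_eigenvalue eps \<omega> (box L x0) lam) \<and>
     (\<forall>lam\<in>eigenvalues eps \<omega> (box L x0). \<forall>lam'\<in>eigenvalues eps \<omega> (box L x0).
        lam \<noteq> lam' \<longrightarrow> cmod (lam - lam') \<ge> exp (- (L powr \<beta>))) \<and>
     (\<exists>\<phi> :: int ^ 'd \<Rightarrow> int ^ 'd \<Rightarrow> complex. \<exists>lam :: int ^ 'd \<Rightarrow> real.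
        (\<forall>x\<in>box L x0. eigenpair eps \<omega> (box L x0) (\<phi> x) (lam x) \<and>
            (\<Sum>y\<in>box L x0. (cmod (\<phi> x y))\<^sup>2) = 1 \<and>
            localized \<tau> L x0 x m (\<phi> x)) \<and>
        (\<forall>x\<in>box L x0. \<forall>x'\<in>box L x0. x \<noteq> x' \<longrightarrow>
            (\<Sum>y\<in>box L x0. \<phi> x y * cnj (\<phi> x' y)) = 0))"

end

theory Submission
  imports Defs "HOL-Real_Asymp.Real_Asymp"
begin

text \<open>
  At high disorder fractional moments replace the multiscale induction. Removing the first site
  gives \<open>G\<^sub>T(x, y) = \<epsilon> G\<^sub>T(x, x) \<Sum>\<^sub>w G\<^bsub>T - {x}\<^esub>(w, y)\<close>, where only \<open>G\<^sub>T(x, x)\<close> depends on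
  \<open>\<omega>\<^sub>x\<close>, and \<open>1 / \<bar>\<omega>\<^sub>x - a\<bar>\<close> has bounded \<open>s\<close>-th moments for \<open>s < \<alpha>\<close>. Hence
  \<open>E \<bar>G\<^sub>T(x, y)\<bar>\<^sup>s\<close> decays exponentially, at any prescribed rate once \<open>\<epsilon>\<close> is small.

  For sites \<open>x, y\<close> at distance \<open>r\<close> take the disjoint balls of radius \<open>r / 2\<close> around them and a net
  of energies of spacing \<open>exp (- r)\<close>. At a fixed energy both Green functions are large only with the
  square of the probability for one of them; since \<open>2 s > 1\<close> this beats the number of energies in the
  net. So every eigenfunction is exponentially small at \<open>x\<close> or at \<open>y\<close>. As \<open>\<tau> > \<beta> > \<xi>\<close>, this holds
  for all pairs at distance at least \<open>L\<^sub>\<tau> / 2\<close> outside an event of probability much smaller than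
  \<open>exp (- L\<^sup>\<xi>)\<close>.

  Two eigenvalues at distance at most \<open>\<delta>\<close> give, for suitable \<open>x\<close>, an approximate eigenvector with
  weight at \<open>x\<close> and one of the operator with \<open>x\<close> removed. Each of these confines one potential value to
  an interval of length \<open>O(\<delta>)\<close>, so a net of energies gives spacing \<open>\<delta>\<close> up to probability
  \<open>O(\<delta>\<^bsup>2 \<alpha> - 1\<^esup>)\<close>, with polynomial factors in \<open>L\<close>. Hall's theorem finally assigns the
  eigenfunctions bijectively to sites near their centers.
\<close>

section \<open>Spectral theory of finite symmetric operators\<close>

text \<open>The threshold on \<epsilon> must be fixed before \<xi>. This works because smallness of
  \<epsilon> enters through \<open>eps \<le> 1\<close> and
  \<open>C * (3 ^ CARD('d) * eps powr s) \<le> exp (-8)\<close>, which involve \<mu> and the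
  dimension alone; \<xi>, \<beta> and \<tau> move only the initial scale. One ball per pair would
  not do: a net of spacing \<open>exp (- r)\<close> has about \<open>exp r\<close> energies, while
  the available bound for one Green function to exceed \<open>exp r\<close> is about
  \<open>exp (- s * r)\<close> with \<open>s < 1\<close>. The net also keeps every estimated energy
  deterministic; an eigenvalue \<open>l\<close> enters as a source term \<open>l - E\<close>.
  Defining the Green function by recursion over regions, not by matrix inversion, makes it total and
  measurable and exposes its dependence on the potential at its first argument.
  \<open>measure\<close> of a nonmeasurable set is 0, so a lower bound on a probability presupposes
  measurability of the localizing event, an existential statement over bases. Compactness of the set
  of bases shows this event closed, hence measurable over countably many sites.\<close>

definition ip :: "'a set \<Rightarrow> ('a \<Rightarrow> complex) \<Rightarrow> ('a \<Rightarrow> complex) \<Rightarrow> complex" where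
  "ip T u v = (\<Sum>z\<in>T. u z * cnj (v z))"

definition sqnorm :: "'a set \<Rightarrow> ('a \<Rightarrow> complex) \<Rightarrow> real" where
  "sqnorm T u = (\<Sum>z\<in>T. (cmod (u z))\<^sup>2)"

definition orthonormal :: "'a set \<Rightarrow> 'i set \<Rightarrow> ('i \<Rightarrow> 'a \<Rightarrow> complex) \<Rightarrow> bool" where
  "orthonormal T I \<phi> \<longleftrightarrow> (\<forall>i\<in>I. \<forall>j\<in>I. ip T (\<phi> i) (\<phi> j) = (if i = j then 1 else 0))"

text \<open>The sum runs over \<open>T\<close>, but the result is not cut off outside
  \<open>T\<close>; eigenvalue equations are therefore demanded only at
  \<open>z \<in> T\<close>.\<close>

definition ham :: "('a \<Rightarrow> 'a \<Rightarrow> real) \<Rightarrow> ('a \<Rightarrow> real) \<Rightarrow> 'a set \<Rightarrow> ('a \<Rightarrow> complex) \<Rightarrow> 'a \<Rightarrow> complex" where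
  "ham A v T u x = of_real (v x) * u x + (\<Sum>y\<in>T. of_real (A x y) * u y)"

lemma ip_self: "ip T u u = of_real (sqnorm T u)"
  by (simp add: ip_def sqnorm_def complex_norm_square[symmetric] del: of_real_power)

lemma cnj_ip: "cnj (ip T u v) = ip T v u"
  by (simp add: ip_def mult.commute)

lemma ip_eq_0_commute: "ip T u v = 0 \<longleftrightarrow> ip T v u = 0"
  using cnj_ip[of T u v] cnj_ip[of T v u] by auto

lemma ip_cong: "(\<And>z. z \<in> T \<Longrightarrow> u z = u' z) \<Longrightarrow> (\<And>z. z \<in> T \<Longrightarrow> v z = v' z) \<Longrightarrow> ip T u v = ip T u' v'"
  by (simp add: ip_def)

lemma ip_add_left: "ip T (\<lambda>z. u z + v z) w = ip T u w + ip T v w"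
  by (simp add: ip_def sum.distrib algebra_simps)

lemma ip_diff_left: "ip T (\<lambda>z. u z - v z) w = ip T u w - ip T v w"
  by (simp add: ip_def sum_subtractf algebra_simps)

lemma ip_scale_left: "ip T (\<lambda>z. c * u z) w = c * ip T u w"
  by (simp add: ip_def sum_distrib_left algebra_simps)

lemma ip_add_right: "ip T w (\<lambda>z. u z + v z) = ip T w u + ip T w v"
  by (simp add: ip_def sum.distrib algebra_simps)

lemma ip_diff_right: "ip T w (\<lambda>z. u z - v z) = ip T w u - ip T w v"
  by (simp add: ip_def sum_subtractf algebra_simps)

lemma ip_scale_right: "ip T w (\<lambda>z. c * u z) = cnj c * ip T w u"
  by (simp add: ip_def sum_distrib_left algebra_simps)

lemma ip_sum_left: "ip T (\<lambda>z. \<Sum>i\<in>I. u i z) w = (\<Sum>i\<in>I. ip T (u i) w)"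
  unfolding ip_def by (subst sum.swap) (simp add: sum_distrib_right)

lemma sqnorm_nonneg: "0 \<le> sqnorm T u"
  by (simp add: sqnorm_def sum_nonneg)

lemma norm_le_sqnorm:
  assumes "finite T" "x \<in> T"
  shows "(cmod (u x))\<^sup>2 \<le> sqnorm T u"
  unfolding sqnorm_def by (rule member_le_sum[OF assms(2) _ assms(1)]) simp

lemma sqnorm_eq_0_iff: "finite T \<Longrightarrow> sqnorm T u = 0 \<longleftrightarrow> (\<forall>z\<in>T. u z = 0)"
  by (simp add: sqnorm_def sum_nonneg_eq_0_iff)

lemma sqnorm_scale: "sqnorm T (\<lambda>z. c * u z) = (cmod c)\<^sup>2 * sqnorm T u"
  by (simp add: sqnorm_def norm_mult power_mult_distrib sum_distrib_left)

lemma norm_ip_le: "cmod (ip T u v) \<le> sqrt (sqnorm T u) * sqrt (sqnorm T v)"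
proof -
  have "cmod (ip T u v) \<le> (\<Sum>z\<in>T. cmod (u z) * cmod (v z))"
    unfolding ip_def by (rule order_trans[OF norm_sum]) (simp add: norm_mult)
  also have "\<dots> = (\<Sum>z\<in>T. \<bar>cmod (u z)\<bar> * \<bar>cmod (v z)\<bar>)" by simp
  also have "\<dots> \<le> L2_set (\<lambda>z. cmod (u z)) T * L2_set (\<lambda>z. cmod (v z)) T"
    by (rule L2_set_mult_ineq)
  finally show ?thesis by (simp add: L2_set_def sqnorm_def)
qed

text \<open>Pigeonhole on the mass. The threshold \<open>1 / sqrt (card T)\<close> is reused as the
  weight at a resonant site and at the center of an eigenfunction.\<close>

lemma exists_large_coordinate:
  assumes "finite T" "sqnorm T u = 1"
  shows "\<exists>x\<in>T. 1 / sqrt (card T) \<le> cmod (u x)"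
proof (rule ccontr)
  assume "\<not> ?thesis"
  then have less: "cmod (u x) < 1 / sqrt (card T)" if "x \<in> T" for x
    using that by force
  have ne: "T \<noteq> {}" using assms by (auto simp: sqnorm_def)
  then have "card T > 0" using assms by (simp add: card_gt_0_iff)
  have "sqnorm T u < (\<Sum>z\<in>T. (1 / sqrt (card T))\<^sup>2)"
    unfolding sqnorm_def using less ne assms(1)
    by (intro sum_strict_mono power_strict_mono) auto
  also have "\<dots> = 1" using \<open>card T > 0\<close> by (simp add: power_divide)
  finally show False using assms by simp
qed

lemma orthonormalD:
  "orthonormal T I \<phi> \<Longrightarrow> i \<in> I \<Longrightarrow> j \<in> I \<Longrightarrow> ip T (\<phi> i) (\<phi> j) = (if i = j then 1 else 0)"
  by (simp add: orthonormal_def)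

lemma orthonormal_sqnorm: "orthonormal T I \<phi> \<Longrightarrow> i \<in> I \<Longrightarrow> sqnorm T (\<phi> i) = 1"
  using orthonormalD[of T I \<phi> i i] by (simp add: ip_self)

lemma ip_orthogonal_remainder:
  assumes "finite I" "orthonormal T I \<phi>" "j \<in> I"
  shows "ip T (\<lambda>z. f z - (\<Sum>i\<in>I. ip T f (\<phi> i) * \<phi> i z)) (\<phi> j) = 0"
proof -
  have "(\<Sum>i\<in>I. ip T f (\<phi> i) * ip T (\<phi> i) (\<phi> j)) = (\<Sum>i\<in>I. if i = j then ip T f (\<phi> j) else 0)"
    using assms by (intro sum.cong) (auto simp: orthonormal_def)
  then show ?thesis using assms
    by (simp add: ip_diff_left ip_sum_left ip_scale_left)
qed

lemma sqnorm_orthogonal_remainder: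
  assumes "finite I" "orthonormal T I \<phi>"
  shows "sqnorm T (\<lambda>z. f z - (\<Sum>i\<in>I. ip T f (\<phi> i) * \<phi> i z))
       = sqnorm T f - (\<Sum>i\<in>I. (cmod (ip T f (\<phi> i)))\<^sup>2)"
proof -
  let ?r = "\<lambda>z. f z - (\<Sum>i\<in>I. ip T f (\<phi> i) * \<phi> i z)"
  have orth: "ip T (\<phi> i) ?r = 0" if "i \<in> I" for i
    using ip_orthogonal_remainder[OF assms that] ip_eq_0_commute by blast
  have "ip T ?r ?r = ip T f ?r - (\<Sum>i\<in>I. ip T f (\<phi> i) * ip T (\<phi> i) ?r)"
    by (simp add: ip_diff_left ip_sum_left ip_scale_left)
  also have "\<dots> = ip T f ?r" using orth by simp
  also have "\<dots> = cnj (ip T ?r f)" by (simp add: cnj_ip)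
  also have "\<dots> = cnj (ip T f f - (\<Sum>i\<in>I. ip T f (\<phi> i) * ip T (\<phi> i) f))"
    by (simp add: ip_diff_left ip_sum_left ip_scale_left)
  also have "(\<Sum>i\<in>I. ip T f (\<phi> i) * ip T (\<phi> i) f) = (\<Sum>i\<in>I. of_real ((cmod (ip T f (\<phi> i)))\<^sup>2))"
    by (intro sum.cong refl) (simp add: complex_norm_square cnj_ip del: of_real_power)
  finally have "complex_of_real (sqnorm T ?r)
      = of_real (sqnorm T f - (\<Sum>i\<in>I. (cmod (ip T f (\<phi> i)))\<^sup>2))"
    by (simp add: ip_self)
  then show ?thesis using of_real_eq_iff by blast
qed

lemma ip_unit_left:
  assumes "finite T" "x \<in> T"
  shows "ip T (\<lambda>z. if z = x then 1 else 0) u = cnj (u x)"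
  using assms by (simp add: ip_def if_distrib[where f="\<lambda>c. c * _"] cong: if_cong)

lemma sqnorm_unit:
  assumes "finite T" "x \<in> T"
  shows "sqnorm T (\<lambda>z. if z = x then 1 else 0) = 1"
  using assms by (simp add: sqnorm_def if_distrib[where f=cmod] if_distrib[where f="\<lambda>c. c\<^sup>2"] cong: if_cong)

text \<open>Bessel's inequality for the unit vector at \<open>x\<close>, whose coefficient along
  \<open>\<phi> i\<close> has modulus \<open>cmod (\<phi> i x)\<close>.\<close>

lemma bessel:
  assumes "finite T" "finite I" "orthonormal T I \<phi>" "x \<in> T"
  shows "(\<Sum>i\<in>I. (cmod (\<phi> i x))\<^sup>2) \<le> 1"
  using sqnorm_orthogonal_remainder[OF assms(2,3), of "\<lambda>z. if z = x then 1 else 0"]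
    sqnorm_nonneg[of T "\<lambda>z. (if z = x then 1 else 0)
        - (\<Sum>i\<in>I. ip T (\<lambda>z. if z = x then 1 else 0) (\<phi> i) * \<phi> i z)"] assms
  by (simp add: ip_unit_left sqnorm_unit)

text \<open>Mass counted by vectors. Comparing it with \<open>bessel\<close>, which counts by sites,
  takes the place of dimension theory, both for completeness and for Hall's condition.\<close>

lemma sum_bessel:
  assumes "orthonormal T I \<phi>"
  shows "(\<Sum>x\<in>T. \<Sum>i\<in>I. (cmod (\<phi> i x))\<^sup>2) = card I"
  using orthonormal_sqnorm[OF assms] by (subst sum.swap) (simp add: sqnorm_def)

text \<open>The masses at the sites add up to \<open>card T\<close> and none exceeds 1, so each
  equals 1. Then the unit vector at \<open>x\<close> coincides on \<open>T\<close> with its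
  expansion in the family, and pairing that expansion with \<psi> gives 0.\<close>

lemma orthonormal_complete:
  assumes T: "finite T" and I: "finite I" "orthonormal T I \<phi>" and card: "card I = card T"
    and orth: "\<And>i. i \<in> I \<Longrightarrow> ip T \<psi> (\<phi> i) = 0" and x: "x \<in> T"
  shows "\<psi> x = 0"
proof -
  let ?d = "\<lambda>z. if z = x then 1 else (0::complex)"
  let ?r = "\<lambda>z. ?d z - (\<Sum>i\<in>I. ip T ?d (\<phi> i) * \<phi> i z)"
  have "(\<Sum>i\<in>I. (cmod (\<phi> i x))\<^sup>2) = 1"
  proof (rule ccontr)
    assume "\<not> ?thesis"
    then have "(\<Sum>i\<in>I. (cmod (\<phi> i x))\<^sup>2) < 1"
      using bessel[OF T I x] by simp
    then have "(\<Sum>x\<in>T. \<Sum>i\<in>I. (cmod (\<phi> i x))\<^sup>2) < (\<Sum>x\<in>T. 1)"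
      using x bessel[OF T I] by (intro sum_strict_mono_ex1 T) auto
    then show False using sum_bessel[OF I(2)] card by simp
  qed
  then have "sqnorm T ?r = 0"
    using sqnorm_orthogonal_remainder[OF I, of ?d] x T by (simp add: ip_unit_left sqnorm_unit)
  then have "?r z = 0" if "z \<in> T" for z using that T by (simp add: sqnorm_eq_0_iff)
  then have eq: "?d z = (\<Sum>i\<in>I. ip T ?d (\<phi> i) * \<phi> i z)" if "z \<in> T" for z using that by force
  have "cnj (\<psi> x) = ip T ?d \<psi>" using ip_unit_left[OF T x] by metis
  also have "\<dots> = ip T (\<lambda>z. \<Sum>i\<in>I. ip T ?d (\<phi> i) * \<phi> i z) \<psi>"
    by (rule ip_cong) (auto dest: eq)
  also have "\<dots> = (\<Sum>i\<in>I. ip T ?d (\<phi> i) * ip T (\<phi> i) \<psi>)"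
    by (simp add: ip_sum_left ip_scale_left)
  also have "\<dots> = 0"
  proof (intro sum.neutral ballI)
    fix i assume "i \<in> I"
    then have "ip T (\<phi> i) \<psi> = 0" using orth ip_eq_0_commute by blast
    then show "ip T ?d (\<phi> i) * ip T (\<phi> i) \<psi> = 0" by simp
  qed
  finally show ?thesis by simp
qed

section \<open>Self-adjointness and the variational construction of eigenvectors\<close>

lemma ip_ham_left:
  assumes "\<And>x y. A x y = A y x"
  shows "ip T (ham A v T u) w = ip T u (ham A v T w)"
proof -
  have "(\<Sum>x\<in>T. \<Sum>y\<in>T. of_real (A x y) * u y * cnj (w x)) = (\<Sum>x\<in>T. \<Sum>y\<in>T. u x * (of_real (A x y) * cnj (w y)))"
    by (subst sum.swap, intro sum.cong refl) (metis assms mult.assoc mult.commute)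
  then show ?thesis
    unfolding ip_def ham_def by (simp add: algebra_simps sum.distrib sum_distrib_left sum_distrib_right)
qed

lemma ham_add: "ham A v T (\<lambda>z. u z + w z) x = ham A v T u x + ham A v T w x"
  by (simp add: ham_def algebra_simps sum.distrib)

lemma ham_scale: "ham A v T (\<lambda>z. c * u z) x = c * ham A v T u x"
  by (simp add: ham_def algebra_simps sum_distrib_left)

text \<open>Tychonoff's theorem. The site type may be infinite; vectors supported in a finite
  \<open>T\<close> become compact by letting the boxes shrink to \<open>{0}\<close> off
  \<open>T\<close>.\<close>

lemma compact_function_box:
  fixes K :: "'a \<Rightarrow> 'b::topological_space set"
  assumes "\<And>x. compact (K x)"
  shows "compact {f. \<forall>x. f x \<in> K x}"
proof -
  have "compactin (product_topology (\<lambda>_. euclidean) UNIV) (PiE UNIV K)"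
    using assms by (auto simp: compactin_PiE)
  moreover have "PiE UNIV K = {f. \<forall>x. f x \<in> K x}" by auto
  ultimately show ?thesis by (simp add: euclidean_product_topology)
qed

text \<open>Too few vectors leave some site with mass below 1. The unit vector at that site then has
  a nonzero component orthogonal to the family.\<close>

lemma exists_unit_orthogonal:
  assumes T: "finite T" and I: "finite I" "orthonormal T I \<phi>" and less: "card I < card T"
  shows "\<exists>u. (\<forall>z. z \<notin> T \<longrightarrow> u z = 0) \<and> sqnorm T u = 1 \<and> (\<forall>i\<in>I. ip T u (\<phi> i) = 0)"
proof -
  have "\<exists>x\<in>T. (\<Sum>i\<in>I. (cmod (\<phi> i x))\<^sup>2) < 1"
  proof (rule ccontr)
    assume "\<not> ?thesis"
    then have "(\<Sum>x\<in>T. 1) \<le> (\<Sum>x\<in>T. \<Sum>i\<in>I. (cmod (\<phi> i x))\<^sup>2)"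
      by (intro sum_mono) force
    then show False using sum_bessel[OF I(2)] less by simp
  qed
  then obtain x where x: "x \<in> T" "(\<Sum>i\<in>I. (cmod (\<phi> i x))\<^sup>2) < 1" by blast
  let ?d = "\<lambda>z. if z = x then 1 else (0::complex)"
  define r where "r = (\<lambda>z. ?d z - (\<Sum>i\<in>I. ip T ?d (\<phi> i) * \<phi> i z))"
  have pos: "sqnorm T r > 0"
    using sqnorm_orthogonal_remainder[OF I, of ?d] x T by (simp add: ip_unit_left sqnorm_unit r_def)
  have orth: "ip T r (\<phi> i) = 0" if "i \<in> I" for i
    unfolding r_def by (rule ip_orthogonal_remainder[OF I that])
  define c where "c = complex_of_real (1 / sqrt (sqnorm T r))"
  define u where "u = (\<lambda>z. if z \<in> T then c * r z else 0)"
  have "sqnorm T u = sqnorm T (\<lambda>z. c * r z)" by (simp add: sqnorm_def u_def)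
  also have "\<dots> = 1" using pos unfolding sqnorm_scale c_def by (simp add: norm_divide power_divide)
  finally have "sqnorm T u = 1" .
  moreover have "ip T u (\<phi> i) = 0" if "i \<in> I" for i
  proof -
    have "ip T u (\<phi> i) = ip T (\<lambda>z. c * r z) (\<phi> i)" by (rule ip_cong) (simp_all add: u_def)
    then show ?thesis using orth[OF that] by (simp add: ip_scale_left)
  qed
  ultimately show ?thesis by (intro exI[of _ u]) (auto simp: u_def)
qed

lemma continuous_on_coordinate [continuous_intros]:
  "continuous_on S (\<lambda>u::'a \<Rightarrow> 'b::topological_space. u z)"
  by (rule continuous_on_subset[OF continuous_on_product_coordinates]) simp

lemma exists_extremal_unit:
  assumes T: "finite T" and I: "finite I" "orthonormal T I \<phi>" and less: "card I < card T"
  obtains u where "\<And>z. z \<notin> T \<Longrightarrow> u z = 0" "sqnorm T u = 1" "\<And>i. i \<in> I \<Longrightarrow> ip T u (\<phi> i) = 0"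
    "\<And>w. sqnorm T w = 1 \<Longrightarrow> (\<And>i. i \<in> I \<Longrightarrow> ip T w (\<phi> i) = 0) \<Longrightarrow>
        Re (ip T (ham A v T w) w) \<le> Re (ip T (ham A v T u) u)"
proof -
  define K where "K = (\<lambda>z. if z \<in> T then cball (0::complex) 1 else {0})"
  define V where "V = {u. \<forall>z. u z \<in> K z} \<inter> {u. sqnorm T u = 1} \<inter> (\<Inter>i\<in>I. {u. ip T u (\<phi> i) = 0})"
  have "compact V"
    unfolding V_def
  proof (intro compact_Int_closed)
    show "compact {u. \<forall>z. u z \<in> K z}" by (intro compact_function_box) (auto simp: K_def)
    show "closed {u. sqnorm T u = 1}" unfolding sqnorm_def
      by (intro closed_Collect_eq continuous_intros)
    show "closed (\<Inter>i\<in>I. {u. ip T u (\<phi> i) = 0})" unfolding ip_def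
      by (intro closed_INT ballI closed_Collect_eq continuous_intros)
  qed
  moreover have in_V: "u \<in> V"
    if "\<And>z. z \<notin> T \<Longrightarrow> u z = 0" "sqnorm T u = 1" "\<And>i. i \<in> I \<Longrightarrow> ip T u (\<phi> i) = 0" for u
  proof -
    have "cmod (u z) \<le> 1" if "z \<in> T" for z
      using norm_le_sqnorm[OF T that, of u] \<open>sqnorm T u = 1\<close> by (simp add: power_le_one_iff)
    then show ?thesis using that by (auto simp: V_def K_def)
  qed
  moreover have "V \<noteq> {}"
    using exists_unit_orthogonal[OF assms] in_V by blast
  moreover have "continuous_on V (\<lambda>u. Re (ip T (ham A v T u) u))"
    unfolding ip_def ham_def by (intro continuous_intros)
  ultimately obtain u where u: "u \<in> V"
      "\<And>w. w \<in> V \<Longrightarrow> Re (ip T (ham A v T w) w) \<le> Re (ip T (ham A v T u) u)"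
    using continuous_attains_sup[of V "\<lambda>u. Re (ip T (ham A v T u) u)"] by blast
  show thesis
  proof
    show "u z = 0" if "z \<notin> T" for z
    proof -
      have "u z \<in> K z" using u(1) by (auto simp: V_def)
      then show ?thesis using that by (simp add: K_def)
    qed
    show "sqnorm T u = 1" using u(1) by (auto simp: V_def)
    show "ip T u (\<phi> i) = 0" if "i \<in> I" for i using u(1) that by (auto simp: V_def)
    show "Re (ip T (ham A v T w) w) \<le> Re (ip T (ham A v T u) u)"
      if w: "sqnorm T w = 1" "\<And>i. i \<in> I \<Longrightarrow> ip T w (\<phi> i) = 0" for w
    proof -
      define w' where "w' = (\<lambda>z. if z \<in> T then w z else 0)"
      have "sqnorm T w' = sqnorm T w" by (simp add: sqnorm_def w'_def)
      moreover have "ip T w' x = ip T w x" for x by (rule ip_cong) (simp_all add: w'_def)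
      ultimately have "w' \<in> V" using w by (intro in_V) (auto simp: w'_def)
      moreover have "ip T (ham A v T w') w' = ip T (ham A v T w) w"
        by (rule ip_cong) (auto simp: ham_def w'_def)
      ultimately show ?thesis using u(2)[of w'] by simp
    qed
  qed
qed

text \<open>First-order optimality: for small \<open>t\<close> a positive linear term would exceed
  the quadratic one. The contradiction is read off at \<open>t = a / b\<close>.\<close>

lemma nonneg_slope_imp_zero:
  fixes a b :: real
  assumes "0 \<le> a" "\<And>t. 0 < t \<Longrightarrow> 2 * t * a \<le> t\<^sup>2 * b"
  shows "a = 0"
proof (rule ccontr)
  assume "a \<noteq> 0"
  with assms(1) have a: "a > 0" by simp
  have b: "b > 0" using assms(2)[of 1] a by simp
  have "2 * (a / b) * a \<le> (a / b)\<^sup>2 * b" using assms(2)[of "a / b"] a b by simp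
  also have "\<dots> = (a / b) * a" using b by (simp add: power2_eq_square)
  finally show False using a b by (simp add: field_simps)
qed

text \<open>Let \<open>u\<close> maximise the quadratic form on the orthogonal complement of the
  family. The residual \<open>w = H u - l u\<close> is orthogonal to \<open>u\<close> and to the
  family, so \<open>u + t w\<close> is an admissible direction, along which the form grows by
  \<open>2 * t * sqnorm T w\<close> to first order. Maximality forces \<open>w = 0\<close>.\<close>

lemma exists_next_eigenvector:
  assumes T: "finite T" and I: "finite I" "orthonormal T I \<phi>" and less: "card I < card T"
    and sym: "\<And>x y. A x y = A y x"
    and eig: "\<And>i z. i \<in> I \<Longrightarrow> z \<in> T \<Longrightarrow> ham A v T (\<phi> i) z = of_real (lam i) * \<phi> i z"
  obtains u l where "\<And>z. z \<notin> T \<Longrightarrow> u z = 0" "sqnorm T u = 1" "\<And>i. i \<in> I \<Longrightarrow> ip T u (\<phi> i) = 0"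
    "\<And>z. z \<in> T \<Longrightarrow> ham A v T u z = of_real l * u z"
proof -
  let ?H = "ham A v T" and ?Q = "\<lambda>u. Re (ip T (ham A v T u) u)"
  obtain u where u: "\<And>z. z \<notin> T \<Longrightarrow> u z = 0" "sqnorm T u = 1" "\<And>i. i \<in> I \<Longrightarrow> ip T u (\<phi> i) = 0"
    and ext: "\<And>w. sqnorm T w = 1 \<Longrightarrow> (\<And>i. i \<in> I \<Longrightarrow> ip T w (\<phi> i) = 0) \<Longrightarrow> ?Q w \<le> ?Q u"
    using exists_extremal_unit[OF T I less] by blast
  define l where "l = ?Q u"
  have Hu_u: "ip T (?H u) u = of_real l"
  proof -
    have "cnj (ip T (?H u) u) = ip T u (?H u)" by (rule cnj_ip)
    also have "\<dots> = ip T (?H u) u" by (rule ip_ham_left[OF sym, symmetric])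
    finally have "ip T (?H u) u \<in> \<real>" by (simp add: Reals_cnj_iff)
    then show ?thesis by (simp add: l_def)
  qed
  \<comment> \<open>The homogeneous form of maximality, so that \<open>u + t w\<close> need not be
    normalised.\<close>
  have scaled: "?Q w \<le> l * sqnorm T w" if w: "\<And>i. i \<in> I \<Longrightarrow> ip T w (\<phi> i) = 0" for w
  proof (cases "sqnorm T w = 0")
    case True
    then have "w z = 0" if "z \<in> T" for z using that T by (simp add: sqnorm_eq_0_iff)
    then have "ip T (?H w) w = 0" by (simp add: ip_def)
    then show ?thesis using True by simp
  next
    case False
    then have pos: "sqnorm T w > 0" using sqnorm_nonneg[of T w] by simp
    define c where "c = 1 / sqrt (sqnorm T w)"
    have c2: "c\<^sup>2 = 1 / sqnorm T w" using pos by (simp add: c_def power_divide)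
    have "?Q (\<lambda>z. of_real c * w z) \<le> l"
      unfolding l_def
    proof (rule ext)
      show "sqnorm T (\<lambda>z. of_real c * w z) = 1" using pos unfolding sqnorm_scale by (simp add: c2)
      show "ip T (\<lambda>z. of_real c * w z) (\<phi> i) = 0" if "i \<in> I" for i
        using w[OF that] by (simp add: ip_scale_left)
    qed
    moreover have "ip T (?H (\<lambda>z. of_real c * w z)) (\<lambda>z. of_real c * w z) = of_real (c\<^sup>2) * ip T (?H w) w"
      by (simp add: ham_scale[abs_def] ip_scale_left ip_scale_right power2_eq_square)
    then have "?Q (\<lambda>z. of_real c * w z) = c\<^sup>2 * ?Q w"
      by (simp del: of_real_power)
    ultimately show ?thesis using pos by (simp add: c2 field_simps)
  qed
  define w where "w = (\<lambda>z. ?H u z - of_real l * u z)"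
  have w_u: "ip T w u = 0"
    using u(2) by (simp add: w_def ip_diff_left ip_scale_left Hu_u ip_self)
  have w_phi: "ip T w (\<phi> i) = 0" if "i \<in> I" for i
  proof -
    have "ip T (?H u) (\<phi> i) = ip T u (?H (\<phi> i))" by (rule ip_ham_left[OF sym])
    also have "\<dots> = ip T u (\<lambda>z. of_real (lam i) * \<phi> i z)" using eig[OF that] by (intro ip_cong) auto
    also have "\<dots> = 0" using u(3)[OF that] by (simp add: ip_scale_right)
    finally show ?thesis using u(3)[OF that] by (simp add: w_def ip_diff_left ip_scale_left)
  qed
  have Hu_w: "ip T (?H u) w = of_real (sqnorm T w)"
  proof -
    have "ip T w w = ip T (?H u) w - of_real l * ip T u w"
      by (subst (1) w_def) (simp add: ip_diff_left ip_scale_left)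
    moreover have "ip T u w = 0" using w_u ip_eq_0_commute by blast
    ultimately show ?thesis by (simp add: ip_self)
  qed
  have Hw_u: "ip T (?H w) u = of_real (sqnorm T w)"
  proof -
    have "ip T (?H w) u = ip T w (?H u)" by (rule ip_ham_left[OF sym])
    also have "\<dots> = cnj (ip T (?H u) w)" by (rule cnj_ip[symmetric])
    finally show ?thesis by (simp add: Hu_w)
  qed
  have "sqnorm T w = 0"
  proof (rule nonneg_slope_imp_zero[where b = "l * sqnorm T w - ?Q w"])
    fix t :: real assume "0 < t"
    let ?p = "\<lambda>z. u z + of_real t * w z"
    have "?Q ?p \<le> l * sqnorm T ?p"
      using u(3) w_phi by (intro scaled) (simp add: ip_add_left ip_scale_left)
    moreover have "?Q ?p = l + 2 * t * sqnorm T w + t\<^sup>2 * ?Q w"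
      by (simp add: ham_add[abs_def] ham_scale[abs_def] ip_add_left ip_scale_left ip_add_right
          ip_scale_right Hu_u Hu_w Hw_u power2_eq_square algebra_simps)
    moreover have "ip T ?p ?p = 1 + of_real (t\<^sup>2 * sqnorm T w)"
      using w_u ip_eq_0_commute[of T w u] u(2)
      by (simp add: ip_add_left ip_scale_left ip_add_right ip_scale_right ip_self power2_eq_square)
    then have "complex_of_real (sqnorm T ?p) = complex_of_real (1 + t\<^sup>2 * sqnorm T w)"
      unfolding ip_self by simp
    then have "sqnorm T ?p = 1 + t\<^sup>2 * sqnorm T w"
      using of_real_eq_iff by blast
    ultimately show "2 * t * sqnorm T w \<le> t\<^sup>2 * (l * sqnorm T w - ?Q w)"
      by (simp add: algebra_simps)
  qed (rule sqnorm_nonneg)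
  then have "?H u z = of_real l * u z" if "z \<in> T" for z
    using that T by (simp add: sqnorm_eq_0_iff w_def)
  then show thesis using that u by blast
qed

theorem spectral_theorem:
  assumes T: "finite T" and sym: "\<And>x y. A x y = A y x"
  obtains \<phi> :: "nat \<Rightarrow> 'a \<Rightarrow> complex" and lam :: "nat \<Rightarrow> real"
  where "orthonormal T {..<card T} \<phi>" "\<And>i z. i < card T \<Longrightarrow> z \<notin> T \<Longrightarrow> \<phi> i z = 0"
    "\<And>i z. i < card T \<Longrightarrow> z \<in> T \<Longrightarrow> ham A v T (\<phi> i) z = of_real (lam i) * \<phi> i z"
proof -
  have "k \<le> card T \<Longrightarrow> \<exists>(\<phi> :: nat \<Rightarrow> 'a \<Rightarrow> complex) (lam :: nat \<Rightarrow> real).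
      orthonormal T {..<k} \<phi> \<and> (\<forall>i<k. \<forall>z. z \<notin> T \<longrightarrow> \<phi> i z = 0) \<and>
      (\<forall>i<k. \<forall>z\<in>T. ham A v T (\<phi> i) z = of_real (lam i) * \<phi> i z)" for k
  proof (induction k)
    case 0
    then show ?case by (simp add: orthonormal_def)
  next
    case (Suc k)
    then obtain \<phi> :: "nat \<Rightarrow> 'a \<Rightarrow> complex" and lam :: "nat \<Rightarrow> real" where *:
      "orthonormal T {..<k} \<phi>" "\<forall>i<k. \<forall>z. z \<notin> T \<longrightarrow> \<phi> i z = 0"
      "\<forall>i<k. \<forall>z\<in>T. ham A v T (\<phi> i) z = of_real (lam i) * \<phi> i z" by auto
    obtain u l where u: "\<And>z. z \<notin> T \<Longrightarrow> u z = 0" "sqnorm T u = 1"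
        "\<And>i. i \<in> {..<k} \<Longrightarrow> ip T u (\<phi> i) = 0" "\<And>z. z \<in> T \<Longrightarrow> ham A v T u z = of_real l * u z"
      by (rule exists_next_eigenvector[OF T _ *(1) _ sym, where v = v and lam = lam]) (use * Suc.prems in auto)
    have "ip T (\<phi> i) u = 0" if "i < k" for i using u(3)[of i] that ip_eq_0_commute[of T u] by simp
    then have "orthonormal T {..<Suc k} (\<phi>(k := u))"
      using *(1) u(2,3) orthonormal_sqnorm[OF *(1)] by (auto simp: orthonormal_def less_Suc_eq ip_self)
    moreover have "\<forall>i<Suc k. \<forall>z. z \<notin> T \<longrightarrow> (\<phi>(k := u)) i z = 0"
      using *(2) u(1) by (auto simp: less_Suc_eq)
    moreover have "\<forall>i<Suc k. \<forall>z\<in>T. ham A v T ((\<phi>(k := u)) i) z = of_real ((lam(k := l)) i) * (\<phi>(k := u)) i z"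
      using *(3) u(4) by (auto simp: less_Suc_eq)
    ultimately show ?case by blast
  qed
  from this[of "card T"] obtain \<phi> :: "nat \<Rightarrow> 'a \<Rightarrow> complex" and lam :: "nat \<Rightarrow> real" where
    "orthonormal T {..<card T} \<phi>" "\<forall>i<card T. \<forall>z. z \<notin> T \<longrightarrow> \<phi> i z = 0"
    "\<forall>i<card T. \<forall>z\<in>T. ham A v T (\<phi> i) z = of_real (lam i) * \<phi> i z" by auto
  then show thesis by (intro that[of \<phi> lam]) auto
qed

section \<open>Independent potentials\<close>

locale iid_potential =
  fixes \<mu> :: "real measure" and K \<alpha> :: real
  assumes prob_mu: "prob_space \<mu>" and sets_mu: "sets \<mu> = sets borel"
    and alpha: "1/2 < \<alpha>" "\<alpha> \<le> 1"
    and hoelder: "\<And>a t. 0 \<le> t \<Longrightarrow> t \<le> 1 \<Longrightarrow> measure \<mu> {a..a+t} \<le> K * t powr \<alpha>"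
begin

sublocale mu: prob_space \<mu> by (rule prob_mu)

lemma space_mu: "space \<mu> = UNIV"
  using sets_eq_imp_space_eq[OF sets_mu] by simp

lemma borel_measurable_mu: "f \<in> borel_measurable borel \<Longrightarrow> f \<in> borel_measurable \<mu>"
  using measurable_cong_sets[OF sets_mu refl] by blast

lemma K_nonneg: "0 \<le> K"
  using hoelder[of 1 0] measure_nonneg[of \<mu> "{0..1}"] by (simp del: measure_nonneg)

definition P :: "('a \<Rightarrow> real) measure" where "P = PiM UNIV (\<lambda>_. \<mu>)"

lemma prob_P: "prob_space (P :: ('a \<Rightarrow> real) measure)"
  unfolding P_def by (rule prob_space_PiM) (rule prob_mu)

lemma space_P: "space P = UNIV"
  by (simp add: P_def space_PiM space_mu)

text \<open>For countably many sites, closedness in the product topology gives measurability. This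
  is how events with an existential quantifier over vectors are handled.\<close>

lemma sets_P_borel: "sets (P :: ('a::countable \<Rightarrow> real) measure) = sets borel"
proof -
  have "sets P = sets (PiM UNIV (\<lambda>_::'a. borel :: real measure))"
    unfolding P_def by (intro sets_PiM_cong refl sets_mu)
  then show ?thesis by (simp add: sets_PiM_equal_borel)
qed

lemma measurable_coordinate [measurable]: "(\<lambda>w. w x) \<in> borel_measurable P"
proof -
  have "(\<lambda>w. w x) \<in> measurable P \<mu>" unfolding P_def by measurable
  then show ?thesis using measurable_cong_sets[OF refl sets_mu] by blast
qed

section \<open>Resampling a single coordinate\<close>

lemma measurable_update:
  "(\<lambda>(a, w). w(x := a)) \<in> measurable (\<mu> \<Otimes>\<^sub>M P) P"
proof -
  have "(\<lambda>(a, w). w(x := a)) \<in> measurable (\<mu> \<Otimes>\<^sub>M PiM UNIV (\<lambda>_. \<mu>)) (PiM (insert x UNIV) (\<lambda>_. \<mu>))"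
    by measurable
  then show ?thesis by (simp add: P_def)
qed

text \<open>Overwriting one coordinate by an independent copy preserves \<open>P\<close>.
  Independence of the potential enters the later estimates through this identity.\<close>

lemma nn_integral_resample:
  fixes f :: "('a \<Rightarrow> real) \<Rightarrow> ennreal"
  assumes [measurable]: "f \<in> borel_measurable P"
  shows "(\<integral>\<^sup>+w. f w \<partial>P) = (\<integral>\<^sup>+w. (\<integral>\<^sup>+a. f (w(x := a)) \<partial>\<mu>) \<partial>P)"
proof -
  interpret P: prob_space "P :: ('a \<Rightarrow> real) measure" by (rule prob_P)
  interpret pair_sigma_finite \<mu> "P :: ('a \<Rightarrow> real) measure" ..
  note [measurable] = measurable_update[of x]
  have "distr (\<mu> \<Otimes>\<^sub>M PiM UNIV (\<lambda>_::'a. \<mu>)) (PiM (insert x UNIV) (\<lambda>_. \<mu>)) (\<lambda>(a, w). w(x := a))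
      = PiM (insert x UNIV) (\<lambda>_. \<mu>)"
    by (rule distr_pair_PiM_eq_PiM[of UNIV "\<lambda>_. \<mu>" x]) (rule prob_mu)+
  then have distr: "distr (\<mu> \<Otimes>\<^sub>M P) P (\<lambda>(a, w). w(x := a)) = P" by (simp add: P_def)
  have "(\<integral>\<^sup>+w. f w \<partial>P) = (\<integral>\<^sup>+w. f w \<partial>distr (\<mu> \<Otimes>\<^sub>M P) P (\<lambda>(a, w). w(x := a)))"
    by (simp add: distr)
  also have "\<dots> = (\<integral>\<^sup>+p. f (case p of (a, w) \<Rightarrow> w(x := a)) \<partial>(\<mu> \<Otimes>\<^sub>M P))"
    by (rule nn_integral_distr) measurable
  also have "\<dots> = (\<integral>\<^sup>+p. (case p of (a, w) \<Rightarrow> f (w(x := a))) \<partial>(\<mu> \<Otimes>\<^sub>M P))"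
    by (simp add: case_prod_unfold)
  also have "\<dots> = (\<integral>\<^sup>+w. (\<integral>\<^sup>+a. f (w(x := a)) \<partial>\<mu>) \<partial>P)"
    using nn_integral_snd[of "\<lambda>p. case p of (a, w) \<Rightarrow> f (w(x := a))"]
      measurable_compose[OF measurable_update assms] by (simp add: case_prod_unfold)
  finally show ?thesis .
qed

lemma measurable_resample:
  fixes f :: "('a \<Rightarrow> real) \<Rightarrow> 'b"
  assumes "f \<in> measurable P N"
  shows "(\<lambda>a. f (w(x := a))) \<in> measurable \<mu> N"
proof -
  have "(\<lambda>a. (a, w)) \<in> measurable \<mu> (\<mu> \<Otimes>\<^sub>M P)" by (rule measurable_Pair2') (simp add: space_P)
  from measurable_compose[OF this measurable_compose[OF measurable_update assms]]
  show ?thesis by simp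
qed

text \<open>\<open>A\<close> may depend on every coordinate; what counts is a uniform bound on its
  slices in direction \<open>x\<close> while \<open>B\<close> is held fixed. With
  \<open>B = UNIV\<close> this bounds \<open>A\<close> alone.\<close>

lemma emeasure_decouple:
  fixes A B :: "('a \<Rightarrow> real) set"
  assumes [measurable]: "A \<in> sets P" "B \<in> sets P"
    and indep: "\<And>w a. w(x := a) \<in> B \<longleftrightarrow> w \<in> B"
    and bound: "\<And>w. emeasure \<mu> {a. w(x := a) \<in> A} \<le> c"
  shows "emeasure P (A \<inter> B) \<le> c * emeasure P B"
proof -
  have "emeasure P (A \<inter> B) = (\<integral>\<^sup>+w. indicator (A \<inter> B) w \<partial>P)" by simp
  also have "\<dots> = (\<integral>\<^sup>+w. (\<integral>\<^sup>+a. indicator (A \<inter> B) (w(x := a)) \<partial>\<mu>) \<partial>P)"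
    by (rule nn_integral_resample) measurable
  also have "\<dots> \<le> (\<integral>\<^sup>+w. c * indicator B w \<partial>P)"
  proof (rule nn_integral_mono)
    fix w :: "'a \<Rightarrow> real"
    have m: "{a. w(x := a) \<in> A} \<in> sets \<mu>"
      using measurable_sets[OF measurable_resample[OF measurable_ident, of w x] assms(1)]
      by (simp add: space_mu vimage_def)
    have "(\<integral>\<^sup>+a. indicator (A \<inter> B) (w(x := a)) \<partial>\<mu>) = (\<integral>\<^sup>+a. indicator {a. w(x := a) \<in> A} a * indicator B w \<partial>\<mu>)"
      by (intro nn_integral_cong) (auto simp: indicator_def indep)
    also have "\<dots> = emeasure \<mu> {a. w(x := a) \<in> A} * indicator B w"
      using m by (subst nn_integral_multc) auto
    also have "\<dots> \<le> c * indicator B w" by (intro mult_right_mono bound) simp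
    finally show "(\<integral>\<^sup>+a. indicator (A \<inter> B) (w(x := a)) \<partial>\<mu>) \<le> c * indicator B w" .
  qed
  also have "\<dots> = c * emeasure P B" by (rule nn_integral_cmult_indicator) measurable
  finally show ?thesis .
qed

lemma measure_interval_le:
  assumes "0 \<le> r" "2 * r \<le> 1"
  shows "measure \<mu> {a - r..a + r} \<le> K * (2 * r) powr \<alpha>"
  using hoelder[of "2 * r" "a - r"] assms by (simp add: algebra_simps)

lemma measure_mu_point: "measure \<mu> {a} = 0"
  using measure_interval_le[of 0 a] measure_nonneg[of \<mu> "{a}"] by (simp add: alpha)

text \<open>Dyadic shells around \<open>a\<close>: on the shell between radii
  \<open>(1/2) ^ (k+2)\<close> and \<open>(1/2) ^ (k+1)\<close> the integrand is at most
  \<open>2 powr (s * (k + 2))\<close>, and Hoelder continuity bounds the measure by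
  \<open>K * 2 powr (- k * \<alpha>)\<close>. The products form a geometric series of ratio
  \<open>2 powr (s - \<alpha>)\<close>, with a sum that does not depend on \<open>a\<close>.\<close>

lemma fractional_moment_bound:
  assumes s: "0 < s" "s < \<alpha>"
  obtains C where "1 \<le> C" "\<And>a. (\<integral>\<^sup>+t. ennreal (\<bar>t - a\<bar> powr (-s)) \<partial>\<mu>) \<le> ennreal C"
proof -
  define f where "f = (\<lambda>k. 2 powr (s * real (k + 2)) * (K * (2 * (1/2) ^ (k+1)) powr \<alpha>))"
  have f_eq: "f k = 2 powr (2 * s) * K * (2 powr (s - \<alpha>)) ^ k" for k
  proof -
    have "(2 * (1/2) ^ (k+1)) = (2::real) powr (- real k)"
      by (simp add: powr_minus_divide powr_realpow power_one_over)
    then have "(2 * (1/2) ^ (k+1)) powr \<alpha> = (2::real) powr (- real k * \<alpha>)"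
      by (simp add: powr_powr)
    then have "f k = K * (2 powr (s * real (k + 2)) * 2 powr (- real k * \<alpha>))"
      by (simp add: f_def)
    also have "\<dots> = K * (2 powr (s * real (k + 2) + - real k * \<alpha>))"
      by (simp only: powr_add)
    also have "s * real (k + 2) + - real k * \<alpha> = 2 * s + (s - \<alpha>) * real k"
      by (simp add: algebra_simps)
    also have "K * 2 powr (2 * s + (s - \<alpha>) * real k) = 2 powr (2 * s) * K * (2 powr (s - \<alpha>)) ^ k"
    proof -
      have "(2 powr (s - \<alpha>)) ^ k = (2::real) powr ((s - \<alpha>) * real k)"
        by (subst powr_realpow[symmetric]) (simp_all add: powr_powr)
      then show ?thesis by (simp add: powr_add)
    qed
    finally show ?thesis .
  qed
  have "2 powr (s - \<alpha>) < (1::real)" using s powr_less_mono[of "s - \<alpha>" 0 2] by simp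
  then have summable: "summable f" unfolding f_eq by (intro summable_mult summable_geometric) simp
  have f_nonneg: "0 \<le> f k" for k using K_nonneg by (simp add: f_def)
  \<comment> \<open>The summand 1 secures \<open>1 \<le> C\<close>, which lets \<open>C\<close> be
    inserted freely in upper bounds.\<close>
  define C where "C = 2 powr s + 1 + (\<Sum>k. f k)"
  show thesis
  proof
    show "1 \<le> C" using suminf_nonneg[OF summable f_nonneg] by (simp add: C_def)
    fix a :: real
    let ?I = "\<lambda>k. {a - (1/2) ^ (k+1)..a + (1/2) ^ (k+1)}"
    have term_le: "u k \<le> (\<Sum>k. u k)" for u :: "nat \<Rightarrow> ennreal" and k
      using sum_le_suminf[of u "{k}"] by simp
    have pointwise: "ennreal (\<bar>t - a\<bar> powr (-s))
        \<le> ennreal (2 powr s) + (\<Sum>k. ennreal (2 powr (s * real (k + 2))) * indicator (?I k) t)" for t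
    \<comment> \<open>The singular point belongs to the easy case, since
      \<open>0 powr (-s) = 0\<close>.\<close>
    proof (cases "\<bar>t - a\<bar> \<ge> 1/2 \<or> t = a")
      case True
      then have "\<bar>t - a\<bar> powr (-s) \<le> 2 powr s"
      proof
        assume "\<bar>t - a\<bar> \<ge> 1/2"
        then have "\<bar>t - a\<bar> powr (-s) \<le> (1/2) powr (-s)" using s by (intro powr_mono2') auto
        then show ?thesis by (simp add: powr_divide powr_minus_divide)
      qed simp
      then show ?thesis by (intro add_increasing2 ennreal_leI) auto
    next
      case False
      then have r: "0 < \<bar>t - a\<bar>" "\<bar>t - a\<bar> < 1/2" by auto
      \<comment> \<open>The index of the shell containing \<open>t\<close>. As
        \<open>\<bar>t - a\<bar> < 1/2\<close>, the floor is at least 1 and the subtraction on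
        naturals is not truncated.\<close>
      define k where "k = nat \<lfloor>- log 2 \<bar>t - a\<bar>\<rfloor> - 1"
      have "log 2 \<bar>t - a\<bar> < log 2 (1/2)" using r by (subst log_less_cancel_iff) auto
      then have "- log 2 \<bar>t - a\<bar> > 1" by (simp add: log_divide)
      then have k: "real k + 1 \<le> - log 2 \<bar>t - a\<bar>" "- log 2 \<bar>t - a\<bar> < real k + 2"
        unfolding k_def by linarith+
      have "\<bar>t - a\<bar> \<le> 2 powr (- real (k + 1))"
        using k(1) r by (simp add: log_le_iff[symmetric])
      also have "\<dots> = (1/2) ^ (k+1)"
        by (simp only: powr_minus_divide powr_realpow power_one_over)
      finally have "t \<in> ?I k" unfolding atLeastAtMost_iff by linarith
      have "\<bar>t - a\<bar> powr (-s) = 2 powr (- log 2 \<bar>t - a\<bar> * s)"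
        using r powr_powr[of 2 "log 2 \<bar>t - a\<bar>" "-s"] by simp
      also have "\<dots> \<le> 2 powr (s * real (k + 2))"
        using mult_right_mono[OF less_imp_le[OF k(2)], of s] s
        by (intro powr_mono) (simp_all add: ac_simps)
      finally have "ennreal (\<bar>t - a\<bar> powr (-s)) \<le> ennreal (2 powr (s * real (k + 2))) * indicator (?I k) t"
        using \<open>t \<in> ?I k\<close> by (simp add: ennreal_leI)
      also have "\<dots> \<le> (\<Sum>k. ennreal (2 powr (s * real (k + 2))) * indicator (?I k) t)"
        by (rule term_le)
      finally show ?thesis by (intro add_increasing) auto
    qed
    have [measurable]: "?I k \<in> sets \<mu>" for k by (simp add: sets_mu)
    have "(\<integral>\<^sup>+t. ennreal (\<bar>t - a\<bar> powr (-s)) \<partial>\<mu>)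
        \<le> (\<integral>\<^sup>+t. ennreal (2 powr s) + (\<Sum>k. ennreal (2 powr (s * real (k + 2))) * indicator (?I k) t) \<partial>\<mu>)"
      by (intro nn_integral_mono pointwise)
    also have "\<dots> = ennreal (2 powr s) + (\<Sum>k. ennreal (2 powr (s * real (k + 2))) * emeasure \<mu> (?I k))"
    proof -
      have "(\<integral>\<^sup>+t. ennreal (2 powr s) + (\<Sum>k. ennreal (2 powr (s * real (k + 2))) * indicator (?I k) t) \<partial>\<mu>)
          = (\<integral>\<^sup>+t. ennreal (2 powr s) \<partial>\<mu>)
            + (\<integral>\<^sup>+t. (\<Sum>k. ennreal (2 powr (s * real (k + 2))) * indicator (?I k) t) \<partial>\<mu>)"
        by (rule nn_integral_add) measurable
      also have "(\<integral>\<^sup>+t. (\<Sum>k. ennreal (2 powr (s * real (k + 2))) * indicator (?I k) t) \<partial>\<mu>)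
          = (\<Sum>k. (\<integral>\<^sup>+t. ennreal (2 powr (s * real (k + 2))) * indicator (?I k) t \<partial>\<mu>))"
        by (rule nn_integral_suminf) measurable
      also have "\<dots> = (\<Sum>k. ennreal (2 powr (s * real (k + 2))) * emeasure \<mu> (?I k))"
        by (intro suminf_cong nn_integral_cmult_indicator) measurable
      finally show ?thesis by (simp add: mu.emeasure_space_1)
    qed
    also have "\<dots> \<le> ennreal (2 powr s) + (\<Sum>k. ennreal (f k))"
    proof (intro add_left_mono suminf_le)
      fix k :: nat
      have "(1/2 :: real) ^ (k+1) \<le> 1/2" by (simp add: power_le_one)
      then have "measure \<mu> (?I k) \<le> K * (2 * (1/2) ^ (k+1)) powr \<alpha>"
        by (intro measure_interval_le) auto
      then show "ennreal (2 powr (s * real (k + 2))) * emeasure \<mu> (?I k) \<le> ennreal (f k)"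
        unfolding f_def mu.emeasure_eq_measure
        by (subst ennreal_mult'[symmetric]) (auto intro!: ennreal_leI mult_left_mono)
    qed auto
    also have "(\<Sum>k. ennreal (f k)) = ennreal (\<Sum>k. f k)"
      by (rule suminf_ennreal2[OF f_nonneg summable])
    also have "ennreal (2 powr s) + ennreal (\<Sum>k. f k) \<le> ennreal C"
      using suminf_nonneg[OF summable f_nonneg] by (subst ennreal_plus[symmetric]) (auto simp: C_def intro!: ennreal_leI)
    finally show "(\<integral>\<^sup>+t. ennreal (\<bar>t - a\<bar> powr (-s)) \<partial>\<mu>) \<le> ennreal C" .
  qed
qed

end

section \<open>Green functions\<close>

lemma card_remove_less: "finite T \<Longrightarrow> x \<in> T \<Longrightarrow> card T - Suc 0 < card T"
  by (metis One_nat_def card_Diff1_less card_Diff_singleton)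

text \<open>Schur complement at the first argument: the site \<open>x\<close> is removed from \<open>T\<close>, so that
  \<open>green A v T x y\<close> depends on \<open>v x\<close> only through one resonant denominator. Where that
  denominator vanishes, the junk value \<open>1/0 = 0\<close> is taken.\<close>
function green :: "('a \<Rightarrow> 'a \<Rightarrow> real) \<Rightarrow> ('a \<Rightarrow> real) \<Rightarrow> 'a set \<Rightarrow> 'a \<Rightarrow> 'a \<Rightarrow> real" where
  "green A v T x y = (if finite T \<and> x \<in> T then
     (let g = 1 / (v x - (\<Sum>w\<in>T - {x}. \<Sum>w'\<in>T - {x}. A x w * green A v (T - {x}) w w' * A w' x))
      in if y = x then g else - g * (\<Sum>w\<in>T - {x}. A x w * green A v (T - {x}) w y)) else 0)"
  by pat_completeness auto
termination
  by (relation "Wellfounded.measure (\<lambda>(A, v, T, x, y). card T)") (auto simp: card_remove_less)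

declare green.simps [simp del]

definition self_energy :: "('a \<Rightarrow> 'a \<Rightarrow> real) \<Rightarrow> ('a \<Rightarrow> real) \<Rightarrow> 'a set \<Rightarrow> 'a \<Rightarrow> real" where
  "self_energy A v S x = (\<Sum>w\<in>S. \<Sum>w'\<in>S. A x w * green A v S w w' * A w' x)"

text \<open>This asks for nonzero denominators in all subregions, more than invertibility on
  \<open>T\<close>. The quantifier over subsets makes the condition hereditary, as induction over
  regions requires.\<close>

definition nonsingular :: "('a \<Rightarrow> 'a \<Rightarrow> real) \<Rightarrow> ('a \<Rightarrow> real) \<Rightarrow> 'a set \<Rightarrow> bool" where
  "nonsingular A v T \<longleftrightarrow> (\<forall>S\<subseteq>T. \<forall>x\<in>S. v x \<noteq> self_energy A v (S - {x}) x)"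

lemma green_diag:
  assumes "finite T" "x \<in> T"
  shows "green A v T x x = 1 / (v x - self_energy A v (T - {x}) x)"
  using assms by (subst green.simps) (simp add: self_energy_def)

lemma green_offdiag:
  assumes "finite T" "x \<in> T" "y \<noteq> x"
  shows "green A v T x y = - green A v T x x * (\<Sum>w\<in>T - {x}. A x w * green A v (T - {x}) w y)"
  using assms unfolding green_diag[OF assms(1,2)] by (subst green.simps) (simp add: self_energy_def)

lemma green_outside: "x \<notin> T \<Longrightarrow> green A v T x y = 0"
  by (subst green.simps) simp

lemma green_cong:
  assumes "finite T" "\<And>z. z \<in> T \<Longrightarrow> v z = v' z"
  shows "green A v T x y = green A v' T x y"
  using assms
proof (induction "card T" arbitrary: T x y rule: less_induct)
  case less
  show ?case
  proof (cases "x \<in> T")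
    case True
    have IH: "green A v (T - {x}) w w' = green A v' (T - {x}) w w'" for w w'
      using less.prems True by (intro less.hyps) (auto simp: card_remove_less)
    then have "green A v T x x = green A v' T x x"
      using less.prems True by (simp add: green_diag self_energy_def)
    then show ?thesis using less.prems True IH by (cases "y = x") (simp_all add: green_offdiag)
  qed (simp add: green_outside)
qed

lemma self_energy_cong:
  assumes "finite T" "\<And>z. z \<in> T \<Longrightarrow> v z = v' z"
  shows "self_energy A v T x = self_energy A v' T x"
  unfolding self_energy_def using green_cong[of T v v', OF assms] by simp

text \<open>Block elimination, phrased as a left inverse: solve on \<open>T - {x}\<close> with
  \<open>u x\<close> as a source, insert the result into the equation at \<open>x\<close>, and solve
  for \<open>u x\<close>. The coefficient of \<open>u x\<close> is then the reciprocal of the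
  diagonal Green function.\<close>

lemma green_solves:
  assumes T: "finite T" "nonsingular A v T" and diag: "\<And>x. A x x = 0" and x: "x \<in> T"
  shows "u x = (\<Sum>y\<in>T. of_real (green A v T x y) * ham A v T u y)"
  using T x
proof (induction "card T" arbitrary: T x rule: less_induct)
  case less
  note T = less.prems(1,2) and x = less.prems(3)
  let ?S = "T - {x}"
  let ?G = "\<lambda>w y. complex_of_real (green A v ?S w y)" and ?A = "\<lambda>w y. complex_of_real (A w y)"
  let ?f = "ham A v T u"
  have ham_S: "ham A v ?S u w = ?f w - ?A w x * u x" if "w \<in> ?S" for w
    using T x by (simp add: ham_def sum.remove[of T x])
  have IH: "u w = (\<Sum>y\<in>?S. ?G w y * (?f y - ?A y x * u x))" if "w \<in> ?S" for w
  proof -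
    have "u w = (\<Sum>y\<in>?S. ?G w y * ham A v ?S u y)"
      using T x that by (intro less.hyps) (auto simp: card_remove_less nonsingular_def)
    then show ?thesis using ham_S by simp
  qed
  define R where "R = (\<Sum>w\<in>?S. \<Sum>y\<in>?S. ?A x w * ?G w y * ?f y)"
  have "?f x = of_real (v x) * u x + (\<Sum>w\<in>?S. ?A x w * u w)"
    using T x diag by (simp add: ham_def sum.remove[of T x])
  also have "(\<Sum>w\<in>?S. ?A x w * u w) = (\<Sum>w\<in>?S. ?A x w * (\<Sum>y\<in>?S. ?G w y * (?f y - ?A y x * u x)))"
    by (intro sum.cong refl) (subst IH, auto)
  also have "\<dots> = R - of_real (self_energy A v ?S x) * u x"
    by (simp add: R_def self_energy_def sum_distrib_left sum_distrib_right sum_subtractf algebra_simps)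
  finally have "(of_real (v x - self_energy A v ?S x)) * u x = ?f x - R"
    by (simp add: algebra_simps)
  moreover have ne: "v x - self_energy A v ?S x \<noteq> 0" using T x by (auto simp: nonsingular_def)
  ultimately have ux: "u x = of_real (green A v T x x) * (?f x - R)"
    using T x ne of_real_eq_0_iff[where 'a=complex, of "v x - self_energy A v ?S x"]
    by (simp add: green_diag field_simps)
  have "(\<Sum>y\<in>?S. of_real (green A v T x y) * ?f y)
      = (\<Sum>y\<in>?S. - of_real (green A v T x x) * ((\<Sum>w\<in>?S. ?A x w * ?G w y) * ?f y))"
    using T x by (intro sum.cong refl) (simp add: green_offdiag)
  also have "\<dots> = - of_real (green A v T x x) * (\<Sum>y\<in>?S. \<Sum>w\<in>?S. ?A x w * ?G w y * ?f y)"
    unfolding sum_distrib_left[symmetric] sum_distrib_right ..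
  also have "(\<Sum>y\<in>?S. \<Sum>w\<in>?S. ?A x w * ?G w y * ?f y) = R"
    unfolding R_def by (rule sum.swap)
  finally show ?case using T x ux by (simp add: sum.remove[of T x] algebra_simps)
qed

text \<open>Divided by the sum, all terms lie in [0, 1], where lowering the exponent from 1 to
  \<open>s\<close> can only increase them.\<close>

lemma powr_sum_le:
  fixes a :: "'i \<Rightarrow> real"
  assumes s: "0 < s" "s \<le> 1" and a: "\<And>i. i \<in> I \<Longrightarrow> 0 \<le> a i"
  shows "(\<Sum>i\<in>I. a i) powr s \<le> (\<Sum>i\<in>I. a i powr s)"
proof (cases "(\<Sum>i\<in>I. a i) = 0")
  case True
  then show ?thesis by (simp add: sum_nonneg)
next
  case False
  define S where "S = (\<Sum>i\<in>I. a i)"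
  have I: "finite I" using False by (metis sum.infinite)
  have S: "S > 0" using False a sum_nonneg[of I a] by (auto simp: S_def)
  have "1 = (\<Sum>i\<in>I. a i / S)" using S by (simp add: sum_divide_distrib[symmetric] S_def)
  also have "\<dots> \<le> (\<Sum>i\<in>I. (a i / S) powr s)"
  proof (rule sum_mono)
    fix i assume i: "i \<in> I"
    then have "a i \<le> S" unfolding S_def using a I by (intro member_le_sum) auto
    then have "(a i / S) powr 1 \<le> (a i / S) powr s" using a[OF i] S s by (intro powr_mono') auto
    then show "a i / S \<le> (a i / S) powr s" using a[OF i] S by simp
  qed
  also have "\<dots> = (\<Sum>i\<in>I. a i powr s) / S powr s"
    using a S by (simp add: powr_divide sum_divide_distrib)
  finally show ?thesis using S by (simp add: S_def field_simps)
qed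

section \<open>Fractional moments of Green functions\<close>

context iid_potential
begin

lemma measurable_green [measurable]:
  assumes "finite T"
  shows "(\<lambda>w. green A (\<lambda>x. w x - E) T x y) \<in> borel_measurable (P :: ('a \<Rightarrow> real) measure)"
  using assms
proof (induction "card T" arbitrary: T x y rule: less_induct)
  case less
  show ?case
  proof (cases "x \<in> T")
    case True
    have [measurable]: "(\<lambda>w. green A (\<lambda>x. w x - E) (T - {x}) w' y') \<in> borel_measurable P" for w' y'
      using less.prems True by (intro less.hyps) (auto simp: card_remove_less)
    have [measurable]: "(\<lambda>w. green A (\<lambda>x. w x - E) T x x) \<in> borel_measurable P"
      using less.prems True by (simp add: green_diag self_energy_def)
    show ?thesis using less.prems True by (cases "y = x") (simp_all add: green_offdiag)
  qed (simp add: green_outside)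
qed

lemma measurable_self_energy [measurable]:
  assumes "finite T"
  shows "(\<lambda>w. self_energy A (\<lambda>x. w x - E) T x) \<in> borel_measurable (P :: ('a \<Rightarrow> real) measure)"
  unfolding self_energy_def using assms by measurable

lemma green_update:
  assumes "finite T" "z \<notin> T"
  shows "green A (\<lambda>x. (w(z := a)) x - E) T x y = green A (\<lambda>x. w x - E) T x y"
  using assms by (intro green_cong) auto

lemma self_energy_update:
  assumes "finite T" "z \<notin> T"
  shows "self_energy A (\<lambda>x. (w(z := a)) x - E) T x = self_energy A (\<lambda>x. w x - E) T x"
  using assms by (intro self_energy_cong) auto

text \<open>Given the other coordinates, each denominator vanishes for a single value of
  \<open>w x\<close>, and \<mu> has no atoms. There are finitely many pairs of a subregion and a
  site.\<close>

lemma AE_nonsingular: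
  assumes T: "finite T"
  shows "AE w in (P :: ('a \<Rightarrow> real) measure). nonsingular A (\<lambda>x. w x - E) T"
proof -
  have "AE w in (P :: ('a \<Rightarrow> real) measure). w x - E \<noteq> self_energy A (\<lambda>x. w x - E) (S - {x}) x"
    if "S \<subseteq> T" "x \<in> S" for S x
  proof -
    have fin [measurable]: "finite (S - {x})" using T that finite_subset by blast
    let ?N = "{w \<in> space P. w x - E = self_energy A (\<lambda>x. w x - E) (S - {x}) x}"
    have N: "?N \<in> sets P" by measurable
    have "emeasure P (?N \<inter> UNIV) \<le> 0 * emeasure P (UNIV :: ('a \<Rightarrow> real) set)"
    proof (rule emeasure_decouple[OF N])
      fix w :: "'a \<Rightarrow> real"
      have "{a. w(x := a) \<in> ?N} = {E + self_energy A (\<lambda>x. w x - E) (S - {x}) x}"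
        using self_energy_update[OF fin, of x A w _ E x] by (auto simp: space_P algebra_simps)
      then show "emeasure \<mu> {a. w(x := a) \<in> ?N} \<le> 0"
        by (simp add: mu.emeasure_eq_measure measure_mu_point)
    qed (use sets.top[of P] in \<open>auto simp: space_P\<close>)
    then have "emeasure P ?N = 0" by simp
    then show ?thesis using N by (subst AE_iff_measurable[OF N]) auto
  qed
  then have "AE w in (P :: ('a \<Rightarrow> real) measure). \<forall>S\<in>Pow T. \<forall>x\<in>S. w x - E \<noteq> self_energy A (\<lambda>x. w x - E) (S - {x}) x"
    using T by (intro AE_finite_allI) (auto dest: finite_subset)
  then show ?thesis by eventually_elim (auto simp: nonsingular_def)
qed

text \<open>Once the other coordinates are frozen, the diagonal Green function is
  \<open>1 / (t - a)\<close> in the potential value \<open>t\<close> at \<open>x\<close>, and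
  \<open>R\<close> is a constant factor. The moment bound is uniform in \<open>a\<close>.\<close>

lemma nn_integral_green_diag_le:
  fixes R :: "('a \<Rightarrow> real) \<Rightarrow> ennreal"
  assumes C: "\<And>a. (\<integral>\<^sup>+t. ennreal (\<bar>t - a\<bar> powr (-s)) \<partial>\<mu>) \<le> ennreal C"
    and T: "finite T" "x \<in> T" and R: "R \<in> borel_measurable P" "\<And>w a. R (w(x := a)) = R w"
  shows "(\<integral>\<^sup>+w. R w * ennreal (\<bar>green A (\<lambda>x. w x - E) T x x\<bar> powr s) \<partial>P) \<le> ennreal C * (\<integral>\<^sup>+w. R w \<partial>P)"
proof -
  note [measurable] = R(1) and [simp, measurable] = T(1)
  have "(\<integral>\<^sup>+w. R w * ennreal (\<bar>green A (\<lambda>x. w x - E) T x x\<bar> powr s) \<partial>P)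
      = (\<integral>\<^sup>+w. (\<integral>\<^sup>+t. R (w(x := t)) * ennreal (\<bar>green A (\<lambda>z. (w(x := t)) z - E) T x x\<bar> powr s) \<partial>\<mu>) \<partial>P)"
    by (rule nn_integral_resample) measurable
  also have "\<dots> \<le> (\<integral>\<^sup>+w. ennreal C * R w \<partial>P)"
  proof (rule nn_integral_mono)
    fix w :: "'a \<Rightarrow> real"
    define a where "a = E + self_energy A (\<lambda>x. w x - E) (T - {x}) x"
    \<comment> \<open>This includes \<open>t = a\<close>: \<open>1 / 0 = 0\<close> makes the left
      side 0, and \<open>0 powr (-s) = 0\<close> the right side.\<close>
    have "\<bar>green A (\<lambda>z. (w(x := t)) z - E) T x x\<bar> powr s = \<bar>t - a\<bar> powr (-s)" for t
      using T by (simp add: green_diag self_energy_update a_def powr_minus_divide powr_divide diff_diff_eq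
          abs_divide fun_upd_same del: fun_upd_apply)
    then have "(\<integral>\<^sup>+t. R (w(x := t)) * ennreal (\<bar>green A (\<lambda>z. (w(x := t)) z - E) T x x\<bar> powr s) \<partial>\<mu>)
      = (\<integral>\<^sup>+t. R w * ennreal (\<bar>t - a\<bar> powr (-s)) \<partial>\<mu>)" by (simp add: R(2))
    also have "\<dots> = R w * (\<integral>\<^sup>+t. ennreal (\<bar>t - a\<bar> powr (-s)) \<partial>\<mu>)"
      by (rule nn_integral_cmult) (intro borel_measurable_mu, measurable)
    also have "\<dots> \<le> R w * ennreal C" by (intro mult_left_mono C) simp
    finally show "(\<integral>\<^sup>+t. R (w(x := t)) * ennreal (\<bar>green A (\<lambda>z. (w(x := t)) z - E) T x x\<bar> powr s) \<partial>\<mu>) \<le> ennreal C * R w"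
      by (simp add: mult.commute)
  qed
  also have "\<dots> = ennreal C * (\<integral>\<^sup>+w. R w \<partial>P)" by (rule nn_integral_cmult) measurable
  finally show ?thesis .
qed

text \<open>The factor \<open>F\<close> allows the moments of Green functions of disjoint regions to be multiplied.\<close>
lemma nn_integral_green_le:
  fixes F :: "('a \<Rightarrow> real) \<Rightarrow> ennreal" and h :: "'a \<Rightarrow> real"
  assumes C: "\<And>a. (\<integral>\<^sup>+t. ennreal (\<bar>t - a\<bar> powr (-s)) \<partial>\<mu>) \<le> ennreal C" "1 \<le> C"
    and s: "0 < s" "s \<le> 1" and M: "0 \<le> M"
    and F: "F \<in> borel_measurable P"
    and "finite T" "\<And>w z a. z \<in> T \<Longrightarrow> F (w(z := a)) = F w"
    and "\<And>x. x \<in> T \<Longrightarrow> C * (\<Sum>w\<in>T. \<bar>A x w\<bar> powr s) \<le> exp (-M)"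
    and "\<And>x w. x \<in> T \<Longrightarrow> w \<in> T \<Longrightarrow> A x w \<noteq> 0 \<Longrightarrow> h x \<le> h w + 1" and "h y \<le> 0" and "x \<in> T"
  shows "(\<integral>\<^sup>+w. F w * ennreal (\<bar>green A (\<lambda>x. w x - E) T x y\<bar> powr s) \<partial>P)
      \<le> ennreal (C * exp (- M * h x)) * (\<integral>\<^sup>+w. F w \<partial>P)"
  using assms(7-)
proof (induction "card T" arbitrary: T x rule: less_induct)
  case less
  note T = less.prems(1) and F_upd = less.prems(2) and hop = less.prems(3) and h = less.prems(4,5)
    and x = less.prems(6)
  note [measurable] = F and [simp, measurable] = T
  let ?S = "T - {x}" and ?g = "\<lambda>w. ennreal (\<bar>green A (\<lambda>x. w x - E) T x x\<bar> powr s)"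
  let ?G = "\<lambda>z w. \<bar>green A (\<lambda>x. w x - E) ?S z y\<bar> powr s"
  show ?case
  proof (cases "y = x")
    case True
    have "(\<integral>\<^sup>+w. F w * ennreal (\<bar>green A (\<lambda>x. w x - E) T x y\<bar> powr s) \<partial>P) \<le> ennreal C * (\<integral>\<^sup>+w. F w \<partial>P)"
      unfolding True by (rule nn_integral_green_diag_le[OF C(1) T x F]) (rule F_upd[OF x])
    also have "\<dots> \<le> ennreal (C * exp (- M * h x)) * (\<integral>\<^sup>+w. F w \<partial>P)"
      using C(2) M h(2) True by (intro mult_right_mono ennreal_leI) (auto simp: mult_nonneg_nonpos)
    finally show ?thesis .
  next
    case False
    \<comment> \<open>Everything in the estimate that does not involve \<open>w x\<close>: the
      prefactor and the Green functions of \<open>T - {x}\<close>.\<close>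
    define R where "R = (\<lambda>w. F w * (\<Sum>z\<in>?S. ennreal (\<bar>A x z\<bar> powr s) * ennreal (?G z w)))"
    have [measurable]: "R \<in> borel_measurable P" unfolding R_def by measurable
    have split: "\<bar>green A (\<lambda>x. w x - E) T x y\<bar> powr s
        \<le> \<bar>green A (\<lambda>x. w x - E) T x x\<bar> powr s * (\<Sum>z\<in>?S. \<bar>A x z\<bar> powr s * ?G z w)" for w
    proof -
      have "\<bar>\<Sum>z\<in>?S. A x z * green A (\<lambda>x. w x - E) ?S z y\<bar> powr s
          \<le> (\<Sum>z\<in>?S. \<bar>A x z * green A (\<lambda>x. w x - E) ?S z y\<bar>) powr s"
        using s by (intro powr_mono2 sum_abs) auto
      also have "\<dots> \<le> (\<Sum>z\<in>?S. \<bar>A x z * green A (\<lambda>x. w x - E) ?S z y\<bar> powr s)"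
        using s by (intro powr_sum_le) auto
      also have "\<dots> = (\<Sum>z\<in>?S. \<bar>A x z\<bar> powr s * ?G z w)"
        by (simp add: abs_mult powr_mult)
      finally show ?thesis
        using T x False by (simp add: green_offdiag abs_mult powr_mult mult_left_mono)
    qed
    have "(\<integral>\<^sup>+w. F w * ennreal (\<bar>green A (\<lambda>x. w x - E) T x y\<bar> powr s) \<partial>P) \<le> (\<integral>\<^sup>+w. R w * ?g w \<partial>P)"
    proof (rule nn_integral_mono)
      fix w
      have "F w * ennreal (\<bar>green A (\<lambda>x. w x - E) T x y\<bar> powr s)
          \<le> F w * ennreal (\<bar>green A (\<lambda>x. w x - E) T x x\<bar> powr s * (\<Sum>z\<in>?S. \<bar>A x z\<bar> powr s * ?G z w))"
        by (intro mult_left_mono ennreal_leI split) simp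
      also have "\<dots> = R w * ?g w"
        by (simp add: R_def ennreal_mult sum_nonneg sum_ennreal[symmetric] ac_simps del: sum_ennreal)
      finally show "F w * ennreal (\<bar>green A (\<lambda>x. w x - E) T x y\<bar> powr s) \<le> R w * ?g w" .
    qed
    also have "\<dots> \<le> ennreal C * (\<integral>\<^sup>+w. R w \<partial>P)"
      by (rule nn_integral_green_diag_le[OF C(1) T x])
        (simp_all add: R_def F_upd[OF x] green_update del: fun_upd_apply)
    also have "(\<integral>\<^sup>+w. R w \<partial>P) = (\<Sum>z\<in>?S. ennreal (\<bar>A x z\<bar> powr s) * (\<integral>\<^sup>+w. F w * ennreal (?G z w) \<partial>P))"
      by (simp add: R_def sum_distrib_left nn_integral_sum nn_integral_cmult[symmetric] ac_simps)
    also have "\<dots> \<le> (\<Sum>z\<in>?S. ennreal (\<bar>A x z\<bar> powr s) * (ennreal (C * exp (- M * (h x - 1))) * (\<integral>\<^sup>+w. F w \<partial>P)))"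
    proof (rule sum_mono)
      fix z assume z: "z \<in> ?S"
      show "ennreal (\<bar>A x z\<bar> powr s) * (\<integral>\<^sup>+w. F w * ennreal (?G z w) \<partial>P)
        \<le> ennreal (\<bar>A x z\<bar> powr s) * (ennreal (C * exp (- M * (h x - 1))) * (\<integral>\<^sup>+w. F w \<partial>P))"
      \<comment> \<open>Only an actual hop compares \<open>h z\<close> with \<open>h x\<close>; the
        remaining terms vanish.\<close>
      proof (cases "A x z = 0")
        case False
        have sub: "C * (\<Sum>w\<in>?S. \<bar>A t w\<bar> powr s) \<le> exp (-M)" if "t \<in> ?S" for t
        proof -
          have "C * (\<Sum>w\<in>?S. \<bar>A t w\<bar> powr s) \<le> C * (\<Sum>w\<in>T. \<bar>A t w\<bar> powr s)"
            using C(2) by (intro mult_left_mono sum_mono2) auto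
          then show ?thesis using hop[of t] that by simp
        qed
        have "(\<integral>\<^sup>+w. F w * ennreal (?G z w) \<partial>P) \<le> ennreal (C * exp (- M * h z)) * (\<integral>\<^sup>+w. F w \<partial>P)"
          using z x h F_upd by (intro less.hyps sub) (auto simp: card_remove_less)
        also have "\<dots> \<le> ennreal (C * exp (- M * (h x - 1))) * (\<integral>\<^sup>+w. F w \<partial>P)"
          using C(2) M h(1)[of x z] x z False
          by (intro mult_right_mono ennreal_leI mult_left_mono) (auto intro: mult_left_mono)
        finally show ?thesis by (intro mult_left_mono) auto
      qed simp
    qed
    also have "\<dots> = ennreal (\<Sum>z\<in>?S. \<bar>A x z\<bar> powr s) * (ennreal (C * exp (- M * (h x - 1))) * (\<integral>\<^sup>+w. F w \<partial>P))"
      by (simp add: sum_distrib_right[symmetric] sum_ennreal)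
    finally have "(\<integral>\<^sup>+w. F w * ennreal (\<bar>green A (\<lambda>x. w x - E) T x y\<bar> powr s) \<partial>P)
      \<le> ennreal C * (ennreal (\<Sum>z\<in>?S. \<bar>A x z\<bar> powr s) * (ennreal (C * exp (- M * (h x - 1))) * (\<integral>\<^sup>+w. F w \<partial>P)))"
      by (simp add: mult_left_mono)
    also have "\<dots> = ennreal (C * (\<Sum>z\<in>?S. \<bar>A x z\<bar> powr s) * (C * exp (- M * (h x - 1)))) * (\<integral>\<^sup>+w. F w \<partial>P)"
      using C(2) by (simp add: ennreal_mult sum_nonneg mult.assoc)
    also have "\<dots> \<le> ennreal (C * exp (- M * h x)) * (\<integral>\<^sup>+w. F w \<partial>P)"
    proof (intro mult_right_mono ennreal_leI)
      have "C * (\<Sum>z\<in>?S. \<bar>A x z\<bar> powr s) \<le> C * (\<Sum>z\<in>T. \<bar>A x z\<bar> powr s)"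
        using C(2) by (intro mult_left_mono sum_mono2) auto
      also have "\<dots> \<le> exp (-M)" by (rule hop[OF x])
      finally have "C * (\<Sum>z\<in>?S. \<bar>A x z\<bar> powr s) * (C * exp (- M * (h x - 1))) \<le> exp (-M) * (C * exp (- M * (h x - 1)))"
        using C(2) by (intro mult_right_mono) auto
      \<comment> \<open>The factor \<open>exp (-M)\<close> supplied by one hop exactly restores the
        unit of \<open>h\<close> lost by that hop.\<close>
      also have "\<dots> = C * exp (- M * h x)" by (simp add: exp_add[symmetric] algebra_simps)
      finally show "C * (\<Sum>z\<in>?S. \<bar>A x z\<bar> powr s) * (C * exp (- M * (h x - 1))) \<le> C * exp (- M * h x)" .
    qed simp
    finally show ?thesis .
  qed
qed

end

section \<open>Eigenvalue spacing\<close>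

text \<open>Tube lemma: projecting along a compact factor preserves closedness. It removes the
  existential quantifier over eigenvectors or bases.\<close>

lemma closed_projection:
  fixes S :: "('a::topological_space \<times> 'b::topological_space) set"
  assumes "compact K" "closed S"
  shows "closed {x. \<exists>u\<in>K. (x, u) \<in> S}"
proof -
  have "open (- {x. \<exists>u\<in>K. (x, u) \<in> S})"
  proof (rule topological_space_class.openI)
    fix x assume "x \<in> - {x. \<exists>u\<in>K. (x, u) \<in> S}"
    then have "{x} \<times> K \<subseteq> - S" by auto
    moreover have "open (- S)" using assms(2) by (rule open_Compl)
    ultimately obtain U where U: "x \<in> U" "open U" "U \<times> K \<subseteq> - S"
      using Elementary_Topology.tube_lemma[OF assms(1) \<open>open (- S)\<close> \<open>{x} \<times> K \<subseteq> - S\<close>] by auto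
    then have "U \<subseteq> - {x. \<exists>u\<in>K. (x, u) \<in> S}" by auto
    then show "\<exists>U. open U \<and> x \<in> U \<and> U \<subseteq> - {x. \<exists>u\<in>K. (x, u) \<in> S}" using U by auto
  qed
  then show ?thesis by (simp add: closed_def)
qed

text \<open>All inequalities are non-strict, so that the set is closed. The weight \<open>c\<close>
  at \<open>x\<close> makes the approximate eigenvalue sensitive to \<open>w x\<close>; otherwise a
  change there could go unnoticed.\<close>

definition resonant :: "('a \<Rightarrow> 'a \<Rightarrow> real) \<Rightarrow> 'a set \<Rightarrow> real \<Rightarrow> real \<Rightarrow> real \<Rightarrow> 'a \<Rightarrow> ('a \<Rightarrow> real) set" where
  "resonant A T E \<delta> c x = {w. \<exists>u. (\<forall>z. z \<notin> T \<longrightarrow> u z = 0) \<and> sqnorm T u = 1 \<and> c \<le> cmod (u x) \<and>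
     sqnorm T (\<lambda>z. ham A w T u z - of_real E * u z) \<le> \<delta>\<^sup>2}"

lemma continuous_on_fst_coordinate [continuous_intros]:
  "continuous_on S (\<lambda>p. (fst p :: 'a \<Rightarrow> 'b::topological_space) z)"
  by (rule continuous_on_product_then_coordinatewise[OF continuous_on_fst[OF continuous_on_id]])

lemma continuous_on_snd_coordinate [continuous_intros]:
  "continuous_on S (\<lambda>p. (snd p :: 'a \<Rightarrow> 'b::topological_space) z)"
  by (rule continuous_on_product_then_coordinatewise[OF continuous_on_snd[OF continuous_on_id]])

lemma compact_unit_box:
  "compact {u :: 'a \<Rightarrow> complex. \<forall>z. u z \<in> (if z \<in> T then cball 0 1 else {0})}"
  by (intro compact_function_box) auto

lemma unit_vector_in_box:
  assumes "finite T" "\<And>z. z \<notin> T \<Longrightarrow> u z = 0" "sqnorm T u = 1"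
  shows "u z \<in> (if z \<in> T then cball 0 1 else {0})"
  using norm_le_sqnorm[OF assms(1), of z u] assms(2,3) by (auto simp: power_le_one_iff)

lemma closed_resonant:
  assumes T: "finite T"
  shows "closed (resonant A T E \<delta> c x)"
proof -
  let ?K = "{u :: 'a \<Rightarrow> complex. \<forall>z. u z \<in> (if z \<in> T then cball 0 1 else {0})}"
  let ?S = "{p :: ('a \<Rightarrow> real) \<times> ('a \<Rightarrow> complex). sqnorm T (snd p) = 1} \<inter> {p. c \<le> cmod (snd p x)} \<inter>
     {p. sqnorm T (\<lambda>z. ham A (fst p) T (snd p) z - of_real E * snd p z) \<le> \<delta>\<^sup>2}"
  have "closed ?S"
    unfolding sqnorm_def ham_def
    by (intro closed_Int closed_Collect_eq closed_Collect_le continuous_intros)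
  then have "closed {w. \<exists>u\<in>?K. (w, u) \<in> ?S}"
    by (intro closed_projection compact_unit_box)
  moreover have "resonant A T E \<delta> c x = {w. \<exists>u\<in>?K. (w, u) \<in> ?S}"
  proof (intro set_eqI iffI)
    fix w assume "w \<in> resonant A T E \<delta> c x"
    then obtain u :: "'a \<Rightarrow> complex" where u: "\<And>z. z \<notin> T \<Longrightarrow> u z = 0" "sqnorm T u = 1" "c \<le> cmod (u x)"
        "sqnorm T (\<lambda>z. ham A w T u z - of_real E * u z) \<le> \<delta>\<^sup>2"
      unfolding resonant_def by blast
    have "u \<in> ?K" using unit_vector_in_box[OF T u(1,2)] by blast
    moreover have "(w, u) \<in> ?S" using u by simp
    ultimately show "w \<in> {w. \<exists>u\<in>?K. (w, u) \<in> ?S}" by blast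
  next
    fix w assume "w \<in> {w. \<exists>u\<in>?K. (w, u) \<in> ?S}"
    then obtain u where u: "u \<in> ?K" "(w, u) \<in> ?S" by blast
    have "u z = 0" if "z \<notin> T" for z
    proof -
      have "u z \<in> (if z \<in> T then cball 0 1 else {0})" using u(1) by blast
      then show ?thesis using that by simp
    qed
    then show "w \<in> resonant A T E \<delta> c x" using u(2) by (auto simp: resonant_def)
  qed
  ultimately show ?thesis by simp
qed

lemma resonant_cong:
  assumes "\<And>z. z \<in> T \<Longrightarrow> w z = w' z"
  shows "w \<in> resonant A T E \<delta> c x \<longleftrightarrow> w' \<in> resonant A T E \<delta> c x"
proof -
  have "ham A w T u z = ham A w' T u z" if "z \<in> T" for u z using assms[OF that] by (simp add: ham_def)
  then have "sqnorm T (\<lambda>z. ham A w T u z - of_real E * u z) = sqnorm T (\<lambda>z. ham A w' T u z - of_real E * u z)" for u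
    by (simp add: sqnorm_def)
  then show ?thesis by (simp add: resonant_def)
qed

text \<open>Pairing the two approximate eigenvector equations with each other leaves only
  \<open>(a - b) u(x) v(x)\<close> of the difference of the operators.\<close>
lemma resonant_diameter:
  assumes T: "finite T" "x \<in> T" and sym: "\<And>x y. A x y = A y x" and nonneg: "0 \<le> \<delta>" "0 \<le> c"
    and a: "w(x := a) \<in> resonant A T E \<delta> c x" and b: "w(x := b) \<in> resonant A T E \<delta> c x"
  shows "\<bar>a - b\<bar> * c\<^sup>2 \<le> 2 * \<delta>"
proof -
  let ?r = "\<lambda>a u z. ham A (w(x := a)) T u z - of_real E * u z"
  from a obtain u where u: "sqnorm T u = 1" "c \<le> cmod (u x)" "sqnorm T (?r a u) \<le> \<delta>\<^sup>2"
    by (auto simp: resonant_def)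
  from b obtain v where v: "sqnorm T v = 1" "c \<le> cmod (v x)" "sqnorm T (?r b v) \<le> \<delta>\<^sup>2"
    by (auto simp: resonant_def)
  have "ip T (ham A (w(x := a)) T u) v - ip T (ham A (w(x := b)) T u) v
      = (\<Sum>z\<in>T. if z = x then of_real (a - b) * u x * cnj (v x) else 0)"
    unfolding ip_def sum_subtractf[symmetric] by (intro sum.cong refl) (simp add: ham_def algebra_simps)
  then have eq: "of_real (a - b) * u x * cnj (v x) = ip T (?r a u) v - ip T u (?r b v)"
    using T by (simp add: ip_diff_left ip_diff_right ip_scale_left ip_scale_right ip_ham_left[OF sym])
  have sqrt_le: "sqrt (sqnorm T f) \<le> \<delta>" if "sqnorm T f \<le> \<delta>\<^sup>2" for f
    using that nonneg by (simp add: real_le_lsqrt sqnorm_nonneg)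
  have "\<bar>a - b\<bar> * c\<^sup>2 \<le> \<bar>a - b\<bar> * (cmod (u x) * cmod (v x))"
    using u v nonneg by (intro mult_left_mono) (auto simp: power2_eq_square intro!: mult_mono)
  also have "\<dots> = cmod (of_real (a - b) * u x * cnj (v x))"
    unfolding norm_mult norm_of_real by simp
  also have "\<dots> \<le> cmod (ip T (?r a u) v) + cmod (ip T u (?r b v))"
    unfolding eq by (rule norm_triangle_ineq4)
  also have "\<dots> \<le> \<delta> * 1 + 1 * \<delta>"
    using norm_ip_le[of T "?r a u" v] norm_ip_le[of T u "?r b v"] sqrt_le[OF u(3)] sqrt_le[OF v(3)] u(1) v(1)
    by (intro add_mono) auto
  finally show ?thesis by simp
qed

lemma sqnorm_combination:
  assumes "sqnorm T u = 1" "sqnorm T v = 1" "ip T u v = 0"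
  shows "sqnorm T (\<lambda>z. a * u z + b * v z) = (cmod a)\<^sup>2 + (cmod b)\<^sup>2"
proof -
  have "ip T v u = 0" using assms(3) ip_eq_0_commute by blast
  then have "ip T (\<lambda>z. a * u z + b * v z) (\<lambda>z. a * u z + b * v z) = a * cnj a + b * cnj b"
    using assms by (simp add: ip_add_left ip_add_right ip_scale_left ip_scale_right ip_self)
  then have "complex_of_real (sqnorm T (\<lambda>z. a * u z + b * v z)) = of_real ((cmod a)\<^sup>2 + (cmod b)\<^sup>2)"
    by (simp add: ip_self complex_norm_square del: of_real_power)
  then show ?thesis using of_real_eq_iff by blast
qed

text \<open>From two orthogonal approximate eigenvectors one can form a combination vanishing at \<open>x\<close>,
  which is an approximate eigenvector of the operator with the site \<open>x\<close> removed.\<close>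
lemma two_eigenvectors_resonant:
  assumes T: "finite T" and u: "sqnorm T u = 1" "\<And>z. z \<notin> T \<Longrightarrow> u z = 0" and v: "sqnorm T v = 1" "\<And>z. z \<notin> T \<Longrightarrow> v z = 0"
    and orth: "ip T u v = 0"
    and eig: "\<And>z. z \<in> T \<Longrightarrow> ham A w T u z = of_real l * u z" "\<And>z. z \<in> T \<Longrightarrow> ham A w T v z = of_real l' * v z"
    and near: "\<bar>l - E\<bar> \<le> \<delta>" "\<bar>l' - E\<bar> \<le> \<delta>"
  obtains x y where "x \<in> T" "y \<in> T - {x}" "w \<in> resonant A T E \<delta> (1 / sqrt (card T)) x"
    "w \<in> resonant A (T - {x}) E \<delta> (1 / sqrt (card T)) y"
proof -
  obtain x where x: "x \<in> T" "1 / sqrt (card T) \<le> cmod (u x)"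
    using exists_large_coordinate[OF T u(1)] by blast
  have "card T > 0" using x(1) T by (auto simp: card_gt_0_iff)
  then have "0 < 1 / sqrt (card T)" by simp
  then have ux: "cmod (u x) > 0" using x(2) by linarith
  have sq_le: "(cmod (of_real (l - E)))\<^sup>2 \<le> \<delta>\<^sup>2" "(cmod (of_real (l' - E)))\<^sup>2 \<le> \<delta>\<^sup>2"
    using near by (simp_all only: norm_of_real abs_le_square_iff[symmetric])
  have "sqnorm T (\<lambda>z. ham A w T u z - of_real E * u z) = sqnorm T (\<lambda>z. of_real (l - E) * u z)"
    using eig by (simp add: sqnorm_def algebra_simps)
  then have res1: "w \<in> resonant A T E \<delta> (1 / sqrt (card T)) x"
    unfolding resonant_def mem_Collect_eq using u x sq_le(1)
    by (intro exI[of _ u] conjI allI impI) (simp_all add: sqnorm_scale)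
  define N where "N = sqrt ((cmod (v x))\<^sup>2 + (cmod (u x))\<^sup>2)"
  have N: "N > 0" "N\<^sup>2 = (cmod (v x))\<^sup>2 + (cmod (u x))\<^sup>2" using ux by (simp_all add: N_def add_nonneg_pos)
  \<comment> \<open>Coefficients proportional to \<open>(v x, - u x)\<close> cancel the value at
    \<open>x\<close>; division by \<open>N\<close> makes the coefficient vector a unit
    vector.\<close>
  define a b where "a = v x / of_real N" and "b = - u x / of_real N"
  define f where "f = (\<lambda>z. a * u z + b * v z)"
  have ab: "(cmod a)\<^sup>2 + (cmod b)\<^sup>2 = 1"
    using N ux by (simp add: a_def b_def norm_divide power_divide add_divide_distrib[symmetric])
  have fx: "f x = 0" by (simp add: f_def a_def b_def)
  have remove: "sqnorm (T - {x}) g = sqnorm T g - (cmod (g x))\<^sup>2" for g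
    using T x by (simp add: sqnorm_def sum.remove)
  have f1: "sqnorm (T - {x}) f = 1"
    using sqnorm_combination[OF u(1) v(1) orth, of a b] ab fx by (simp add: remove f_def[symmetric])
  \<comment> \<open>Since \<open>f x = 0\<close>, dropping \<open>x\<close> from the operator alters
    nothing at the other sites.\<close>
  have "sqnorm (T - {x}) (\<lambda>z. ham A w (T - {x}) f z - of_real E * f z)
      = sqnorm (T - {x}) (\<lambda>z. ham A w T f z - of_real E * f z)"
    using T x fx by (simp add: ham_def sum.remove[of T x])
  also have "\<dots> \<le> sqnorm T (\<lambda>z. ham A w T f z - of_real E * f z)" by (simp add: remove)
  \<comment> \<open>The two errors are multiples of the orthogonal vectors \<open>u\<close> and
    \<open>v\<close>, so their squares add and the tolerance remains \<delta>.\<close>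
  also have "\<dots> = sqnorm T (\<lambda>z. (of_real (l - E) * a) * u z + (of_real (l' - E) * b) * v z)"
    using eig by (simp add: sqnorm_def f_def ham_add ham_scale algebra_simps)
  also have "\<dots> = (cmod (of_real (l - E)))\<^sup>2 * (cmod a)\<^sup>2 + (cmod (of_real (l' - E)))\<^sup>2 * (cmod b)\<^sup>2"
    by (simp only: sqnorm_combination[OF u(1) v(1) orth] norm_mult power_mult_distrib)
  also have "\<dots> \<le> \<delta>\<^sup>2 * (cmod a)\<^sup>2 + \<delta>\<^sup>2 * (cmod b)\<^sup>2"
    by (intro add_mono mult_right_mono sq_le) auto
  also have "\<dots> = \<delta>\<^sup>2" using ab by (simp add: distrib_left[symmetric])
  finally have f2: "sqnorm (T - {x}) (\<lambda>z. ham A w (T - {x}) f z - of_real E * f z) \<le> \<delta>\<^sup>2" .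
  obtain y where y: "y \<in> T - {x}" "1 / sqrt (card (T - {x})) \<le> cmod (f y)"
    using exists_large_coordinate[of "T - {x}" f] T f1 by auto
  have "0 < card (T - {x})" using y(1) T by (auto simp: card_gt_0_iff)
  moreover have "card (T - {x}) \<le> card T" using T by (intro card_mono) auto
  ultimately have "1 / sqrt (card T) \<le> 1 / sqrt (card (T - {x}))" by (intro divide_left_mono) auto
  then have "w \<in> resonant A (T - {x}) E \<delta> (1 / sqrt (card T)) y"
    using y f1 f2 u(2) v(2) fx by (auto simp: resonant_def f_def intro!: exI[of _ f])
  then show thesis using that x y res1 by blast
qed

section \<open>Probability of small gaps\<close>

context iid_potential
begin

lemma sets_resonant [measurable]:
  fixes A :: "'a::countable \<Rightarrow> 'a \<Rightarrow> real"
  shows "finite T \<Longrightarrow> resonant A T E \<delta> c x \<in> sets P"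
  unfolding sets_P_borel by (intro borel_closed closed_resonant)

text \<open>With squared weight \<open>1 / n\<close>, \<open>resonant_diameter\<close> puts the
  slice within distance \<open>2 * \<delta> * n\<close> of any one of its points, hence in an
  interval of length \<open>4 * \<delta> * n\<close>.\<close>

lemma emeasure_resonant_slice_le:
  fixes n :: nat and \<delta> :: real
  assumes T: "finite T" "x \<in> T" and sym: "\<And>x y. A x y = A y x" and n: "n > 0" and \<delta>: "0 \<le> \<delta>" "4 * \<delta> * n \<le> 1"
  shows "emeasure \<mu> {a. w(x := a) \<in> resonant A T E \<delta> (1 / sqrt (n)) x}
     \<le> ennreal (K * (4 * \<delta> * n) powr \<alpha>)"
proof (cases "{a. w(x := a) \<in> resonant A T E \<delta> (1 / sqrt (n)) x} = {}")
  case True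
  then show ?thesis by (metis emeasure_empty zero_le)
next
  case False
  then obtain b where b: "w(x := b) \<in> resonant A T E \<delta> (1 / sqrt (n)) x" by blast
  define r where "r = 2 * \<delta> * n"
  have "{a. w(x := a) \<in> resonant A T E \<delta> (1 / sqrt (n)) x} \<subseteq> {b - r..b + r}"
  proof (intro subsetI)
    fix a assume "a \<in> {a. w(x := a) \<in> resonant A T E \<delta> (1 / sqrt (n)) x}"
    then have "\<bar>a - b\<bar> * (1 / sqrt (n))\<^sup>2 \<le> 2 * \<delta>"
      using b by (intro resonant_diameter[where A = A, OF T sym \<delta>(1)]) auto
    then have "\<bar>a - b\<bar> \<le> r" using n by (simp add: r_def power_divide field_simps)
    then show "a \<in> {b - r..b + r}" unfolding atLeastAtMost_iff by linarith
  qed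
  then have "emeasure \<mu> {a. w(x := a) \<in> resonant A T E \<delta> (1 / sqrt (n)) x} \<le> emeasure \<mu> {b - r..b + r}"
    by (intro emeasure_mono) (simp_all add: sets_mu)
  also have "\<dots> \<le> ennreal (K * (2 * r) powr \<alpha>)"
    unfolding mu.emeasure_eq_measure using \<delta> by (intro ennreal_leI measure_interval_le) (auto simp: r_def)
  finally show ?thesis by (simp add: r_def mult.assoc)
qed

text \<open>The resonance of \<open>T - {x}\<close> does not see \<open>w x\<close>. It is held
  fixed while \<open>w x\<close> is resampled, and is then estimated by resampling
  \<open>w y\<close>. The resulting power \<delta> to the \<open>2 * \<alpha>\<close> outweighs the
  number of energies, of order \<open>1 / \<delta>\<close>.\<close>

lemma emeasure_two_resonances_le:
  fixes A :: "'a::countable \<Rightarrow> 'a \<Rightarrow> real" and n :: nat and \<delta> :: real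
  assumes T: "finite T" "x \<in> T" "y \<in> T - {x}" and sym: "\<And>x y. A x y = A y x" and n: "n > 0"
    and \<delta>: "0 \<le> \<delta>" "4 * \<delta> * n \<le> 1"
  shows "emeasure P (resonant A T E \<delta> (1 / sqrt n) x \<inter> resonant A (T - {x}) E \<delta> (1 / sqrt n) y)
     \<le> ennreal ((K * (4 * \<delta> * n) powr \<alpha>)\<^sup>2)"
proof -
  interpret P: prob_space "P :: ('a \<Rightarrow> real) measure" by (rule prob_P)
  let ?k = "ennreal (K * (4 * \<delta> * n) powr \<alpha>)"
  have fin: "finite (T - {x})" using T by simp
  have "emeasure P (resonant A (T - {x}) E \<delta> (1 / sqrt n) y \<inter> (UNIV :: ('a \<Rightarrow> real) set)) \<le> ?k * emeasure P (UNIV :: ('a \<Rightarrow> real) set)"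
    using emeasure_resonant_slice_le[OF fin T(3) sym n \<delta>] sets.top[of "P :: ('a \<Rightarrow> real) measure"]
    by (intro emeasure_decouple[where x = y] sets_resonant fin) (auto simp: space_P)
  then have B: "emeasure P (resonant A (T - {x}) E \<delta> (1 / sqrt n) y) \<le> ?k"
    using P.emeasure_space_1 by (simp add: space_P)
  have "emeasure P (resonant A T E \<delta> (1 / sqrt n) x \<inter> resonant A (T - {x}) E \<delta> (1 / sqrt n) y)
      \<le> ?k * emeasure P (resonant A (T - {x}) E \<delta> (1 / sqrt n) y)"
    by (rule emeasure_decouple[where x = x, OF sets_resonant[OF T(1)] sets_resonant[OF fin]
          resonant_cong emeasure_resonant_slice_le[OF T(1,2) sym n \<delta>]]) auto
  also have "\<dots> \<le> ?k * ?k" by (intro mult_left_mono B) simp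
  also have "\<dots> = ennreal ((K * (4 * \<delta> * n) powr \<alpha>)\<^sup>2)"
    using K_nonneg by (simp add: ennreal_mult[symmetric] power2_eq_square)
  finally show ?thesis .
qed

text \<open>If the gap is below \<delta>, the grid point below \<open>l\<close> is within
  \<open>2 * \<delta>\<close> of both eigenvalues, whence the tolerance \<open>2 * \<delta>\<close>.
  \<open>S\<close> depends neither on the eigenvectors nor on the eigenvalues, so it serves all
  pairs simultaneously.\<close>

lemma eigenvalue_spacing:
  fixes A :: "'a::countable \<Rightarrow> 'a \<Rightarrow> real" and n :: nat and \<delta> :: real
  assumes T: "finite T" and sym: "\<And>x y. A x y = A y x" and n: "n = card T"
    and \<delta>: "0 < \<delta>" "8 * \<delta> * n \<le> 1" and B: "0 \<le> B"
  obtains S where "S \<in> sets P" "emeasure P S \<le> ennreal ((2 * B / \<delta> + 5) * (real n)\<^sup>2 * (K * (8 * \<delta> * n) powr \<alpha>)\<^sup>2)"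
    "\<And>w u v l l'. w \<notin> S \<Longrightarrow> sqnorm T u = 1 \<Longrightarrow> (\<And>z. z \<notin> T \<Longrightarrow> u z = 0) \<Longrightarrow> sqnorm T v = 1 \<Longrightarrow>
      (\<And>z. z \<notin> T \<Longrightarrow> v z = 0) \<Longrightarrow> ip T u v = 0 \<Longrightarrow>
      (\<And>z. z \<in> T \<Longrightarrow> ham A w T u z = of_real l * u z) \<Longrightarrow>
      (\<And>z. z \<in> T \<Longrightarrow> ham A w T v z = of_real l' * v z) \<Longrightarrow> \<bar>l\<bar> \<le> B \<Longrightarrow> \<delta> \<le> \<bar>l - l'\<bar>"
proof -
  \<comment> \<open>The index \<open>k\<close> used below is a floor and may undershoot
    \<open>- B / \<delta>\<close> by less than one; hence the added 1.\<close>
  define N where "N = \<lceil>B / \<delta>\<rceil> + 1"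
  let ?R = "\<lambda>k x y. resonant A T (of_int k * \<delta>) (2 * \<delta>) (1 / sqrt n) x
      \<inter> resonant A (T - {x}) (of_int k * \<delta>) (2 * \<delta>) (1 / sqrt n) y"
  define S where "S = (\<Union>k\<in>{-N..N}. \<Union>x\<in>T. \<Union>y\<in>T - {x}. ?R k x y)"
  let ?p = "(K * (8 * \<delta> * n) powr \<alpha>)\<^sup>2"
  have fin: "finite (T - {x})" for x using T by simp
  have N: "0 \<le> N" "real_of_int N \<le> B / \<delta> + 2"
  proof -
    have "0 \<le> B / \<delta>" using B \<delta>(1) by simp
    then show "0 \<le> N" "real_of_int N \<le> B / \<delta> + 2" unfolding N_def by linarith+
  qed
  show thesis
  proof
    show "S \<in> sets P" unfolding S_def
      by (intro sets.finite_UN sets.Int sets_resonant fin T) auto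
    have R: "emeasure P (?R k x y) \<le> ennreal ?p" if xy: "x \<in> T" "y \<in> T - {x}" for k x y
    proof -
      have "n > 0" unfolding n using xy T by (auto simp: card_gt_0_iff)
      from emeasure_two_resonances_le[where A = A and \<delta> = "2 * \<delta>" and E = "of_int k * \<delta>", OF T xy sym this] \<delta>
      show ?thesis by simp
    qed
    have "emeasure P S \<le> (\<Sum>k\<in>{-N..N}. emeasure P (\<Union>x\<in>T. \<Union>y\<in>T - {x}. ?R k x y))"
      unfolding S_def by (intro emeasure_subadditive_finite)
        (auto intro!: sets.finite_UN sets.Int sets_resonant fin T)
    also have "\<dots> \<le> (\<Sum>k\<in>{-N..N}. \<Sum>x\<in>T. emeasure P (\<Union>y\<in>T - {x}. ?R k x y))"
      by (intro sum_mono emeasure_subadditive_finite)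
        (auto intro!: sets.finite_UN sets.Int sets_resonant fin T)
    also have "\<dots> \<le> (\<Sum>k\<in>{-N..N}. \<Sum>x\<in>T. \<Sum>y\<in>T - {x}. emeasure P (?R k x y))"
      by (intro sum_mono emeasure_subadditive_finite)
        (auto intro!: sets.finite_UN sets.Int sets_resonant fin T)
    also have "\<dots> \<le> (\<Sum>k\<in>{-N..N}. \<Sum>x\<in>T. \<Sum>y\<in>T - {x}. ennreal ?p)"
      by (intro sum_mono R)
    also have "\<dots> \<le> (\<Sum>k\<in>{-N..N}. \<Sum>x\<in>T. \<Sum>y\<in>T. ennreal ?p)"
      by (intro sum_mono sum_mono2 T) auto
    also have "\<dots> = (\<Sum>k\<in>{-N..N}. \<Sum>x\<in>T. \<Sum>y\<in>T. ?p)" by (simp add: sum_ennreal sum_nonneg del: sum_constant)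
    also have "(\<Sum>k\<in>{-N..N}. \<Sum>x\<in>T. \<Sum>y\<in>T. ?p) = real_of_int (2 * N + 1) * (real n)\<^sup>2 * ?p"
      using N(1) by (simp add: n power2_eq_square of_nat_nat)
    also have "ennreal \<dots> \<le> ennreal ((2 * B / \<delta> + 5) * (real n)\<^sup>2 * ?p)"
      using N(2) by (intro ennreal_leI mult_right_mono) auto
    finally show "emeasure P S \<le> ennreal ((2 * B / \<delta> + 5) * (real n)\<^sup>2 * ?p)" .
  next
    fix w u v l l'
    assume notin: "w \<notin> S" and u: "sqnorm T u = 1" "\<And>z. z \<notin> T \<Longrightarrow> u z = 0" and v: "sqnorm T v = 1" "\<And>z. z \<notin> T \<Longrightarrow> v z = 0"
      and orth: "ip T u v = 0" and eig: "\<And>z. z \<in> T \<Longrightarrow> ham A w T u z = of_real l * u z"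
      "\<And>z. z \<in> T \<Longrightarrow> ham A w T v z = of_real l' * v z" and l: "\<bar>l\<bar> \<le> B"
    show "\<delta> \<le> \<bar>l - l'\<bar>"
    proof (rule ccontr)
      assume "\<not> \<delta> \<le> \<bar>l - l'\<bar>"
      define k where "k = \<lfloor>l / \<delta>\<rfloor>"
      have k: "of_int k \<le> l / \<delta>" "l / \<delta> < of_int k + 1" unfolding k_def by linarith+
      then have k': "of_int k * \<delta> \<le> l" "l < of_int k * \<delta> + \<delta>" using \<delta>(1) by (simp_all add: field_simps)
      have near: "\<bar>l - of_int k * \<delta>\<bar> \<le> 2 * \<delta>" "\<bar>l' - of_int k * \<delta>\<bar> \<le> 2 * \<delta>"
        using k' \<open>\<not> \<delta> \<le> \<bar>l - l'\<bar>\<close> \<delta>(1) by linarith+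
      have "\<bar>l / \<delta>\<bar> \<le> B / \<delta>" using l \<delta>(1) by (simp add: divide_right_mono)
      then have kN: "k \<in> {-N..N}" using k unfolding N_def atLeastAtMost_iff by linarith
      obtain x y where "x \<in> T" "y \<in> T - {x}" "w \<in> ?R k x y"
        using two_eigenvectors_resonant[OF T u v orth eig near] n by (metis IntI)
      then show False using notin kN by (auto simp: S_def)
    qed
  qed
qed

end

section \<open>Decay of eigenfunctions\<close>

text \<open>On \<open>T1\<close> the eigenfunction solves an inhomogeneous equation at energy
  \<open>E\<close>, with the mismatch \<open>l - E\<close> as source in the bulk and hops from
  \<open>T - T1\<close> as source at the boundary. The Green function must be small only at boundary
  sites; in the bulk its size \<open>t\<close> is paid for by \<kappa>.\<close>

lemma eigenfunction_bound:
  fixes \<kappa> g t E l :: real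
  assumes T: "finite T" "T1 \<subseteq> T" and ns: "nonsingular A (\<lambda>x. w x - E) T1" and diag: "\<And>x. A x x = 0"
    and x: "x \<in> T1" and u: "\<And>z. z \<in> T \<Longrightarrow> cmod (u z) \<le> 1"
    and eig: "\<And>z. z \<in> T \<Longrightarrow> ham A w T u z = of_real l * u z" and near: "\<bar>l - E\<bar> \<le> \<kappa>"
    and row: "\<And>z. z \<in> T \<Longrightarrow> (\<Sum>w\<in>T. \<bar>A z w\<bar>) \<le> 1" and pos: "0 \<le> \<kappa>" "0 \<le> g"
    and bulk: "\<And>z. z \<in> T1 \<Longrightarrow> \<bar>green A (\<lambda>x. w x - E) T1 x z\<bar> \<le> t"
    and bdry: "\<And>z y. z \<in> T1 \<Longrightarrow> y \<in> T - T1 \<Longrightarrow> A z y \<noteq> 0 \<Longrightarrow> \<bar>green A (\<lambda>x. w x - E) T1 x z\<bar> \<le> g"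
  shows "cmod (u x) \<le> card T1 * (t * \<kappa> + g)"
proof -
  have T1: "finite T1" using T finite_subset by blast
  let ?G = "\<lambda>z. green A (\<lambda>x. w x - E) T1 x z" and ?h = "\<lambda>z. ham A (\<lambda>x. w x - E) T1 u z"
  have h: "?h z = of_real (l - E) * u z - (\<Sum>y\<in>T - T1. of_real (A z y) * u y)" if "z \<in> T1" for z
  proof -
    have "(\<Sum>y\<in>T. of_real (A z y) * u y) = (\<Sum>y\<in>T - T1. of_real (A z y) * u y) + (\<Sum>y\<in>T1. of_real (A z y) * u y)"
      using T by (rule sum.subset_diff[rotated])
    then show ?thesis using eig[of z] that T by (auto simp: ham_def algebra_simps)
  qed
  have "u x = (\<Sum>z\<in>T1. of_real (?G z) * ?h z)" by (rule green_solves[OF T1 ns diag x])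
  then have "cmod (u x) \<le> (\<Sum>z\<in>T1. \<bar>?G z\<bar> * cmod (?h z))"
    by (metis (mono_tags, lifting) norm_mult norm_of_real norm_sum sum.cong)
  also have "\<dots> \<le> (\<Sum>z\<in>T1. t * \<kappa> + g)"
  proof (rule sum_mono)
    fix z assume z: "z \<in> T1"
    then have zT: "z \<in> T" using T by blast
    let ?b = "\<Sum>y\<in>T - T1. of_real (A z y) * u y"
    have "cmod (?h z) \<le> cmod (of_real (l - E) * u z) + cmod ?b"
      unfolding h[OF z] by (rule norm_triangle_ineq4)
    also have "cmod (of_real (l - E) * u z) \<le> \<kappa> * 1"
      unfolding norm_mult norm_of_real using near u[OF zT] pos by (intro mult_mono) auto
    finally have hz: "cmod (?h z) \<le> \<kappa> + cmod ?b" by simp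
    have "cmod ?b \<le> (\<Sum>y\<in>T - T1. \<bar>A z y\<bar> * 1)"
    proof (rule sum_norm_le)
      fix y assume "y \<in> T - T1"
      then show "norm (of_real (A z y) * u y) \<le> \<bar>A z y\<bar> * 1"
        unfolding norm_mult norm_of_real using u by (intro mult_left_mono) auto
    qed
    also have "\<dots> \<le> (\<Sum>y\<in>T. \<bar>A z y\<bar>)" using T by (auto intro: sum_mono2)
    also have "\<dots> \<le> 1" by (rule row[OF zT])
    finally have b1: "cmod ?b \<le> 1" .
    have Gb: "\<bar>?G z\<bar> * cmod ?b \<le> g"
    proof (cases "\<exists>y\<in>T - T1. A z y \<noteq> 0")
      case True
      then have "\<bar>?G z\<bar> \<le> g" using bdry[OF z] by blast
      then have "\<bar>?G z\<bar> * cmod ?b \<le> g * 1" using b1 pos by (intro mult_mono) auto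
      then show ?thesis by simp
    qed (use pos in auto)
    have "\<bar>?G z\<bar> * cmod (?h z) \<le> \<bar>?G z\<bar> * (\<kappa> + cmod ?b)" by (rule mult_left_mono[OF hz]) simp
    also have "\<dots> = \<bar>?G z\<bar> * \<kappa> + \<bar>?G z\<bar> * cmod ?b" by (rule distrib_left)
    also have "\<dots> \<le> t * \<kappa> + g" using bulk[OF z] pos Gb by (intro add_mono mult_right_mono) auto
    finally show "\<bar>?G z\<bar> * cmod (?h z) \<le> t * \<kappa> + g" .
  qed
  finally show ?thesis by simp
qed

section \<open>Large Green functions at fixed energies\<close>

context iid_potential
begin

lemma emeasure_ge_le:
  fixes f :: "('a \<Rightarrow> real) \<Rightarrow> ennreal"
  assumes [measurable]: "f \<in> borel_measurable P" and le: "(\<integral>\<^sup>+w. f w \<partial>P) \<le> ennreal b" and pos: "0 < c" "0 \<le> b"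
  shows "emeasure P {w. ennreal c \<le> f w} \<le> ennreal (b / c)"
proof -
  have "{w. ennreal c \<le> f w} = {w \<in> space P. 1 \<le> ennreal (1 / c) * f w}"
  proof -
    have "ennreal c \<le> f w \<longleftrightarrow> 1 \<le> ennreal (1 / c) * f w" for w
    proof
      assume "ennreal c \<le> f w"
      then have "ennreal (1 / c) * ennreal c \<le> ennreal (1 / c) * f w" by (rule mult_left_mono) simp
      then show "1 \<le> ennreal (1 / c) * f w" using pos by (simp add: ennreal_mult[symmetric])
    next
      assume "1 \<le> ennreal (1 / c) * f w"
      then have "ennreal c * 1 \<le> ennreal c * (ennreal (1 / c) * f w)" by (rule mult_left_mono) simp
      then show "ennreal c \<le> f w" using pos by (simp add: mult.assoc[symmetric] ennreal_mult[symmetric])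
    qed
    then show ?thesis by (simp add: space_P)
  qed
  also have "emeasure P \<dots> \<le> ennreal (1 / c) * (\<integral>\<^sup>+w. f w * indicator (space P) w \<partial>P)"
    by (rule nn_integral_Markov_inequality) auto
  also have "(\<integral>\<^sup>+w. f w * indicator (space P) w \<partial>P) = (\<integral>\<^sup>+w. f w \<partial>P)" by (simp add: space_P)
  also have "ennreal (1 / c) * (\<integral>\<^sup>+w. f w \<partial>P) \<le> ennreal (1 / c) * ennreal b"
    by (rule mult_left_mono[OF le]) simp
  also have "\<dots> = ennreal (b / c)" using pos by (simp add: ennreal_mult[symmetric])
  finally show ?thesis .
qed

lemma emeasure_green_ge_le:
  fixes A :: "'a \<Rightarrow> 'a \<Rightarrow> real" and d :: "'a \<Rightarrow> 'a \<Rightarrow> real"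
  assumes C: "\<And>a. (\<integral>\<^sup>+t. ennreal (\<bar>t - a\<bar> powr (-s)) \<partial>\<mu>) \<le> ennreal C" "1 \<le> C"
    and s: "0 < s" "s \<le> 1" and M: "0 \<le> M" and T: "finite T" "x \<in> T"
    and hop: "\<And>x. x \<in> T \<Longrightarrow> C * (\<Sum>w\<in>T. \<bar>A x w\<bar> powr s) \<le> exp (-M)"
    and d: "d y y = 0" "\<And>x w. A x w \<noteq> 0 \<Longrightarrow> d x y \<le> d w y + 1"
    and t: "0 < t"
  shows "{w. t \<le> \<bar>green A (\<lambda>x. w x - E) T x y\<bar>} \<in> sets P" (is "?S \<in> _")
    and "emeasure P {w. t \<le> \<bar>green A (\<lambda>x. w x - E) T x y\<bar>} \<le> ennreal (C * exp (- M * d x y) * t powr (-s))"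
proof -
  interpret P: prob_space "P :: ('a \<Rightarrow> real) measure" by (rule prob_P)
  note [simp, measurable] = T(1)
  have "{w \<in> space P. t \<le> \<bar>green A (\<lambda>x. w x - E) T x y\<bar>} \<in> sets P" by measurable
  then show "?S \<in> sets P" by (simp add: space_P)
  let ?f = "\<lambda>w. ennreal (\<bar>green A (\<lambda>x. w x - E) T x y\<bar> powr s)"
  have [measurable]: "?f \<in> borel_measurable P" by measurable
  have "(\<integral>\<^sup>+w. 1 * ?f w \<partial>P) \<le> ennreal (C * exp (- M * d x y)) * (\<integral>\<^sup>+w. 1 \<partial>(P :: ('a \<Rightarrow> real) measure))"
    by (rule nn_integral_green_le[OF C s M _ T(1) _ hop, where h = "\<lambda>x. d x y"]) (use d T in auto)
  then have le: "(\<integral>\<^sup>+w. ?f w \<partial>P) \<le> ennreal (C * exp (- M * d x y))"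
    by (simp add: P.emeasure_space_1)
  have "?S \<subseteq> {w. ennreal (t powr s) \<le> ?f w}"
    using t s by (auto intro!: ennreal_leI powr_mono2)
  then have "emeasure P ?S \<le> emeasure P {w. ennreal (t powr s) \<le> ?f w}"
  proof (rule emeasure_mono)
    have "{w \<in> space P. ennreal (t powr s) \<le> ?f w} \<in> sets P" by measurable
    then show "{w. ennreal (t powr s) \<le> ?f w} \<in> sets P" by (simp add: space_P)
  qed
  also have "\<dots> \<le> ennreal (C * exp (- M * d x y) / t powr s)"
    using t C by (intro emeasure_ge_le le) auto
  also have "\<dots> = ennreal (C * exp (- M * d x y) * t powr (-s))" by (simp add: powr_minus_divide)
  finally show "emeasure P ?S \<le> \<dots>" .
qed

text \<open>Bounded moments suffice here, so decay is switched off by rate 0 and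
  \<open>h = 0\<close>. The first moment acts as the factor \<open>F\<close> for the second, being
  independent of the potential in \<open>T'\<close>.\<close>

lemma emeasure_two_green_ge_le:
  fixes A :: "'a \<Rightarrow> 'a \<Rightarrow> real"
  assumes C: "\<And>a. (\<integral>\<^sup>+t. ennreal (\<bar>t - a\<bar> powr (-s)) \<partial>\<mu>) \<le> ennreal C" "1 \<le> C"
    and s: "0 < s" "s \<le> 1" and T: "finite T" "x \<in> T" and T': "finite T'" "x' \<in> T'" and disj: "T \<inter> T' = {}"
    and hop: "\<And>x. x \<in> T \<Longrightarrow> C * (\<Sum>w\<in>T. \<bar>A x w\<bar> powr s) \<le> 1"
    and hop': "\<And>x. x \<in> T' \<Longrightarrow> C * (\<Sum>w\<in>T'. \<bar>A x w\<bar> powr s) \<le> 1"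
    and t: "0 < t"
  shows "{w. t \<le> \<bar>green A (\<lambda>x. w x - E) T x y\<bar> \<and> t \<le> \<bar>green A (\<lambda>x. w x - E) T' x' y'\<bar>} \<in> sets P" (is "?S \<in> _")
    and "emeasure P {w. t \<le> \<bar>green A (\<lambda>x. w x - E) T x y\<bar> \<and> t \<le> \<bar>green A (\<lambda>x. w x - E) T' x' y'\<bar>}
      \<le> ennreal (C\<^sup>2 * t powr (- 2 * s))"
proof -
  interpret P: prob_space "P :: ('a \<Rightarrow> real) measure" by (rule prob_P)
  note [simp, measurable] = T(1) T'(1)
  have "{w \<in> space P. t \<le> \<bar>green A (\<lambda>x. w x - E) T x y\<bar> \<and> t \<le> \<bar>green A (\<lambda>x. w x - E) T' x' y'\<bar>} \<in> sets P" by measurable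
  then show "?S \<in> sets P" by (simp add: space_P)
  let ?f = "\<lambda>w. ennreal (\<bar>green A (\<lambda>x. w x - E) T x y\<bar> powr s)"
  let ?g = "\<lambda>w. ennreal (\<bar>green A (\<lambda>x. w x - E) T' x' y'\<bar> powr s)"
  have [measurable]: "?f \<in> borel_measurable P" "?g \<in> borel_measurable P" by measurable
  have f: "(\<integral>\<^sup>+w. 1 * ?f w \<partial>P) \<le> ennreal (C * exp (- 0 * 0)) * (\<integral>\<^sup>+w. 1 \<partial>(P :: ('a \<Rightarrow> real) measure))"
    by (rule nn_integral_green_le[OF C s _ _ T(1), where h = "\<lambda>x. 0"]) (use T hop in auto)
  have "(\<integral>\<^sup>+w. ?f w * ?g w \<partial>P) \<le> ennreal (C * exp (- 0 * 0)) * (\<integral>\<^sup>+w. ?f w \<partial>P)"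
  proof (rule nn_integral_green_le[OF C s _ _ T'(1), where h = "\<lambda>x. 0"])
    show "?f (w(z := a)) = ?f w" if "z \<in> T'" for w z a
      using disj that by (subst green_update) auto
  qed (use T' hop' in auto)
  also have "\<dots> \<le> ennreal (C * exp (- 0 * 0)) * ennreal C"
    using f by (intro mult_left_mono) (simp_all add: P.emeasure_space_1)
  finally have le: "(\<integral>\<^sup>+w. ?f w * ?g w \<partial>P) \<le> ennreal (C\<^sup>2)"
    using C(2) by (simp add: ennreal_mult[symmetric] power2_eq_square)
  have "?S \<subseteq> {w. ennreal (t powr s * t powr s) \<le> ?f w * ?g w}"
    using t s by (auto simp: ennreal_mult intro!: mult_mono ennreal_leI powr_mono2)
  then have "emeasure P ?S \<le> emeasure P {w. ennreal (t powr s * t powr s) \<le> ?f w * ?g w}"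
  proof (rule emeasure_mono)
    have "{w \<in> space P. ennreal (t powr s * t powr s) \<le> ?f w * ?g w} \<in> sets P" by measurable
    then show "{w. ennreal (t powr s * t powr s) \<le> ?f w * ?g w} \<in> sets P" by (simp add: space_P)
  qed
  also have "\<dots> \<le> ennreal (C\<^sup>2 / (t powr s * t powr s))"
    using t C by (intro emeasure_ge_le le) auto
  also have "\<dots> = ennreal (C\<^sup>2 * t powr (- 2 * s))"
    using powr_add[of t s s] by (simp add: powr_minus_divide)
  finally show "emeasure P ?S \<le> \<dots>" .
qed

text \<open>Three kinds of bad events occur at each net energy: a large Green function from
  \<open>x\<close> to the boundary of its ball, the same for \<open>y\<close>, and large values in
  both balls. Outside them one ball satisfies both bounds of \<open>eigenfunction_bound\<close>,
  possibly a different ball for different energies.\<close>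

lemma pair_localization:
  fixes A :: "'a \<Rightarrow> 'a \<Rightarrow> real" and d :: "'a \<Rightarrow> 'a \<Rightarrow> real" and s C B m r :: real and n :: nat
  assumes C: "\<And>a. (\<integral>\<^sup>+t. ennreal (\<bar>t - a\<bar> powr (-s)) \<partial>\<mu>) \<le> ennreal C" "1 \<le> C"
    and s: "1/2 < s" "s \<le> 1" and m: "m = (2 * s - 1) / (8 * s)"
    and T: "finite T" "x \<in> T" "y \<in> T" and n: "n = card T"
    and diag: "\<And>x. A x x = 0"
    and hop: "\<And>x. x \<in> T \<Longrightarrow> C * (\<Sum>w\<in>T. \<bar>A x w\<bar> powr s) \<le> exp (-8)"
    and row: "\<And>x. x \<in> T \<Longrightarrow> (\<Sum>w\<in>T. \<bar>A x w\<bar>) \<le> 1"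
    and d: "\<And>x. d x x = 0" "\<And>x y. d x y = d y x" "\<And>x y z. d x z \<le> d x y + d y z" "\<And>x y. 0 \<le> d x y"
      "\<And>x w. A x w \<noteq> 0 \<Longrightarrow> d x w \<le> 1"
    and r: "r = d x y" "0 < r" and B: "0 \<le> B"
  obtains S where "S \<in> sets P" "emeasure P S \<le> ennreal ((2 * B + 5) * (2 * real n * C * exp 8 + (real n)\<^sup>2 * C\<^sup>2) * exp (- ((2 * s - 1) / 2) * r))"
    "AE w in P. w \<notin> S \<longrightarrow> (\<forall>u l. sqnorm T u = 1 \<longrightarrow> (\<forall>z\<in>T. ham A w T u z = of_real l * u z) \<longrightarrow> \<bar>l\<bar> \<le> B \<longrightarrow>
      cmod (u x) \<le> 2 * real n * exp (- 2 * m * r) \<or> cmod (u y) \<le> 2 * real n * exp (- 2 * m * r))"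
proof -
  \<comment> \<open>\<kappa> is the net spacing, \<open>t\<close> the size tolerated in the bulk and
    \<open>g\<close> the size tolerated at the boundary, balanced by
    \<open>t * \<kappa> = g\<close>. The choice of \<open>m\<close> gives
    \<open>2 * s * (1 - 2 * m) = s + 1/2\<close>, midway between 1 and \<open>2 * s\<close>, so the
    joint event still decays at rate \<open>(2 * s - 1) / 2\<close> after summation over
    \<open>exp r\<close> energies.\<close>
  define \<kappa> t g where "\<kappa> = exp (- r)" and "t = exp ((1 - 2 * m) * r)" and "g = exp (- 2 * m * r)"
  have pos: "0 < \<kappa>" "0 < t" "0 < g" by (simp_all add: \<kappa>_def t_def g_def)
  have t\<kappa>: "t * \<kappa> = g" by (simp add: t_def \<kappa>_def g_def exp_add[symmetric] algebra_simps)
  define T1 where "T1 = (\<lambda>c. {z \<in> T. 2 * d c z < r})"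
  have T1: "finite (T1 c)" "T1 c \<subseteq> T" "c \<in> T \<Longrightarrow> c \<in> T1 c" for c
    using T r d(1) by (auto simp: T1_def)
  have disj: "T1 x \<inter> T1 y = {}"
  proof -
    have False if "2 * d x z < r" "2 * d y z < r" for z
      using d(3)[of x y z] d(2)[of z y] that r by linarith
    then show ?thesis by (auto simp: T1_def)
  qed
  \<comment> \<open>A boundary site has a neighbour at distance at least \<open>r / 2\<close> from
    the center, and a hop covers at most 1.\<close>
  have bdry: "r / 2 - 1 \<le> d c z" if "z \<in> T1 c" "y \<in> T - T1 c" "A z y \<noteq> 0" for c z y
    using that d(3)[of c y z] d(5)[of z y] by (auto simp: T1_def)
  let ?G = "\<lambda>E c w z. green A (\<lambda>x. w x - E) (T1 c) c z"
  have hop1: "C * (\<Sum>w\<in>T1 c. \<bar>A x w\<bar> powr s) \<le> exp (-8)" if "x \<in> T1 c" for x c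
  proof -
    have "C * (\<Sum>w\<in>T1 c. \<bar>A x w\<bar> powr s) \<le> C * (\<Sum>w\<in>T. \<bar>A x w\<bar> powr s)"
      using C(2) T1[of c] T by (intro mult_left_mono sum_mono2) auto
    then show ?thesis using hop[of x] that T1[of c] by auto
  qed
  have hop0: "C * (\<Sum>w\<in>T1 c. \<bar>A x w\<bar> powr s) \<le> 1" if "x \<in> T1 c" for x c
    using hop1[OF that] by (rule order_trans) simp
  have s0: "0 < s" using s by simp
  have m2: "2 * m * s \<le> 1/4" "m \<le> 1/8" "0 < m"
    using s by (simp_all add: m field_simps)
  define N where "N = \<lceil>B / \<kappa>\<rceil> + 1"
  have N: "0 \<le> N" "real_of_int N \<le> B / \<kappa> + 2"
  proof -
    have "0 \<le> B / \<kappa>" using B pos by simp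
    then show "0 \<le> N" "real_of_int N \<le> B / \<kappa> + 2" unfolding N_def by linarith+
  qed
  let ?E = "\<lambda>k. of_int k * \<kappa>"
  define b where "b = (\<lambda>k c. \<Union>z\<in>{z\<in>T1 c. r / 2 - 1 \<le> d c z}. {w. g \<le> \<bar>?G (?E k) c w z\<bar>})"
  define b2 where "b2 = (\<lambda>k. \<Union>z\<in>T1 x. \<Union>z'\<in>T1 y. {w. t \<le> \<bar>?G (?E k) x w z\<bar> \<and> t \<le> \<bar>?G (?E k) y w z'\<bar>})"
  define S where "S = (\<Union>k\<in>{-N..N}. b k x \<union> (b k y \<union> b2 k))"
  let ?p = "real n * (C * exp 8 * exp (- 3 * r))" and ?q = "(real n)\<^sup>2 * (C\<^sup>2 * exp (- (s + 1/2) * r))"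
  have card_T1: "card (T1 c) \<le> n" for c unfolding n by (intro card_mono T T1)
  have b: "b k c \<in> sets P" "emeasure P (b k c) \<le> ennreal ?p" if c: "c \<in> T" for k c
  proof -
    have 1: "{w. g \<le> \<bar>?G (?E k) c w z\<bar>} \<in> sets P" for z
      by (rule emeasure_green_ge_le[OF C s0 s(2) _ T1(1) T1(3)[OF c] hop1]) (use pos d(1) in auto)
    show "b k c \<in> sets P" unfolding b_def using T1 1 by (intro sets.finite_UN) auto
    have "emeasure P (b k c) \<le> (\<Sum>z\<in>{z\<in>T1 c. r / 2 - 1 \<le> d c z}. emeasure P {w. g \<le> \<bar>?G (?E k) c w z\<bar>})"
      unfolding b_def using T1 1 by (intro emeasure_subadditive_finite) auto
    also have "\<dots> \<le> (\<Sum>z\<in>{z\<in>T1 c. r / 2 - 1 \<le> d c z}. ennreal (C * exp 8 * exp (- 3 * r)))"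
    proof (rule sum_mono)
      fix z assume z: "z \<in> {z\<in>T1 c. r / 2 - 1 \<le> d c z}"
      have "d x z \<le> d w z + 1" if "A x w \<noteq> 0" for x w
        using d(3)[of x z w] d(5)[OF that] by linarith
      then have "emeasure P {w. g \<le> \<bar>?G (?E k) c w z\<bar>} \<le> ennreal (C * exp (- 8 * d c z) * g powr (-s))"
        using pos d(1) by (intro emeasure_green_ge_le[OF C s0 s(2) _ T1(1) T1(3)[OF c] hop1]) auto
      also have "\<dots> \<le> ennreal (C * exp 8 * exp (- 3 * r))"
      proof (rule ennreal_leI)
        have "exp (- 8 * d c z) * g powr (-s) = exp (2 * m * s * r - 8 * d c z)"
          by (simp add: g_def powr_def exp_add[symmetric] algebra_simps)
        \<comment> \<open>Rate 8 over the distance \<open>r / 2 - 1\<close> gives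
          \<open>4 * r - 8\<close>, and the level \<open>g\<close> costs at most
          \<open>r / 4\<close>. What remains is ample against the \<open>exp r\<close>
          energies.\<close>
        also have "\<dots> \<le> exp (8 + - 3 * r)"
        proof -
          have "2 * m * s * r \<le> 1/4 * r" using r(2) by (intro mult_right_mono m2(1)) simp
          moreover have "r / 2 - 1 \<le> d c z" using z by simp
          ultimately have "2 * m * s * r - 8 * d c z \<le> 8 + - 3 * r" using r(2) by linarith
          then show ?thesis by simp
        qed
        finally show "C * exp (- 8 * d c z) * g powr (-s) \<le> C * exp 8 * exp (- 3 * r)"
          unfolding exp_add mult.assoc using C(2) by (intro mult_left_mono) auto
      qed
      finally show "emeasure P {w. g \<le> \<bar>?G (?E k) c w z\<bar>} \<le> ennreal (C * exp 8 * exp (- 3 * r))" .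
    qed
    also have "\<dots> \<le> (\<Sum>z\<in>T1 c. ennreal (C * exp 8 * exp (- 3 * r)))"
      using T1 by (intro sum_mono2) auto
    also have "\<dots> = ennreal (real (card (T1 c)) * (C * exp 8 * exp (- 3 * r)))"
      using C(2) by (simp add: ennreal_mult ennreal_of_nat_eq_real_of_nat)
    also have "\<dots> \<le> ennreal ?p"
      using C(2) card_T1 by (intro ennreal_leI mult_right_mono) auto
    finally show "emeasure P (b k c) \<le> ennreal ?p" .
  qed
  have b2: "b2 k \<in> sets P" "emeasure P (b2 k) \<le> ennreal ?q" for k
  proof -
    let ?R = "\<lambda>z z'. {w. t \<le> \<bar>?G (?E k) x w z\<bar> \<and> t \<le> \<bar>?G (?E k) y w z'\<bar>}"
    have 1: "?R z z' \<in> sets P" for z z'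
      by (rule emeasure_two_green_ge_le[OF C s0 s(2) T1(1) T1(3)[OF T(2)] T1(1) T1(3)[OF T(3)] disj hop0 hop0 pos(2)])
    show "b2 k \<in> sets P" unfolding b2_def using T1 1 by (intro sets.finite_UN) auto
    have eq: "t powr (- 2 * s) = exp (- (s + 1/2) * r)"
    proof -
      have "- 2 * s * ((1 - 2 * m) * r) = - (s + 1/2) * r" using s0 by (simp add: m field_simps)
      then show ?thesis by (simp add: t_def powr_def)
    qed
    have R: "emeasure P (?R z z') \<le> ennreal (C\<^sup>2 * exp (- (s + 1/2) * r))" for z z'
      using emeasure_two_green_ge_le(2)[where A = A and E = "?E k" and y = z and y' = z', OF C s0 s(2) T1(1) T1(3)[OF T(2)] T1(1) T1(3)[OF T(3)] disj hop0 hop0 pos(2)]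
      unfolding eq .
    have "emeasure P (b2 k) \<le> (\<Sum>z\<in>T1 x. emeasure P (\<Union>z'\<in>T1 y. ?R z z'))"
      unfolding b2_def using T1 1 by (intro emeasure_subadditive_finite) (auto intro!: sets.finite_UN)
    also have "\<dots> \<le> (\<Sum>z\<in>T1 x. \<Sum>z'\<in>T1 y. emeasure P (?R z z'))"
      using T1 1 by (intro sum_mono emeasure_subadditive_finite) auto
    also have "\<dots> \<le> (\<Sum>z\<in>T1 x. \<Sum>z'\<in>T1 y. ennreal (C\<^sup>2 * exp (- (s + 1/2) * r)))"
      by (intro sum_mono R)
    also have "\<dots> = ennreal (real (card (T1 x)) * (real (card (T1 y)) * (C\<^sup>2 * exp (- (s + 1/2) * r))))"
      by (simp add: ennreal_mult ennreal_of_nat_eq_real_of_nat)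
    also have "\<dots> \<le> ennreal (real n * (real n * (C\<^sup>2 * exp (- (s + 1/2) * r))))"
      using card_T1 by (intro ennreal_leI mult_mono) auto
    also have "real n * (real n * (C\<^sup>2 * exp (- (s + 1/2) * r))) = ?q" by (simp add: power2_eq_square)
    finally show "emeasure P (b2 k) \<le> ennreal ?q" .
  qed
  show thesis
  proof
    show "S \<in> sets P" unfolding S_def using b T b2 by (intro sets.finite_UN sets.Un) auto
    have "emeasure P S \<le> (\<Sum>k\<in>{-N..N}. emeasure P (b k x \<union> (b k y \<union> b2 k)))"
      unfolding S_def using b T b2 by (intro emeasure_subadditive_finite) auto
    also have "\<dots> \<le> (\<Sum>k\<in>{-N..N}. ennreal (?p + (?p + ?q)))"
    proof (rule sum_mono)
      fix k
      have "emeasure P (b k x \<union> (b k y \<union> b2 k)) \<le> emeasure P (b k x) + (emeasure P (b k y) + emeasure P (b2 k))"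
        using b T b2 by (intro order_trans[OF emeasure_subadditive] add_left_mono emeasure_subadditive) auto
      also have "\<dots> \<le> ennreal ?p + (ennreal ?p + ennreal ?q)"
        by (intro add_mono b b2 T)
      also have "\<dots> = ennreal (?p + (?p + ?q))" 
      proof -
        have p0: "0 \<le> ?p" and q0: "0 \<le> ?q" using C(2) by auto
        show ?thesis unfolding ennreal_plus[OF p0 add_nonneg_nonneg[OF p0 q0]] ennreal_plus[OF p0 q0] ..
      qed
      finally show "emeasure P (b k x \<union> (b k y \<union> b2 k)) \<le> ennreal (?p + (?p + ?q))" .
    qed
    also have "\<dots> = ennreal (\<Sum>k\<in>{-N..N}. ?p + (?p + ?q))"
      using C(2) by (intro sum_ennreal) auto
    also have "(\<Sum>k\<in>{-N..N}. ?p + (?p + ?q)) = real_of_int (2 * N + 1) * (?p + (?p + ?q))"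
      using N(1) by (simp add: of_nat_nat)
    also have "ennreal \<dots> \<le> ennreal ((2 * B + 5) * (2 * real n * C * exp 8 + (real n)\<^sup>2 * C\<^sup>2) * exp (- ((2 * s - 1) / 2) * r))"
    proof (rule ennreal_leI)
      let ?e = "exp (- ((2 * s - 1) / 2) * r)"
      have "1 \<le> exp r" "B / \<kappa> = B * exp r" using r(2) by (simp_all add: \<kappa>_def exp_minus field_simps)
      then have N2: "real_of_int (2 * N + 1) \<le> (2 * B + 5) * exp r"
        using N(2) by (simp add: algebra_simps del: one_le_exp_iff)
      have e1: "exp r * exp (- 3 * r) \<le> ?e"
        using s r by (simp add: exp_add[symmetric] algebra_simps)
      have e2: "exp r * exp (- (s + 1/2) * r) = ?e"
      proof -
        have "r + - (s + 1/2) * r = - ((2 * s - 1) / 2) * r" by (simp add: field_simps)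
        then show ?thesis unfolding exp_add[symmetric] by simp
      qed
      have "real_of_int (2 * N + 1) * (?p + (?p + ?q)) \<le> (2 * B + 5) * exp r * (?p + (?p + ?q))"
        using C(2) by (intro mult_right_mono N2) auto
      also have "\<dots> = (2 * B + 5) * ((2 * real n * C * exp 8) * (exp r * exp (- 3 * r)) + ((real n)\<^sup>2 * C\<^sup>2) * (exp r * exp (- (s + 1/2) * r)))"
        by (simp add: algebra_simps)
      also have "\<dots> \<le> (2 * B + 5) * ((2 * real n * C * exp 8) * ?e + ((real n)\<^sup>2 * C\<^sup>2) * ?e)"
        unfolding e2 using B C(2) e1 by (intro mult_left_mono add_mono) auto
      also have "\<dots> = (2 * B + 5) * (2 * real n * C * exp 8 + (real n)\<^sup>2 * C\<^sup>2) * ?e"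
        by (simp add: algebra_simps)
      finally show "real_of_int (2 * N + 1) * (?p + (?p + ?q)) \<le> \<dots>" .
    qed
    finally show "emeasure P S \<le> \<dots>" .
    \<comment> \<open>The Green function represents the eigenfunction only at nonsingular energies;
      with finitely many net energies the exceptions form a null set.\<close>
    have "AE w in (P :: ('a \<Rightarrow> real) measure). \<forall>k\<in>{-N..N}. nonsingular A (\<lambda>x. w x - ?E k) (T1 x) \<and> nonsingular A (\<lambda>x. w x - ?E k) (T1 y)"
      by (intro AE_finite_allI AE_conjI AE_nonsingular T1) auto
    then show "AE w in P. w \<notin> S \<longrightarrow> (\<forall>u l. sqnorm T u = 1 \<longrightarrow> (\<forall>z\<in>T. ham A w T u z = of_real l * u z) \<longrightarrow> \<bar>l\<bar> \<le> B \<longrightarrow>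
      cmod (u x) \<le> 2 * real n * exp (- 2 * m * r) \<or> cmod (u y) \<le> 2 * real n * exp (- 2 * m * r))"
    proof (eventually_elim, intro impI allI)
      fix w u l
      assume ns: "\<forall>k\<in>{-N..N}. nonsingular A (\<lambda>x. w x - ?E k) (T1 x) \<and> nonsingular A (\<lambda>x. w x - ?E k) (T1 y)"
        and S: "w \<notin> S" and u: "sqnorm T u = 1" and eig: "\<forall>z\<in>T. ham A w T u z = of_real l * u z" and l: "\<bar>l\<bar> \<le> B"
      define k where "k = \<lfloor>l / \<kappa>\<rfloor>"
      have k: "of_int k \<le> l / \<kappa>" "l / \<kappa> < of_int k + 1" unfolding k_def by linarith+
      then have near: "\<bar>l - ?E k\<bar> \<le> \<kappa>" using pos by (simp add: abs_le_iff field_simps)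
      have "\<bar>l / \<kappa>\<bar> \<le> B / \<kappa>" using l pos by (simp add: divide_right_mono)
      then have kN: "k \<in> {-N..N}" using k unfolding N_def atLeastAtMost_iff by linarith
      have u1: "cmod (u z) \<le> 1" if "z \<in> T" for z
        using norm_le_sqnorm[OF T(1) that, of u] u by (simp add: power_le_one_iff)
      have bound: "cmod (u c) \<le> 2 * real n * exp (- 2 * m * r)"
        if c: "c \<in> T" "w \<notin> b k c" "nonsingular A (\<lambda>x. w x - ?E k) (T1 c)" "\<And>z. z \<in> T1 c \<Longrightarrow> \<bar>?G (?E k) c w z\<bar> \<le> t" for c
      proof -
        have "cmod (u c) \<le> card (T1 c) * (t * \<kappa> + g)"
        proof (rule eigenfunction_bound[OF T(1) T1(2) c(3) diag T1(3)[OF c(1)] u1 _ near row _ _ c(4)])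
          show "\<bar>?G (?E k) c w z\<bar> \<le> g" if "z \<in> T1 c" "y \<in> T - T1 c" "A z y \<noteq> 0" for z y
            using bdry[OF that] that c(2) by (force simp: b_def)
        qed (use eig pos in auto)
        also have "\<dots> \<le> real n * (g + g)"
          unfolding t\<kappa> using card_T1 pos by (intro mult_right_mono) auto
        finally show ?thesis by (simp add: g_def)
      qed
      have "w \<notin> b k x" "w \<notin> b k y" "w \<notin> b2 k" using S kN by (auto simp: S_def)
      show "cmod (u x) \<le> 2 * real n * exp (- 2 * m * r) \<or> cmod (u y) \<le> 2 * real n * exp (- 2 * m * r)"
      \<comment> \<open>A single large bulk value around \<open>x\<close>, combined with
        \<open>w \<notin> b2 k\<close>, forces the bulk bound at every site of the ball around
        \<open>y\<close>.\<close>
      proof (cases "\<forall>z\<in>T1 x. \<bar>?G (?E k) x w z\<bar> \<le> t")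
        case True
        then show ?thesis using bound[OF T(2) \<open>w \<notin> b k x\<close>] ns kN by blast
      next
        case False
        then have "\<bar>?G (?E k) y w z\<bar> \<le> t" if "z \<in> T1 y" for z
          using \<open>w \<notin> b2 k\<close> that by (force simp: b2_def)
        then show ?thesis using bound[OF T(3) \<open>w \<notin> b k y\<close>] ns kN by blast
      qed
    qed
  qed
qed

end

section \<open>Labelling eigenfunctions by sites\<close>

text \<open>If every nonempty proper subfamily has a surplus, one index may be matched arbitrarily.
  Otherwise a tight subfamily \<open>J0\<close> is matched within its neighbourhood
  \<open>U\<close>; tightness transfers Hall's condition to the remaining indices with
  \<open>U\<close> deleted.\<close>

theorem hall_marriage:
  fixes N :: "'i \<Rightarrow> 'a set"
  assumes "finite I" "\<And>i. i \<in> I \<Longrightarrow> finite (N i)" "\<And>J. J \<subseteq> I \<Longrightarrow> card J \<le> card (\<Union>i\<in>J. N i)"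
  shows "\<exists>f. inj_on f I \<and> (\<forall>i\<in>I. f i \<in> N i)"
  using assms
proof (induction "card I" arbitrary: I N rule: less_induct)
  case less
  note I = less.prems(1) and N = less.prems(2) and hall = less.prems(3)
  show ?case
  proof (cases "I = {}")
    case False
    then obtain i where i: "i \<in> I" by blast
    show ?thesis
    proof (cases "\<forall>J\<subseteq>I. J \<noteq> {} \<longrightarrow> J \<noteq> I \<longrightarrow> card J < card (\<Union>i\<in>J. N i)")
      case True
      have "card {i} \<le> card (\<Union>i\<in>{i}. N i)" using i by (intro hall) auto
      then have "N i \<noteq> {}" by auto
      then obtain x where x: "x \<in> N i" by blast
      have "\<exists>f. inj_on f (I - {i}) \<and> (\<forall>j\<in>I - {i}. f j \<in> N j - {x})"
      proof (rule less.hyps)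
        show "card (I - {i}) < card I" using I i by (simp add: card_remove_less)
        fix J assume J: "J \<subseteq> I - {i}"
        have fin: "finite (\<Union>i\<in>J. N i)" using J I N finite_subset[of J I] by auto
        have "card J \<le> card ((\<Union>i\<in>J. N i) - {x})"
        proof (cases "J = {}")
          case False
          then have "card J < card (\<Union>i\<in>J. N i)" using True J i by auto
          then show ?thesis using fin by (auto simp: card_Diff_singleton_if)
        qed simp
        moreover have "(\<Union>i\<in>J. N i - {x}) = (\<Union>i\<in>J. N i) - {x}" by auto
        ultimately show "card J \<le> card (\<Union>i\<in>J. N i - {x})" by simp
      qed (use I N in auto)
      then obtain f where f: "inj_on f (I - {i})" "\<And>j. j \<in> I - {i} \<Longrightarrow> f j \<in> N j - {x}" by blast
      have "inj_on (f(i := x)) I"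
        using f by (auto simp: inj_on_def)
      moreover have "\<forall>j\<in>I. (f(i := x)) j \<in> N j" using f x by auto
      ultimately show ?thesis by blast
    next
      case False
      then obtain J0 where J0: "J0 \<subseteq> I" "J0 \<noteq> {}" "J0 \<noteq> I" "\<not> card J0 < card (\<Union>i\<in>J0. N i)" by blast
      define U where "U = (\<Union>i\<in>J0. N i)"
      have finJ: "finite J" if "J \<subseteq> I" for J using that I finite_subset by blast
      have U: "finite U" "card U \<le> card J0" using J0 N finJ by (auto simp: U_def)
      have "\<exists>f. inj_on f J0 \<and> (\<forall>j\<in>J0. f j \<in> N j)"
        using J0 N hall I finJ by (intro less.hyps psubset_card_mono) auto
      then obtain f where f: "inj_on f J0" "\<And>j. j \<in> J0 \<Longrightarrow> f j \<in> N j" by blast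
      have "\<exists>g. inj_on g (I - J0) \<and> (\<forall>j\<in>I - J0. g j \<in> N j - U)"
      proof (rule less.hyps)
        show "card (I - J0) < card I" using J0 I by (intro psubset_card_mono) auto
        fix J assume J: "J \<subseteq> I - J0"
        let ?V = "\<Union>i\<in>J. N i - U"
        have fin: "finite J" "finite J0" using J J0 finJ by auto
        have "card J + card J0 = card (J \<union> J0)" using J fin by (intro card_Un_disjoint[symmetric]) auto
        also have "\<dots> \<le> card (\<Union>i\<in>J \<union> J0. N i)" using J J0 by (intro hall) auto
        also have "(\<Union>i\<in>J \<union> J0. N i) = ?V \<union> U" by (auto simp: U_def)
        also have "card (?V \<union> U) \<le> card ?V + card U" by (rule card_Un_le)
        finally show "card J \<le> card ?V" using U by simp
      qed (use I N in auto)
      then obtain g where g: "inj_on g (I - J0)" "\<And>j. j \<in> I - J0 \<Longrightarrow> g j \<in> N j - U" by blast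
      define h where "h = (\<lambda>j. if j \<in> J0 then f j else g j)"
      have fU: "f j \<in> U" if "j \<in> J0" for j using f(2)[OF that] that by (auto simp: U_def)
      have "inj_on h I"
      proof (rule inj_onI)
        fix i j assume ij: "i \<in> I" "j \<in> I" "h i = h j"
        show "i = j"
          using ij fU[of i] fU[of j] g(2)[of i] g(2)[of j] inj_onD[OF f(1), of i j] inj_onD[OF g(1), of i j]
          by (cases "i \<in> J0"; cases "j \<in> J0") (auto simp: h_def)
      qed
      moreover have "\<forall>j\<in>I. h j \<in> N j" using f g by (auto simp: h_def)
      ultimately show ?thesis by blast
    qed
  qed simp
qed

lemma orthonormal_subset: "orthonormal T I \<phi> \<Longrightarrow> J \<subseteq> I \<Longrightarrow> orthonormal T J \<phi>"
  unfolding orthonormal_def by blast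

text \<open>Hall's condition: eigenfunctions indexed by \<open>J\<close> have almost all of their mass in the union
  \<open>B\<close> of the balls around their centers, so by Bessel's inequality \<open>B\<close> has at least \<open>card J\<close> points.\<close>
lemma eigenfunction_labelling:
  fixes d :: "'a \<Rightarrow> 'a \<Rightarrow> real" and m R :: real
  assumes T: "finite T" and n: "n = card T" and on: "orthonormal T {..<n} \<phi>"
    and d: "\<And>x. d x x = 0" "\<And>x y. d x y = d y x" "\<And>x y z. d x z \<le> d x y + d y z"
    and m: "0 < m" and R: "0 < R" "exp (- m * R) * sqrt n < 1" "(real n)\<^sup>2 * exp (- 2 * m * R) < 1"
    and loc: "\<And>i x y. i < n \<Longrightarrow> x \<in> T \<Longrightarrow> y \<in> T \<Longrightarrow> R \<le> d x y \<Longrightarrow>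
       cmod (\<phi> i x) \<le> exp (- m * d x y) \<or> cmod (\<phi> i y) \<le> exp (- m * d x y)"
  obtains \<sigma> where "bij_betw \<sigma> T {..<n}"
    "\<And>x y. x \<in> T \<Longrightarrow> y \<in> T \<Longrightarrow> 2 * R \<le> d x y \<Longrightarrow> cmod (\<phi> (\<sigma> x) y) \<le> exp (- (m / 2) * d x y)"
proof -
  have "\<exists>c\<in>T. 1 / sqrt n \<le> cmod (\<phi> i c)" if "i < n" for i
    unfolding n using exists_large_coordinate[OF T orthonormal_sqnorm[OF on]] that by auto
  then obtain c where c: "\<And>i. i < n \<Longrightarrow> c i \<in> T" "\<And>i. i < n \<Longrightarrow> 1 / sqrt n \<le> cmod (\<phi> i (c i))"
    by metis
  \<comment> \<open>At its center the eigenfunction exceeds \<open>exp (- m * R)\<close>, so the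
    dichotomy for the pair of center and \<open>y\<close> can only be resolved at
    \<open>y\<close>.\<close>
  have decay: "cmod (\<phi> i y) \<le> exp (- m * d (c i) y)" if i: "i < n" and y: "y \<in> T" "R \<le> d (c i) y" for i y
  proof -
    have "exp (- m * d (c i) y) \<le> exp (- m * R)" using m y by simp
    also have "\<dots> < 1 / sqrt n" using R(2) i by (simp add: field_simps)
    also have "\<dots> \<le> cmod (\<phi> i (c i))" by (rule c(2)[OF i])
    finally show ?thesis using loc[OF i c(1)[OF i] y] by linarith
  qed
  define N where "N = (\<lambda>i. {x \<in> T. d (c i) x < R})"
  have "\<exists>f. inj_on f {..<n} \<and> (\<forall>i\<in>{..<n}. f i \<in> N i)"
  proof (rule hall_marriage)
    fix J assume J: "J \<subseteq> {..<n}"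
    define B where "B = (\<Union>i\<in>J. N i)"
    have B: "B \<subseteq> T" "finite B" using T by (auto simp: B_def N_def intro: finite_subset)
    have finJ: "finite J" using J finite_subset by blast
    have cJ: "card J \<le> n" using J card_mono[of "{..<n}" J] by simp
    have onJ: "orthonormal T J \<phi>" using orthonormal_subset[OF on J] .
    have small: "(cmod (\<phi> i y))\<^sup>2 \<le> exp (- 2 * m * R)" if i: "i \<in> J" and y: "y \<in> T - B" for i y
    proof -
      have "R \<le> d (c i) y" using i y by (auto simp: B_def N_def)
      then have "cmod (\<phi> i y) \<le> exp (- m * d (c i) y)" "exp (- m * d (c i) y) \<le> exp (- m * R)"
        using decay[of i y] i y J m by auto
      then have "cmod (\<phi> i y) \<le> exp (- m * R)" by linarith
      then have "(cmod (\<phi> i y))\<^sup>2 \<le> (exp (- m * R))\<^sup>2" by (intro power_mono) auto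
      then show ?thesis by (simp add: exp_double[symmetric] mult.assoc)
    qed
    have "real (card J) = (\<Sum>x\<in>T. \<Sum>i\<in>J. (cmod (\<phi> i x))\<^sup>2)" by (rule sum_bessel[OF onJ, symmetric])
    also have "\<dots> = (\<Sum>x\<in>T - B. \<Sum>i\<in>J. (cmod (\<phi> i x))\<^sup>2) + (\<Sum>x\<in>B. \<Sum>i\<in>J. (cmod (\<phi> i x))\<^sup>2)"
      by (rule sum.subset_diff[OF B(1) T])
    also have "\<dots> \<le> (\<Sum>x\<in>T - B. \<Sum>i\<in>J. exp (- 2 * m * R)) + (\<Sum>x\<in>B. 1)"
      using B by (intro add_mono sum_mono small bessel[OF T finJ onJ]) auto
    also have "\<dots> = real (card (T - B)) * (real (card J) * exp (- 2 * m * R)) + card B" by simp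
    also have "\<dots> \<le> real n * (real n * exp (- 2 * m * R)) + card B"
      using cJ T unfolding n by (intro add_right_mono mult_mono) (auto intro: card_mono)
    \<comment> \<open>Missing mass below 1 is harmless because both cardinalities are
      integers.\<close>
    also have "\<dots> < 1 + real (card B)" using R(3) by (simp add: power2_eq_square)
    finally show "card J \<le> card (\<Union>i\<in>J. N i)" unfolding B_def by linarith
  qed (use T in \<open>auto simp: N_def\<close>)
  then obtain f where f: "inj_on f {..<n}" "\<And>i. i < n \<Longrightarrow> f i \<in> N i" by auto
  have "f ` {..<n} = T"
    using f T by (intro card_subset_eq) (auto simp: N_def card_image n)
  then have bij: "bij_betw f {..<n} T" using f(1) by (simp add: bij_betw_def)
  define \<sigma> where "\<sigma> = inv_into {..<n} f"
  show thesis
  proof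
    show bij': "bij_betw \<sigma> T {..<n}" unfolding \<sigma>_def by (rule bij_betw_inv_into[OF bij])
    fix x y assume xy: "x \<in> T" "y \<in> T" "2 * R \<le> d x y"
    define i where "i = \<sigma> x"
    have i: "i < n" "f i = x"
      using bij_betwE[OF bij'] xy(1) bij_betw_inv_into_right[OF bij xy(1)] by (auto simp: i_def \<sigma>_def)
    then have "d (c i) x < R" using f(2)[of i] by (auto simp: N_def)
    then have far: "d x y - R \<le> d (c i) y" using d(3)[of x y "c i"] d(2)[of x "c i"] by linarith
    then have "cmod (\<phi> i y) \<le> exp (- m * d (c i) y)" using xy by (intro decay i) auto
    also have "\<dots> \<le> exp (- (m / 2) * d x y)"
    \<comment> \<open>The label \<open>x\<close> is within \<open>R\<close> of the center, at most
      half of \<open>d x y\<close>. Replacing the center by the label thus halves the rate.\<close>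
    proof -
      have "d x y / 2 \<le> d (c i) y" using far xy(3) by linarith
      then have "m * (d x y / 2) \<le> m * d (c i) y" using m by (intro mult_left_mono) auto
      then show ?thesis by simp
    qed
    finally show "cmod (\<phi> (\<sigma> x) y) \<le> exp (- (m / 2) * d x y)" by (simp add: i_def)
  qed
qed

section \<open>The Anderson model on the lattice\<close>

definition hopping :: "real \<Rightarrow> int ^ 'd \<Rightarrow> int ^ 'd \<Rightarrow> real" where
  "hopping eps x y = (if norm (to_real y - to_real x) = 1 then - eps else 0)"

definition site_dist :: "int ^ 'd \<Rightarrow> int ^ 'd \<Rightarrow> real" where
  "site_dist x y = infnorm (to_real x - to_real y)"

lemma hopping_sym: "hopping eps x y = hopping eps y x"
  by (simp add: hopping_def norm_minus_commute)

lemma hopping_diag: "hopping eps x x = 0"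
  by (simp add: hopping_def)

lemma site_dist_self: "site_dist x x = 0"
  by (simp add: site_dist_def infnorm_0)

lemma site_dist_sym: "site_dist x y = site_dist y x"
  unfolding site_dist_def by (rule infnorm_sub)

lemma site_dist_triangle: "site_dist x z \<le> site_dist x y + site_dist y z"
  using infnorm_triangle[of "to_real x - to_real y" "to_real y - to_real z"] by (simp add: site_dist_def)

lemma site_dist_nonneg: "0 \<le> site_dist x y"
  by (simp add: site_dist_def infnorm_pos_le)

lemma site_dist_hopping: "hopping eps x y \<noteq> 0 \<Longrightarrow> site_dist x y \<le> 1"
  using infnorm_le_norm[of "to_real x - to_real y"]
  by (auto simp: hopping_def site_dist_def norm_minus_commute split: if_splits)

lemma H_restr_eq_ham:
  assumes "finite T"
  shows "H_restr eps w T u = (\<lambda>y. if y \<in> T then ham (hopping eps) w T u y else 0)"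
proof
  fix y
  have "(\<Sum>z\<in>T. of_real (hopping eps y z) * u z) = (\<Sum>z\<in>T. if norm (to_real z - to_real y) = 1 then - of_real eps * u z else 0)"
    by (intro sum.cong) (auto simp: hopping_def)
  also have "\<dots> = (\<Sum>z\<in>{z\<in>T. norm (to_real z - to_real y) = 1}. - of_real eps * u z)"
    using assms by (subst sum.inter_filter) auto
  finally show "H_restr eps w T u y = (if y \<in> T then ham (hopping eps) w T u y else 0)"
    by (simp add: H_restr_def ham_def sum_distrib_left sum_negf)
qed

lemma H_restr_eigen_iff:
  assumes "finite T" "\<And>z. z \<notin> T \<Longrightarrow> u z = 0"
  shows "H_restr eps w T u = (\<lambda>y. l * u y) \<longleftrightarrow> (\<forall>z\<in>T. ham (hopping eps) w T u z = l * u z)"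
  using assms by (auto simp: H_restr_eq_ham fun_eq_iff)

lemma vec_subset_PiE:
  fixes B :: "'d::finite \<Rightarrow> int set"
  assumes "\<And>i. finite (B i)" "\<And>i. card (B i) \<le> k" "S \<subseteq> {y :: int ^ 'd. \<forall>i. y $ i \<in> B i}"
  shows "finite S" "card S \<le> k ^ CARD('d)"
proof -
  have inj: "inj_on (\<lambda>y. \<lambda>i. y $ i) S" by (auto simp: inj_on_def vec_eq_iff fun_eq_iff)
  have sub: "(\<lambda>y. \<lambda>i. y $ i) ` S \<subseteq> PiE UNIV B" using assms(3) by auto
  have fin: "finite (PiE UNIV B)" using assms(1) by (intro finite_PiE) auto
  show "finite S" using finite_imageD[OF finite_subset[OF sub fin] inj] .
  have "card S \<le> card (PiE UNIV B)" using card_inj_on_le[OF inj sub fin] .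
  also have "\<dots> = (\<Prod>i\<in>UNIV. card (B i))" by (rule card_PiE) simp
  also have "\<dots> \<le> (\<Prod>i\<in>(UNIV :: 'd set). k)" using assms(2) by (intro prod_mono) auto
  finally show "card S \<le> k ^ CARD('d)" by simp
qed

lemma box_subset: "box L x \<subseteq> {y. \<forall>i. y $ i \<in> {\<lceil>x $ i - L / 2\<rceil>..\<lfloor>x $ i + L / 2\<rfloor>}}"
proof (intro subsetI CollectI allI)
  fix y i assume "y \<in> box L x"
  then have "\<bar>(to_real y - x) $ i\<bar> \<le> L / 2"
    using component_le_infnorm_cart[of "to_real y - x" i] by (simp add: box_def)
  then have "\<bar>real_of_int (y $ i) - x $ i\<bar> \<le> L / 2" by (simp add: to_real_def)
  then show "y $ i \<in> {\<lceil>x $ i - L / 2\<rceil>..\<lfloor>x $ i + L / 2\<rfloor>}"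
    unfolding atLeastAtMost_iff ceiling_le_iff le_floor_iff by linarith
qed

lemma finite_box: "finite (box L x)"
  by (rule vec_subset_PiE(1)[OF _ _ box_subset, where k = "Max (range (\<lambda>i. card {\<lceil>x $ i - L / 2\<rceil>..\<lfloor>x $ i + L / 2\<rfloor>}))"]) auto

lemma card_box_le:
  fixes x :: "real ^ 'd"
  assumes "0 \<le> L"
  shows "real (card (box L x)) \<le> (L + 1) ^ CARD('d)"
proof -
  have "card {\<lceil>x $ i - L / 2\<rceil>..\<lfloor>x $ i + L / 2\<rfloor>} \<le> nat \<lfloor>L + 1\<rfloor>" for i
  proof -
    have "\<lfloor>x $ i + L / 2\<rfloor> - \<lceil>x $ i - L / 2\<rceil> + 1 \<le> \<lfloor>L + 1\<rfloor>"
      unfolding le_floor_iff using of_int_floor_le[of "x $ i + L / 2"] le_of_int_ceiling[of "x $ i - L / 2"] by linarith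
    then show ?thesis by (simp add: nat_mono)
  qed
  then have "card (box L x) \<le> nat \<lfloor>L + 1\<rfloor> ^ CARD('d)"
    by (intro vec_subset_PiE(2)[OF _ _ box_subset]) auto
  then have "real (card (box L x)) \<le> real (nat \<lfloor>L + 1\<rfloor>) ^ CARD('d)"
    by (metis of_nat_le_iff of_nat_power)
  also have "\<dots> \<le> (L + 1) ^ CARD('d)" using assms by (intro power_mono) auto
  finally show ?thesis .
qed

lemma sum_hopping_powr_le:
  fixes x :: "int ^ 'd"
  assumes "finite T" "0 < s" "0 \<le> eps"
  shows "(\<Sum>y\<in>T. \<bar>hopping eps x y\<bar> powr s) \<le> 3 ^ CARD('d) * eps powr s"
proof -
  let ?N = "{y \<in> T. norm (to_real y - to_real x) = 1}"
  \<comment> \<open>A crude count: all neighbours lie in a cube of side 3, whence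
    \<open>3 ^ CARD('d)\<close>.\<close>
  have sub: "?N \<subseteq> {y. \<forall>i. y $ i \<in> {x $ i - 1..x $ i + 1}}"
  proof (intro subsetI CollectI allI)
    fix y i assume "y \<in> ?N"
    then have "\<bar>(to_real y - to_real x) $ i\<bar> \<le> 1"
      using component_le_norm_cart[of "to_real y - to_real x" i] by simp
    then have "\<bar>real_of_int (y $ i - x $ i)\<bar> \<le> 1" by (simp add: to_real_def)
    then show "y $ i \<in> {x $ i - 1..x $ i + 1}" unfolding atLeastAtMost_iff by linarith
  qed
  have card: "card ?N \<le> 3 ^ CARD('d)" by (rule vec_subset_PiE(2)[OF _ _ sub]) auto
  have "(\<Sum>y\<in>T. \<bar>hopping eps x y\<bar> powr s) = (\<Sum>y\<in>T. if norm (to_real y - to_real x) = 1 then eps powr s else 0)"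
    using assms by (intro sum.cong) (auto simp: hopping_def)
  also have "\<dots> = real (card ?N) * eps powr s"
    using assms(1) by (subst sum.inter_filter[symmetric]) auto
  also have "\<dots> \<le> 3 ^ CARD('d) * eps powr s"
    using of_nat_mono[OF card, where 'a = real] by (intro mult_right_mono) auto
  finally show ?thesis .
qed

text \<open>A reformulation of localization without reference to the set of eigenvalues: simplicity
  and spacing become gaps between the labels, and extension by zero confines the basis to a compact
  set. Given \<open>\<phi>\<close> and \<open>lam\<close>, only universal closed conditions
  remain.\<close>

definition labelled_basis ::
    "real \<Rightarrow> real \<Rightarrow> real \<Rightarrow> (int ^ 'd \<Rightarrow> real) \<Rightarrow> real \<Rightarrow> real \<Rightarrow> real ^ 'd \<Rightarrow> (int ^ 'd \<Rightarrow> int ^ 'd \<Rightarrow> complex) \<Rightarrow> (int ^ 'd \<Rightarrow> real) \<Rightarrow> bool" where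
  "labelled_basis \<beta> \<tau> eps w m L x0 \<phi> lam \<longleftrightarrow>
     (\<forall>x z. x \<notin> box L x0 \<or> z \<notin> box L x0 \<longrightarrow> \<phi> x z = 0) \<and>
     orthonormal (box L x0) (box L x0) \<phi> \<and>
     (\<forall>x\<in>box L x0. \<forall>z\<in>box L x0. ham (hopping eps) w (box L x0) (\<phi> x) z = of_real (lam x) * \<phi> x z) \<and>
     (\<forall>x\<in>box L x0. localized \<tau> L x0 x m (\<phi> x)) \<and>
     (\<forall>x\<in>box L x0. \<forall>x'\<in>box L x0. x \<noteq> x' \<longrightarrow> exp (- (L powr \<beta>)) \<le> \<bar>lam x - lam x'\<bar>)"

text \<open>An eigenvector is orthogonal to every basis vector with a different eigenvalue. By
  completeness its eigenvalue, a priori complex, is some \<open>lam x\<close>; since the gaps are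
  positive, it is then a multiple of \<open>\<phi> x\<close>.\<close>

lemma labelled_basis_imp_m_localizing:
  assumes lb: "labelled_basis \<beta> \<tau> eps w m L x0 \<phi> lam"
  shows "m_localizing \<beta> \<tau> eps w m L x0"
proof -
  let ?T = "box L x0" and ?H = "ham (hopping eps) w (box L x0)"
  note T = finite_box[of L x0]
  have out: "\<phi> x z = 0" if "x \<notin> ?T \<or> z \<notin> ?T" for x z using lb that by (auto simp: labelled_basis_def)
  have on: "orthonormal ?T ?T \<phi>" using lb by (simp add: labelled_basis_def)
  have eig: "?H (\<phi> x) z = of_real (lam x) * \<phi> x z" if "x \<in> ?T" "z \<in> ?T" for x z
    using lb that by (simp add: labelled_basis_def)
  have loc: "localized \<tau> L x0 x m (\<phi> x)" if "x \<in> ?T" for x using lb that by (simp add: labelled_basis_def)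
  have sep: "exp (- (L powr \<beta>)) \<le> \<bar>lam x - lam x'\<bar>" if "x \<in> ?T" "x' \<in> ?T" "x \<noteq> x'" for x x'
    using lb that by (simp add: labelled_basis_def)
  note complete = orthonormal_complete[OF T T on refl]
  have eigen_orth: "ip ?T \<psi> (\<phi> x) = 0"
    if \<psi>: "\<And>z. z \<in> ?T \<Longrightarrow> ?H \<psi> z = l * \<psi> z" and x: "x \<in> ?T" and ne: "l \<noteq> of_real (lam x)" for \<psi> l x
  proof -
    have "l * ip ?T \<psi> (\<phi> x) = ip ?T (?H \<psi>) (\<phi> x)"
      unfolding ip_scale_left[symmetric] by (rule ip_cong) (simp_all add: \<psi>)
    also have "\<dots> = ip ?T \<psi> (?H (\<phi> x))" by (rule ip_ham_left[OF hopping_sym])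
    also have "\<dots> = ip ?T \<psi> (\<lambda>z. of_real (lam x) * \<phi> x z)" by (rule ip_cong) (simp_all add: eig x)
    also have "\<dots> = of_real (lam x) * ip ?T \<psi> (\<phi> x)" by (simp add: ip_scale_right)
    finally show ?thesis using ne by simp
  qed
  have spectrum: "\<exists>x\<in>?T. l = of_real (lam x)"
    if \<psi>: "\<And>z. z \<in> ?T \<Longrightarrow> ?H \<psi> z = l * \<psi> z" "\<exists>y\<in>?T. \<psi> y \<noteq> 0" for \<psi> l
    using eigen_orth[OF \<psi>(1)] complete[of \<psi>] \<psi>(2) by blast
  have multiple: "\<psi> z = ip ?T \<psi> (\<phi> x) * \<phi> x z"
    if \<psi>: "\<And>z. z \<in> ?T \<Longrightarrow> ?H \<psi> z = of_real (lam x) * \<psi> z" "\<And>z. z \<notin> ?T \<Longrightarrow> \<psi> z = 0" and x: "x \<in> ?T" for \<psi> x z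
  proof (cases "z \<in> ?T")
    case True
    have "(\<lambda>z. \<psi> z - ip ?T \<psi> (\<phi> x) * \<phi> x z) z = 0"
    proof (rule complete[OF _ True])
      fix x' assume x': "x' \<in> ?T"
      show "ip ?T (\<lambda>z. \<psi> z - ip ?T \<psi> (\<phi> x) * \<phi> x z) (\<phi> x') = 0"
      proof (cases "x' = x")
        case True
        then show ?thesis using orthonormalD[OF on x x] by (simp add: ip_diff_left ip_scale_left)
      next
        case False
        then have "lam x \<noteq> lam x'"
          using less_le_trans[OF exp_gt_zero sep[OF x x']] by auto
        then have "ip ?T \<psi> (\<phi> x') = 0" using eigen_orth[OF \<psi>(1) x'] by simp
        then show ?thesis using orthonormalD[OF on x x'] False by (simp add: ip_diff_left ip_scale_left)
      qed
    qed
    then show ?thesis by simp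
  qed (use \<psi> out in auto)
  show ?thesis
    unfolding m_localizing_def
  proof (intro conjI)
    show "\<forall>l\<in>eigenvalues eps w ?T. simple_eigenvalue eps w ?T l"
      unfolding simple_eigenvalue_def
    proof (intro ballI allI impI, elim conjE)
      fix l \<psi> \<psi>'
      assume out1: "\<forall>y. y \<notin> ?T \<longrightarrow> \<psi> y = 0" and ne: "\<exists>y\<in>?T. \<psi> y \<noteq> 0" and e1: "H_restr eps w ?T \<psi> = (\<lambda>y. l * \<psi> y)"
        and out2: "\<forall>y. y \<notin> ?T \<longrightarrow> \<psi>' y = 0" and e2: "H_restr eps w ?T \<psi>' = (\<lambda>y. l * \<psi>' y)"
      have E: "\<forall>z\<in>?T. ?H \<psi> z = l * \<psi> z" "\<forall>z\<in>?T. ?H \<psi>' z = l * \<psi>' z"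
        using H_restr_eigen_iff[OF T, of \<psi> eps w l] H_restr_eigen_iff[OF T, of \<psi>' eps w l] e1 e2 out1 out2
        by simp_all
      obtain x where x: "x \<in> ?T" "l = of_real (lam x)" using spectrum E(1) ne by blast
      define a b where "a = ip ?T \<psi> (\<phi> x)" and "b = ip ?T \<psi>' (\<phi> x)"
      have ab: "\<psi> z = a * \<phi> x z" "\<psi>' z = b * \<phi> x z" for z
        unfolding a_def b_def using E x(2) out1 out2 by (auto intro!: multiple[OF _ _ x(1)])
      have "a \<noteq> 0" using ne ab by auto
      then show "\<exists>c. \<psi>' = (\<lambda>y. c * \<psi> y)" by (intro exI[of _ "b / a"]) (simp add: ab fun_eq_iff)
    qed
    have ev: "\<exists>x\<in>?T. l = of_real (lam x)" if "l \<in> eigenvalues eps w ?T" for l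
    proof -
      from that obtain \<psi> where \<psi>: "\<And>y. y \<notin> ?T \<Longrightarrow> \<psi> y = 0" "\<exists>y\<in>?T. \<psi> y \<noteq> 0" "H_restr eps w ?T \<psi> = (\<lambda>y. l * \<psi> y)"
        unfolding eigenvalues_def by blast
      have "\<forall>z\<in>?T. ?H \<psi> z = l * \<psi> z"
        using H_restr_eigen_iff[OF T \<psi>(1)] \<psi>(3) by (rule iffD1)
      then show ?thesis by (intro spectrum[OF _ \<psi>(2)]) simp
    qed
    show "\<forall>l\<in>eigenvalues eps w ?T. \<forall>l'\<in>eigenvalues eps w ?T. l \<noteq> l' \<longrightarrow> exp (- (L powr \<beta>)) \<le> cmod (l - l')"
    proof (intro ballI impI)
      fix l l' assume "l \<in> eigenvalues eps w ?T" "l' \<in> eigenvalues eps w ?T" "l \<noteq> l'"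
      then obtain x x' where x: "x \<in> ?T" "l = of_real (lam x)" "x' \<in> ?T" "l' = of_real (lam x')"
        using ev[of l] ev[of l'] by auto
      then have "x \<noteq> x'" using \<open>l \<noteq> l'\<close> by auto
      from x have "cmod (l - l') = \<bar>lam x - lam x'\<bar>"
        by (simp only: of_real_diff[symmetric] norm_of_real)
      then show "exp (- (L powr \<beta>)) \<le> cmod (l - l')" using sep[OF x(1,3) \<open>x \<noteq> x'\<close>] by simp
    qed
    show "\<exists>\<phi> lam. (\<forall>x\<in>?T. eigenpair eps w ?T (\<phi> x) (lam x) \<and> (\<Sum>y\<in>?T. (cmod (\<phi> x y))\<^sup>2) = 1 \<and> localized \<tau> L x0 x m (\<phi> x)) \<and>
      (\<forall>x\<in>?T. \<forall>x'\<in>?T. x \<noteq> x' \<longrightarrow> (\<Sum>y\<in>?T. \<phi> x y * cnj (\<phi> x' y)) = 0)"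
    proof (intro exI[of _ \<phi>] exI[of _ lam] conjI ballI impI)
      fix x assume x: "x \<in> ?T"
      have sq: "sqnorm ?T (\<phi> x) = 1" by (rule orthonormal_sqnorm[OF on x])
      then show "(\<Sum>y\<in>?T. (cmod (\<phi> x y))\<^sup>2) = 1" by (simp add: sqnorm_def)
      have "\<exists>y\<in>?T. \<phi> x y \<noteq> 0" using sq sqnorm_eq_0_iff[OF T, of "\<phi> x"] by auto
      then show "eigenpair eps w ?T (\<phi> x) (lam x)"
        unfolding eigenpair_def using H_restr_eigen_iff[OF T, of "\<phi> x" eps w "of_real (lam x)"] out eig[OF x] by simp
      show "localized \<tau> L x0 x m (\<phi> x)" by (rule loc[OF x])
    next
      fix x x' assume "x \<in> ?T" "x' \<in> ?T" "x \<noteq> x'"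
      then show "(\<Sum>y\<in>?T. \<phi> x y * cnj (\<phi> x' y)) = 0" using orthonormalD[OF on, of x x'] by (simp add: ip_def)
    qed
  qed
qed

text \<open>Orthogonal unit vectors at different sites cannot share a simple eigenvalue, so the
  spacing of distinct eigenvalues becomes a gap between any two labels.\<close>

lemma m_localizing_imp_labelled_basis:
  assumes ml: "m_localizing \<beta> \<tau> eps w m L x0"
  obtains \<phi> lam where "labelled_basis \<beta> \<tau> eps w m L x0 \<phi> lam"
proof -
  let ?T = "box L x0" and ?H = "ham (hopping eps) w (box L x0)"
  note T = finite_box[of L x0]
  from ml obtain \<phi> lam where
    basis: "\<And>x. x \<in> ?T \<Longrightarrow> eigenpair eps w ?T (\<phi> x) (lam x) \<and> sqnorm ?T (\<phi> x) = 1 \<and> localized \<tau> L x0 x m (\<phi> x)"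
    and orth: "\<And>x x'. x \<in> ?T \<Longrightarrow> x' \<in> ?T \<Longrightarrow> x \<noteq> x' \<Longrightarrow> ip ?T (\<phi> x) (\<phi> x') = 0"
    unfolding m_localizing_def sqnorm_def ip_def by blast
  have ev: "complex_of_real (lam x) \<in> eigenvalues eps w ?T" if "x \<in> ?T" for x
    using basis[OF that] unfolding eigenpair_def eigenvalues_def by blast
  have sep: "exp (- (L powr \<beta>)) \<le> \<bar>lam x - lam x'\<bar>" if x: "x \<in> ?T" "x' \<in> ?T" "x \<noteq> x'" for x x'
  proof -
    have "lam x \<noteq> lam x'"
    proof
      assume eq: "lam x = lam x'"
      have "simple_eigenvalue eps w ?T (of_real (lam x))" using ml ev[OF x(1)] by (simp add: m_localizing_def)
      then obtain c where "\<phi> x' = (\<lambda>y. c * \<phi> x y)"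
        using basis[OF x(1)] basis[OF x(2)] eq unfolding simple_eigenvalue_def eigenpair_def by metis
      then have "ip ?T (\<phi> x) (\<phi> x') = cnj c * ip ?T (\<phi> x) (\<phi> x)" "sqnorm ?T (\<phi> x') = (cmod c)\<^sup>2 * sqnorm ?T (\<phi> x)"
        by (simp_all add: ip_scale_right sqnorm_scale)
      then show False using basis[OF x(1)] basis[OF x(2)] orth[OF x] by (auto simp: ip_self)
    qed
    then have "exp (- (L powr \<beta>)) \<le> cmod (of_real (lam x) - of_real (lam x'))"
      using ml ev[OF x(1)] ev[OF x(2)] unfolding m_localizing_def by (metis of_real_eq_iff)
    then show ?thesis by (simp only: of_real_diff[symmetric] norm_of_real)
  qed
  have on: "orthonormal ?T ?T \<phi>" unfolding orthonormal_def using basis orth by (simp add: ip_self)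
  have out: "\<phi> x z = 0" if "x \<in> ?T" "z \<notin> ?T" for x z using basis[OF that(1)] that(2) unfolding eigenpair_def by blast
  have eig: "?H (\<phi> x) z = of_real (lam x) * \<phi> x z" if "x \<in> ?T" "z \<in> ?T" for x z
    using basis[OF that(1)] H_restr_eigen_iff[OF T, of "\<phi> x" eps w] out[OF that(1)] that(2) unfolding eigenpair_def by blast
  \<comment> \<open>Vectors indexed by sites outside the box are arbitrary in the given basis; they
    are set to zero for the later compactness argument.\<close>
  define \<psi> where "\<psi> = (\<lambda>x. if x \<in> ?T then \<phi> x else (\<lambda>_. 0))"
  have "labelled_basis \<beta> \<tau> eps w m L x0 \<psi> lam"
    unfolding labelled_basis_def
    using on out eig basis sep by (auto simp: \<psi>_def orthonormal_def)
  then show thesis by (rule that)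
qed

lemma continuous_on_snd_coordinate2 [continuous_intros]:
  "continuous_on S (\<lambda>p. (snd p :: 'a \<Rightarrow> 'c \<Rightarrow> 'b::topological_space) x z)"
  by (rule continuous_on_product_then_coordinatewise[OF continuous_on_snd_coordinate])

text \<open>With the eigenvalues expressed as expectation values, \<open>labelled_basis\<close> is a jointly closed
  condition on the potential and the basis, and the bases range over a compact set.\<close>
lemma closed_m_localizing:
  fixes x0 :: "real ^ 'd"
  shows "closed {w. m_localizing \<beta> \<tau> eps w m L x0}"
proof -
  let ?T = "box L x0"
  note T = finite_box[of L x0]
  define lam where "lam = (\<lambda>w (\<phi> :: int ^ 'd \<Rightarrow> int ^ 'd \<Rightarrow> complex) x. Re (ip ?T (ham (hopping eps) w ?T (\<phi> x)) (\<phi> x)))"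
  define K0 where "K0 = (\<lambda>x z. if x \<in> ?T \<and> z \<in> ?T then cball (0::complex) 1 else {0})"
  define K where "K = {\<phi> :: int ^ 'd \<Rightarrow> int ^ 'd \<Rightarrow> complex. \<forall>x. \<phi> x \<in> {u. \<forall>z. u z \<in> K0 x z}}"
  have K: "compact K" unfolding K_def by (intro compact_function_box) (auto simp: K0_def)
  let ?S = "{p. labelled_basis \<beta> \<tau> eps (fst p) m L x0 (snd p) (lam (fst p) (snd p))}"
  have "closed ?S"
    unfolding labelled_basis_def orthonormal_def localized_def ip_def ham_def lam_def Ball_def
    by (intro closed_Collect_conj closed_Collect_all closed_Collect_imp open_Collect_const
        closed_Collect_eq closed_Collect_le continuous_intros)
  then have "closed {w. \<exists>\<phi>\<in>K. (w, \<phi>) \<in> ?S}" by (rule closed_projection[OF K])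
  moreover have "{w. m_localizing \<beta> \<tau> eps w m L x0} = {w. \<exists>\<phi>\<in>K. (w, \<phi>) \<in> ?S}"
  proof (intro set_eqI iffI)
    fix w assume "w \<in> {w. m_localizing \<beta> \<tau> eps w m L x0}"
    then obtain \<phi> l where lb: "labelled_basis \<beta> \<tau> eps w m L x0 \<phi> l"
      using m_localizing_imp_labelled_basis by blast
    have on: "orthonormal ?T ?T \<phi>" using lb by (simp add: labelled_basis_def)
    have "lam w \<phi> x = l x" if x: "x \<in> ?T" for x
    proof -
      have "ip ?T (ham (hopping eps) w ?T (\<phi> x)) (\<phi> x) = ip ?T (\<lambda>z. of_real (l x) * \<phi> x z) (\<phi> x)"
        using lb x by (intro ip_cong) (auto simp: labelled_basis_def)
      then show ?thesis using orthonormalD[OF on x x] by (simp add: lam_def ip_scale_left)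
    qed
    then have "labelled_basis \<beta> \<tau> eps w m L x0 \<phi> (lam w \<phi>)"
      using lb by (simp add: labelled_basis_def)
    moreover have "\<phi> \<in> K"
    proof -
      have "\<phi> x z \<in> K0 x z" for x z
        using lb norm_le_sqnorm[OF T, of z "\<phi> x"] orthonormal_sqnorm[OF on, of x]
        by (auto simp: K0_def labelled_basis_def power_le_one_iff)
      then show ?thesis by (simp add: K_def)
    qed
    ultimately show "w \<in> {w. \<exists>\<phi>\<in>K. (w, \<phi>) \<in> ?S}" by auto
  next
    fix w assume "w \<in> {w. \<exists>\<phi>\<in>K. (w, \<phi>) \<in> ?S}"
    then show "w \<in> {w. m_localizing \<beta> \<tau> eps w m L x0}" using labelled_basis_imp_m_localizing by auto
  qed
  ultimately show ?thesis by simp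
qed

section \<open>The probability of localization\<close>

text \<open>In the application \<open>T\<close> is \<open>L powr \<tau>\<close> and \<open>N\<close>
  bounds the number of sites. The outer \<open>n\<^sup>2\<close> counts the pairs.\<close>

lemma first_error_le:
  fixes n N C B c1 R T :: real
  assumes "0 \<le> n" "n \<le> N" "1 \<le> N" "1 \<le> C" "0 \<le> B" "0 < c1" "T / 4 \<le> R"
  shows "n\<^sup>2 * (B * (2 * n * C * exp 8 + n\<^sup>2 * C\<^sup>2) * exp (- c1 * R))
    \<le> B * 3 * C\<^sup>2 * exp 8 * N ^ 4 * exp (- (c1 / 4) * T)"
proof -
  have n2: "n\<^sup>2 \<le> N\<^sup>2" using assms by (intro power_mono) auto
  have "n * C \<le> N\<^sup>2 * C\<^sup>2"
    using assms by (intro mult_mono order_trans[OF assms(2)]) (auto simp: power2_eq_square)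
  then have "2 * n * C * exp 8 \<le> 2 * (N\<^sup>2 * C\<^sup>2) * exp 8" by simp
  moreover have "n\<^sup>2 * C\<^sup>2 \<le> N\<^sup>2 * C\<^sup>2 * exp 8"
  proof -
    have "n\<^sup>2 * C\<^sup>2 \<le> N\<^sup>2 * C\<^sup>2 * 1" using n2 by (simp add: mult_right_mono)
    also have "\<dots> \<le> N\<^sup>2 * C\<^sup>2 * exp 8" by (intro mult_left_mono) auto
    finally show ?thesis .
  qed
  ultimately have sum: "2 * n * C * exp 8 + n\<^sup>2 * C\<^sup>2 \<le> 3 * (N\<^sup>2 * C\<^sup>2 * exp 8)" by linarith
  have "c1 * (T / 4) \<le> c1 * R" using assms by (intro mult_left_mono) auto
  then have e: "exp (- c1 * R) \<le> exp (- (c1 / 4) * T)" by simp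
  have "n\<^sup>2 * (B * (2 * n * C * exp 8 + n\<^sup>2 * C\<^sup>2) * exp (- c1 * R))
      \<le> N\<^sup>2 * (B * (3 * (N\<^sup>2 * C\<^sup>2 * exp 8)) * exp (- (c1 / 4) * T))"
    using assms by (intro mult_mono n2 sum e) (auto intro!: mult_nonneg_nonneg add_nonneg_nonneg)
  also have "\<dots> = B * 3 * C\<^sup>2 * exp 8 * N ^ 4 * exp (- (c1 / 4) * T)"
    by (simp add: power2_eq_square power4_eq_xxxx)
  finally show ?thesis .
qed

text \<open>After taking logarithms, \<open>L powr a\<close> dominates the logarithmic terms and
  \<open>L powr \<xi>\<close>. The factor 1/2 lets two errors share the allowed probability.\<close>

lemma stretched_exponential_eventually_le:
  fixes D c a \<xi> :: real and k :: nat
  assumes "0 < D" "0 < c" "0 < \<xi>" "\<xi> < a"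
  shows "\<forall>\<^sub>F L in at_top. D * (L + 1) ^ k * exp (- c * L powr a) \<le> exp (- (L powr \<xi>)) / 2"
proof -
  have "((\<lambda>L. (ln (2 * D) + real k * ln (L + 1) + L powr \<xi>) / L powr a) \<longlongrightarrow> 0) at_top"
    using assms by real_asymp
  then have "\<forall>\<^sub>F L in at_top. (ln (2 * D) + real k * ln (L + 1) + L powr \<xi>) / L powr a < c"
    using assms(2) by (rule order_tendstoD)
  then show ?thesis
    using eventually_gt_at_top[of 0]
  proof eventually_elim
    case (elim L)
    then have "ln (2 * D) + real k * ln (L + 1) + L powr \<xi> \<le> c * L powr a"
      by (simp add: field_simps)
    then have "exp (ln (2 * D) + real k * ln (L + 1) + - (c * L powr a)) \<le> exp (- (L powr \<xi>))"
      by simp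
    also have "exp (ln (2 * D) + real k * ln (L + 1) + - (c * L powr a)) = 2 * D * (L + 1) ^ k * exp (- c * L powr a)"
      using elim assms(1) by (simp only: exp_add exp_of_nat_mult) simp
    finally show ?case by simp
  qed
qed

text \<open>Gershgorin's argument: read the eigenvalue equation at a site where the eigenvector has
  maximal modulus.\<close>

lemma eigenvalue_bound:
  assumes T: "finite T" and u: "sqnorm T u = 1" and eig: "\<And>z. z \<in> T \<Longrightarrow> ham A w T u z = of_real l * u z"
    and w: "\<And>z. z \<in> T \<Longrightarrow> \<bar>w z\<bar> \<le> c" and row: "\<And>z. z \<in> T \<Longrightarrow> (\<Sum>y\<in>T. \<bar>A z y\<bar>) \<le> 1"
  shows "\<bar>l\<bar> \<le> c + 1"
proof -
  have "T \<noteq> {}" using u by (auto simp: sqnorm_def)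
  have "Max ((\<lambda>z. cmod (u z)) ` T) \<in> (\<lambda>z. cmod (u z)) ` T"
    using T \<open>T \<noteq> {}\<close> by (intro Max_in) auto
  then obtain x where "x \<in> T" and max: "Max ((\<lambda>z. cmod (u z)) ` T) = cmod (u x)" by blast
  then have x: "x \<in> T" "\<And>z. z \<in> T \<Longrightarrow> cmod (u z) \<le> cmod (u x)"
    unfolding max[symmetric] using T by auto
  obtain z where z: "z \<in> T" "u z \<noteq> 0" using u sqnorm_eq_0_iff[OF T, of u] by auto
  then have pos: "cmod (u x) > 0" using less_le_trans[OF _ x(2)[OF z(1)], of 0] by simp
  have "\<bar>l\<bar> * cmod (u x) = cmod (ham A w T u x)" by (simp add: eig x(1) norm_mult)
  also have "\<dots> \<le> cmod (of_real (w x) * u x) + cmod (\<Sum>y\<in>T. of_real (A x y) * u y)"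
    unfolding ham_def by (rule norm_triangle_ineq)
  also have "cmod (of_real (w x) * u x) \<le> c * cmod (u x)"
    unfolding norm_mult norm_of_real using w x(1) by (intro mult_right_mono) auto
  also have "cmod (\<Sum>y\<in>T. of_real (A x y) * u y) \<le> (\<Sum>y\<in>T. \<bar>A x y\<bar> * cmod (u x))"
  proof (rule sum_norm_le)
    fix y assume "y \<in> T"
    then show "cmod (of_real (A x y) * u y) \<le> \<bar>A x y\<bar> * cmod (u x)"
      unfolding norm_mult norm_of_real using x(2) by (intro mult_left_mono) auto
  qed
  also have "\<dots> = (\<Sum>y\<in>T. \<bar>A x y\<bar>) * cmod (u x)" by (simp add: sum_distrib_right)
  also have "\<dots> \<le> 1 * cmod (u x)" using row[OF x(1)] by (intro mult_right_mono) auto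
  finally have "\<bar>l\<bar> * cmod (u x) \<le> (c + 1) * cmod (u x)" by (simp add: distrib_right)
  then show ?thesis using pos by simp
qed

context iid_potential
begin

lemma AE_coordinate_bounded:
  assumes "measure \<mu> {-c..c} = 1"
  shows "AE w in (P :: ('a \<Rightarrow> real) measure). \<bar>w x\<bar> \<le> c"
proof -
  let ?N = "{w \<in> space P. \<not> \<bar>w x\<bar> \<le> c}"
  have N: "?N \<in> sets (P :: ('a \<Rightarrow> real) measure)" by measurable
  have "emeasure P (?N \<inter> UNIV) \<le> 0 * emeasure P (UNIV :: ('a \<Rightarrow> real) set)"
  proof (rule emeasure_decouple[OF N])
    fix w :: "'a \<Rightarrow> real"
    have "{a. w(x := a) \<in> ?N} = space \<mu> - {-c..c}" by (auto simp: space_P space_mu)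
    then have "measure \<mu> {a. w(x := a) \<in> ?N} = 0"
      using mu.prob_compl[of "{-c..c}"] assms by (simp add: sets_mu)
    then show "emeasure \<mu> {a. w(x := a) \<in> ?N} \<le> 0" by (simp add: mu.emeasure_eq_measure)
  qed (use sets.top[of P] in \<open>auto simp: space_P\<close>)
  then have "emeasure P ?N = 0" by simp
  then show ?thesis using N by (subst AE_iff_measurable[OF N]) auto
qed

text \<open>A union bound over pairs at distance at least \<open>R\<close> and over small gaps.
  \<open>R\<close> is half of the localization threshold because labelling by sites doubles the
  distance from which decay holds; it also turns the rate \<open>m\<close> into
  \<open>m / 2\<close>.\<close>

lemma emeasure_not_localizing_le:
  fixes x0 :: "real ^ 'd" and s C c eps \<beta> \<tau> L :: real
  defines "n \<equiv> card (box L x0)" and "m \<equiv> (2 * s - 1) / (8 * s)" and "R \<equiv> real_of_int \<lfloor>L powr \<tau>\<rfloor> / 2"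
    and "\<delta> \<equiv> exp (- (L powr \<beta>))"
  assumes C: "\<And>a. (\<integral>\<^sup>+t. ennreal (\<bar>t - a\<bar> powr (-s)) \<partial>\<mu>) \<le> ennreal C" "1 \<le> C"
    and s: "1/2 < s" "s \<le> 1" and c: "measure \<mu> {-c..c} = 1" "0 \<le> c"
    and eps: "0 < eps" "eps \<le> 1" "C * (3 ^ CARD('d) * eps powr s) \<le> exp (-8)"
    and R: "0 < R" "2 * real n * exp (- m * R) \<le> 1" and \<delta>: "8 * \<delta> * n \<le> 1"
  shows "emeasure P {w. \<not> m_localizing \<beta> \<tau> eps w (m / 2) L x0}
     \<le> ennreal ((real n)\<^sup>2 * ((2 * (c + 1) + 5) * (2 * real n * C * exp 8 + (real n)\<^sup>2 * C\<^sup>2) * exp (- ((2 * s - 1) / 2) * R))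
       + (2 * (c + 1) / \<delta> + 5) * (real n)\<^sup>2 * (K * (8 * \<delta> * n) powr \<alpha>)\<^sup>2)"
proof -
  define T where "T = box L x0"
  define A where "A = (hopping eps :: int ^ 'd \<Rightarrow> int ^ 'd \<Rightarrow> real)"
  have T: "finite T" unfolding T_def by (rule finite_box)
  have n: "n = card T" by (simp add: n_def T_def)
  have sym: "A x y = A y x" and diag: "A x x = 0" for x y
    unfolding A_def by (rule hopping_sym, rule hopping_diag)
  have s0: "0 < s" using s by simp
  have hop: "C * (\<Sum>w\<in>T. \<bar>A x w\<bar> powr s) \<le> exp (-8)" for x
  proof -
    have "C * (\<Sum>w\<in>T. \<bar>A x w\<bar> powr s) \<le> C * (3 ^ CARD('d) * eps powr s)"
      unfolding A_def using C(2) eps s0 T by (intro mult_left_mono sum_hopping_powr_le) auto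
    then show ?thesis using eps by simp
  qed
  have row: "(\<Sum>w\<in>T. \<bar>A x w\<bar>) \<le> 1" for x
  proof -
    have "(\<Sum>w\<in>T. \<bar>A x w\<bar>) \<le> (\<Sum>w\<in>T. \<bar>A x w\<bar> powr s)"
    proof (rule sum_mono)
      fix w
      have "\<bar>A x w\<bar> powr 1 \<le> \<bar>A x w\<bar> powr s"
        using eps s by (intro powr_mono') (auto simp: A_def hopping_def)
      then show "\<bar>A x w\<bar> \<le> \<bar>A x w\<bar> powr s" by simp
    qed
    also have "\<dots> \<le> C * (\<Sum>w\<in>T. \<bar>A x w\<bar> powr s)"
      using mult_right_mono[OF C(2), of "\<Sum>w\<in>T. \<bar>A x w\<bar> powr s"] by (simp add: sum_nonneg)
    also have "\<dots> \<le> exp (-8)" by (rule hop)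
    also have "\<dots> \<le> 1" by simp
    finally show ?thesis .
  qed
  let ?B = "c + 1"
  define q where "q = (2 * ?B + 5) * (2 * real n * C * exp 8 + (real n)\<^sup>2 * C\<^sup>2) * exp (- ((2 * s - 1) / 2) * R)"
  have q: "0 \<le> q" using C(2) c(2) by (simp add: q_def)
  define bad where "bad = (\<lambda>x y S. S \<in> sets P \<and> emeasure P S \<le> ennreal q \<and>
    (AE w in P. w \<notin> S \<longrightarrow> (\<forall>u l. sqnorm T u = 1 \<longrightarrow> (\<forall>z\<in>T. ham A w T u z = of_real l * u z) \<longrightarrow> \<bar>l\<bar> \<le> ?B \<longrightarrow>
      cmod (u x) \<le> 2 * real n * exp (- 2 * m * site_dist x y) \<or> cmod (u y) \<le> 2 * real n * exp (- 2 * m * site_dist x y))))"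
  have "\<exists>S. bad x y S" if xy: "x \<in> T" "y \<in> T" "R \<le> site_dist x y" for x y
  proof -
    have d0: "0 < site_dist x y" using xy R by simp
    have B0: "0 \<le> ?B" using c(2) by simp
    obtain S where S: "S \<in> sets P"
      "emeasure P S \<le> ennreal ((2 * ?B + 5) * (2 * real n * C * exp 8 + (real n)\<^sup>2 * C\<^sup>2) * exp (- ((2 * s - 1) / 2) * site_dist x y))"
      "AE w in P. w \<notin> S \<longrightarrow> (\<forall>u l. sqnorm T u = 1 \<longrightarrow> (\<forall>z\<in>T. ham A w T u z = of_real l * u z) \<longrightarrow> \<bar>l\<bar> \<le> ?B \<longrightarrow>
        cmod (u x) \<le> 2 * real n * exp (- 2 * m * site_dist x y) \<or> cmod (u y) \<le> 2 * real n * exp (- 2 * m * site_dist x y))"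
      using pair_localization[where A = A and d = site_dist and s = s and C = C and B = ?B and m = m and r = "site_dist x y" and n = n and T = T and x = x and y = y,
          OF C s _ T xy(1,2) n diag hop row site_dist_self site_dist_sym site_dist_triangle site_dist_nonneg _ refl d0 B0]
      by (auto simp: m_def A_def site_dist_hopping)
    note S(2)
    also have "ennreal ((2 * ?B + 5) * (2 * real n * C * exp 8 + (real n)\<^sup>2 * C\<^sup>2) * exp (- ((2 * s - 1) / 2) * site_dist x y)) \<le> ennreal q"
      unfolding q_def using C(2) c(2) s xy(3) by (intro ennreal_leI mult_left_mono) (auto intro!: mult_left_mono)
    finally show ?thesis using S by (auto simp: bad_def)
  qed
  then obtain S where S: "\<And>x y. x \<in> T \<Longrightarrow> y \<in> T \<Longrightarrow> R \<le> site_dist x y \<Longrightarrow> bad x y (S x y)" by metis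
  have B0: "0 \<le> ?B" using c(2) by simp
  obtain S0 where S0: "S0 \<in> sets P" "emeasure P S0 \<le> ennreal ((2 * ?B / \<delta> + 5) * (real n)\<^sup>2 * (K * (8 * \<delta> * n) powr \<alpha>)\<^sup>2)"
    and spacing: "\<And>w u v l l'. w \<notin> S0 \<Longrightarrow> sqnorm T u = 1 \<Longrightarrow> (\<And>z. z \<notin> T \<Longrightarrow> u z = 0) \<Longrightarrow> sqnorm T v = 1 \<Longrightarrow>
      (\<And>z. z \<notin> T \<Longrightarrow> v z = 0) \<Longrightarrow> ip T u v = 0 \<Longrightarrow>
      (\<And>z. z \<in> T \<Longrightarrow> ham A w T u z = of_real l * u z) \<Longrightarrow>
      (\<And>z. z \<in> T \<Longrightarrow> ham A w T v z = of_real l' * v z) \<Longrightarrow> \<bar>l\<bar> \<le> ?B \<Longrightarrow> \<delta> \<le> \<bar>l - l'\<bar>"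
    using eigenvalue_spacing[where A = A and T = T, OF T sym n _ \<delta> B0] by (auto simp: \<delta>_def)
  define Q where "Q = {xy \<in> T \<times> T. R \<le> site_dist (fst xy) (snd xy)}"
  have Q: "finite Q" "card Q \<le> n\<^sup>2"
  proof -
    have sub: "Q \<subseteq> T \<times> T" by (auto simp: Q_def)
    then show "finite Q" using T finite_subset by blast
    have "card Q \<le> card (T \<times> T)" by (intro card_mono sub) (simp add: T)
    then show "card Q \<le> n\<^sup>2" by (simp add: n power2_eq_square card_cartesian_product)
  qed
  have SQ: "bad (fst p) (snd p) (S (fst p) (snd p))" if "p \<in> Q" for p
    using that by (intro S) (auto simp: Q_def)
  define Z where "Z = (\<Union>p\<in>Q. S (fst p) (snd p)) \<union> S0"
  have Z: "Z \<in> sets P" unfolding Z_def using SQ Q S0 by (intro sets.Un sets.finite_UN) (auto simp: bad_def)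
  have "AE w in P. (\<forall>z\<in>T. \<bar>w z\<bar> \<le> c) \<and>
      (\<forall>p\<in>Q. w \<notin> S (fst p) (snd p) \<longrightarrow> (\<forall>u l. sqnorm T u = 1 \<longrightarrow> (\<forall>z\<in>T. ham A w T u z = of_real l * u z) \<longrightarrow> \<bar>l\<bar> \<le> ?B \<longrightarrow>
      cmod (u (fst p)) \<le> 2 * real n * exp (- 2 * m * site_dist (fst p) (snd p)) \<or>
      cmod (u (snd p)) \<le> 2 * real n * exp (- 2 * m * site_dist (fst p) (snd p))))"
    using SQ Q T AE_coordinate_bounded[OF c(1)] by (intro AE_conjI AE_finite_allI) (auto simp: bad_def)
  then have "AE w in P. w \<notin> Z \<longrightarrow> m_localizing \<beta> \<tau> eps w (m / 2) L x0"
  proof (eventually_elim, intro impI)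
    fix w assume w: "(\<forall>z\<in>T. \<bar>w z\<bar> \<le> c) \<and>
      (\<forall>p\<in>Q. w \<notin> S (fst p) (snd p) \<longrightarrow> (\<forall>u l. sqnorm T u = 1 \<longrightarrow> (\<forall>z\<in>T. ham A w T u z = of_real l * u z) \<longrightarrow> \<bar>l\<bar> \<le> ?B \<longrightarrow>
      cmod (u (fst p)) \<le> 2 * real n * exp (- 2 * m * site_dist (fst p) (snd p)) \<or>
      cmod (u (snd p)) \<le> 2 * real n * exp (- 2 * m * site_dist (fst p) (snd p))))" and notin: "w \<notin> Z"
    obtain \<phi> :: "nat \<Rightarrow> int ^ 'd \<Rightarrow> complex" and lam where
      on: "orthonormal T {..<card T} \<phi>" and out: "\<And>i z. i < card T \<Longrightarrow> z \<notin> T \<Longrightarrow> \<phi> i z = 0"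
      and eig: "\<And>i z. i < card T \<Longrightarrow> z \<in> T \<Longrightarrow> ham A w T (\<phi> i) z = of_real (lam i) * \<phi> i z"
      by (rule spectral_theorem[where A = A and v = w, OF T sym]) blast
    note on = on[folded n] and out = out[folded n] and eig = eig[folded n]
    have sq: "sqnorm T (\<phi> i) = 1" if "i < n" for i using orthonormal_sqnorm[OF on] that by simp
    have lam: "\<bar>lam i\<bar> \<le> ?B" if "i < n" for i
      by (rule eigenvalue_bound[OF T sq[OF that] eig[OF that] _ row]) (use conjunct1[OF w] that in auto)
    have m: "0 < m" using s by (simp add: m_def)
    have R2: "real n * exp (- m * R) \<le> 1 / 2" using R(2) by simp
    obtain \<sigma> where \<sigma>: "bij_betw \<sigma> T {..<n}"
      "\<And>x y. x \<in> T \<Longrightarrow> y \<in> T \<Longrightarrow> 2 * R \<le> site_dist x y \<Longrightarrow> cmod (\<phi> (\<sigma> x) y) \<le> exp (- (m / 2) * site_dist x y)"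
    proof (rule eigenfunction_labelling[OF T n on site_dist_self site_dist_sym site_dist_triangle m R(1)])
      have "real n \<le> (real n)\<^sup>2" by (cases "n = 0") (simp_all add: power2_eq_square)
      then have "sqrt n \<le> real n" by (intro real_le_lsqrt) auto
      then have "exp (- m * R) * sqrt n \<le> exp (- m * R) * real n" by (intro mult_left_mono) auto
      also have "\<dots> = real n * exp (- m * R)" by (rule mult.commute)
      finally show "exp (- m * R) * sqrt n < 1" using R2 by linarith
      have "(real n * exp (- m * R))\<^sup>2 \<le> (1 / 2)\<^sup>2" using R2 by (intro power_mono) auto
      also have "(real n * exp (- m * R))\<^sup>2 = (real n)\<^sup>2 * exp (- 2 * m * R)"
        using exp_double[of "- m * R"] by (simp only: power_mult_distrib) (simp add: mult.assoc)
      finally show "(real n)\<^sup>2 * exp (- 2 * m * R) < 1"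
        by (rule order_le_less_trans) (simp add: power2_eq_square)
    next
      fix i x y assume i: "i < n" and xy: "x \<in> T" "y \<in> T" "R \<le> site_dist x y"
      have p: "(x, y) \<in> Q" using xy by (simp add: Q_def)
      have "w \<notin> S x y" using notin UN_I[OF p, of w "\<lambda>p. S (fst p) (snd p)"] by (auto simp: Z_def)
      then have "\<forall>u l. sqnorm T u = 1 \<longrightarrow> (\<forall>z\<in>T. ham A w T u z = of_real l * u z) \<longrightarrow> \<bar>l\<bar> \<le> ?B \<longrightarrow>
          cmod (u x) \<le> 2 * real n * exp (- 2 * m * site_dist x y) \<or> cmod (u y) \<le> 2 * real n * exp (- 2 * m * site_dist x y)"
        using bspec[OF conjunct2[OF w] p] by simp
      then have "cmod (\<phi> i x) \<le> 2 * real n * exp (- 2 * m * site_dist x y) \<or> cmod (\<phi> i y) \<le> 2 * real n * exp (- 2 * m * site_dist x y)"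
        using sq[OF i] eig[OF i] lam[OF i] by blast
      \<comment> \<open>Half of the rate \<open>2 * m\<close> is spent on absorbing the prefactor
        \<open>2 * n\<close>, since the distance is at least \<open>R\<close>.\<close>
      moreover have "2 * real n * exp (- 2 * m * site_dist x y) \<le> exp (- m * site_dist x y)"
      proof -
        have "2 * real n * exp (- m * site_dist x y) \<le> 2 * real n * exp (- m * R)"
          using m xy(3) by (intro mult_left_mono) auto
        also have "\<dots> \<le> 1" by (rule R(2))
        finally have "2 * real n * exp (- m * site_dist x y) * exp (- m * site_dist x y) \<le> 1 * exp (- m * site_dist x y)"
          by (intro mult_right_mono) auto
        also have "2 * real n * exp (- m * site_dist x y) * exp (- m * site_dist x y) = 2 * real n * exp (- 2 * m * site_dist x y)"
          unfolding mult.assoc[of _ "exp _"] exp_add[symmetric] by (simp add: algebra_simps)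
        finally show ?thesis by simp
      qed
      ultimately show "cmod (\<phi> i x) \<le> exp (- m * site_dist x y) \<or> cmod (\<phi> i y) \<le> exp (- m * site_dist x y)"
        by linarith
    qed blast
    have \<sigma>n: "\<sigma> x < n" if "x \<in> T" for x using bij_betwE[OF \<sigma>(1)] that by auto
    have \<sigma>inj: "\<sigma> x = \<sigma> y \<longleftrightarrow> x = y" if "x \<in> T" "y \<in> T" for x y
      using bij_betw_imp_inj_on[OF \<sigma>(1)] that by (auto dest: inj_onD)
    have "labelled_basis \<beta> \<tau> eps w (m / 2) L x0 (\<lambda>x. if x \<in> T then \<phi> (\<sigma> x) else (\<lambda>_. 0)) (\<lambda>x. lam (\<sigma> x))"
      unfolding labelled_basis_def T_def[symmetric] A_def[symmetric]
    proof (intro conjI)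
      show "orthonormal T T (\<lambda>x. if x \<in> T then \<phi> (\<sigma> x) else (\<lambda>_. 0))"
        using on \<sigma>n \<sigma>inj by (auto simp: orthonormal_def)
      show "\<forall>x\<in>T. localized \<tau> L x0 x (m / 2) (if x \<in> T then \<phi> (\<sigma> x) else (\<lambda>_. 0))"
        unfolding localized_def T_def[symmetric]
        using \<sigma>(2) by (auto simp: R_def site_dist_def infnorm_sub)
      show "\<forall>x\<in>T. \<forall>x'\<in>T. x \<noteq> x' \<longrightarrow> exp (- (L powr \<beta>)) \<le> \<bar>lam (\<sigma> x) - lam (\<sigma> x')\<bar>"
      proof (intro ballI impI)
        fix x x' assume x: "x \<in> T" "x' \<in> T" "x \<noteq> x'"
        have "ip T (\<phi> (\<sigma> x)) (\<phi> (\<sigma> x')) = 0" using orthonormalD[OF on] \<sigma>n \<sigma>inj x by auto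
        then have "\<delta> \<le> \<bar>lam (\<sigma> x) - lam (\<sigma> x')\<bar>"
          using notin x by (intro spacing[of w "\<phi> (\<sigma> x)" "\<phi> (\<sigma> x')"] sq out eig lam \<sigma>n) (auto simp: Z_def)
        then show "exp (- (L powr \<beta>)) \<le> \<bar>lam (\<sigma> x) - lam (\<sigma> x')\<bar>" by (simp add: \<delta>_def)
      qed
    qed (use out eig \<sigma>n in auto)
    then show "m_localizing \<beta> \<tau> eps w (m / 2) L x0" by (rule labelled_basis_imp_m_localizing)
  qed
  then have "emeasure P {w. \<not> m_localizing \<beta> \<tau> eps w (m / 2) L x0} \<le> emeasure P Z"
    by (intro emeasure_mono_AE Z) auto
  also have "\<dots> \<le> emeasure P (\<Union>p\<in>Q. S (fst p) (snd p)) + emeasure P S0"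
    unfolding Z_def using SQ Q S0 by (intro emeasure_subadditive sets.finite_UN) (auto simp: bad_def)
  also have "\<dots> \<le> ennreal ((real n)\<^sup>2 * q) + ennreal ((2 * ?B / \<delta> + 5) * (real n)\<^sup>2 * (K * (8 * \<delta> * n) powr \<alpha>)\<^sup>2)"
  proof (intro add_mono S0)
    have "emeasure P (\<Union>p\<in>Q. S (fst p) (snd p)) \<le> (\<Sum>p\<in>Q. emeasure P (S (fst p) (snd p)))"
      using SQ Q by (intro emeasure_subadditive_finite) (auto simp: bad_def)
    also have "\<dots> \<le> (\<Sum>p\<in>Q. ennreal q)" using SQ by (intro sum_mono) (auto simp: bad_def)
    also have "\<dots> = ennreal (real (card Q) * q)" using q by (simp add: ennreal_mult ennreal_of_nat_eq_real_of_nat)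
    also have "\<dots> \<le> ennreal ((real n)\<^sup>2 * q)"
      using Q(2) q by (intro ennreal_leI mult_right_mono) (simp_all flip: of_nat_power)
    finally show "emeasure P (\<Union>p\<in>Q. S (fst p) (snd p)) \<le> ennreal ((real n)\<^sup>2 * q)" .
  qed
  also have "\<dots> = ennreal ((real n)\<^sup>2 * q + (2 * ?B / \<delta> + 5) * (real n)\<^sup>2 * (K * (8 * \<delta> * n) powr \<alpha>)\<^sup>2)"
    using q c(2) by (intro ennreal_plus[symmetric]) (auto simp: \<delta>_def)
  finally show ?thesis by (simp add: q_def)
qed

text \<open>With \<open>T\<close> equal to \<open>L powr \<beta>\<close>, the net of energies
  contributes \<open>exp T\<close> and the squared Hoelder bound
  \<open>exp (- (2 * \<alpha> * T))\<close>; the remaining rate \<open>2 * \<alpha> - 1\<close> is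
  positive.\<close>

lemma second_error_le:
  fixes n N B T :: real
  assumes n: "0 \<le> n" "n \<le> N" "1 \<le> N" and B: "0 \<le> B" and T: "0 \<le> T"
  shows "(2 * B / exp (- T) + 5) * n\<^sup>2 * (K * (8 * exp (- T) * n) powr \<alpha>)\<^sup>2
    \<le> (2 * B + 5) * 64 * K\<^sup>2 * N ^ 4 * exp (- (2 * \<alpha> - 1) * T)"
proof -
  have "(8 * exp (- T) * n) powr \<alpha> \<le> (8 * N * exp (- T)) powr \<alpha>"
    using n alpha by (intro powr_mono2) auto
  also have "\<dots> = (8 * N) powr \<alpha> * exp (- (\<alpha> * T))"
    using n by (simp add: powr_mult) (simp add: powr_def)
  also have "\<dots> \<le> (8 * N) * exp (- (\<alpha> * T))"
    using n alpha powr_mono[of \<alpha> 1 "8 * N"] by (intro mult_right_mono) auto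
  finally have p: "(8 * exp (- T) * n) powr \<alpha> \<le> 8 * N * exp (- (\<alpha> * T))" .
  have "(K * (8 * exp (- T) * n) powr \<alpha>)\<^sup>2 \<le> (K * (8 * N * exp (- (\<alpha> * T))))\<^sup>2"
    using K_nonneg p by (intro power_mono mult_left_mono) auto
  also have "\<dots> = 64 * K\<^sup>2 * N\<^sup>2 * exp (- (2 * \<alpha> * T))"
    using exp_double[of "- (\<alpha> * T)"] by (simp add: power_mult_distrib mult.assoc)
  finally have sq: "(K * (8 * exp (- T) * n) powr \<alpha>)\<^sup>2 \<le> 64 * K\<^sup>2 * N\<^sup>2 * exp (- (2 * \<alpha> * T))" .
  have "1 \<le> exp T" using T by simp
  then have pre: "2 * B / exp (- T) + 5 \<le> (2 * B + 5) * exp T"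
    by (simp add: exp_minus field_simps del: one_le_exp_iff)
  have n2: "n\<^sup>2 \<le> N\<^sup>2" using n by (intro power_mono) auto
  have "(2 * B / exp (- T) + 5) * n\<^sup>2 * (K * (8 * exp (- T) * n) powr \<alpha>)\<^sup>2
      \<le> (2 * B + 5) * exp T * N\<^sup>2 * (64 * K\<^sup>2 * N\<^sup>2 * exp (- (2 * \<alpha> * T)))"
    using B by (intro mult_mono pre n2 sq) auto
  also have "\<dots> = (2 * B + 5) * 64 * K\<^sup>2 * N ^ 4 * (exp T * exp (- (2 * \<alpha> * T)))"
    by (simp add: power2_eq_square power4_eq_xxxx)
  also have "exp T * exp (- (2 * \<alpha> * T)) = exp (- (2 * \<alpha> - 1) * T)"
    unfolding exp_add[symmetric] by (simp add: algebra_simps)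
  finally show ?thesis .
qed

text \<open>The error terms do not contain \<open>eps\<close> and see the center only through the
  number of sites, which \<open>card_box_le\<close> bounds uniformly. So one scale serves all
  admissible \<open>eps\<close> and all boxes.\<close>

theorem localization_probability:
  fixes c s C \<xi> \<beta> \<tau> :: real
  assumes C: "\<And>a. (\<integral>\<^sup>+t. ennreal (\<bar>t - a\<bar> powr (-s)) \<partial>\<mu>) \<le> ennreal C" "1 \<le> C"
    and s: "1/2 < s" "s \<le> 1" and c: "measure \<mu> {-c..c} = 1" "0 \<le> c"
    and exponents: "0 < \<xi>" "\<xi> < \<beta>" "\<xi> < \<tau>"
  shows "\<exists>Lt. \<forall>eps. 0 < eps \<and> eps \<le> 1 \<and> C * (3 ^ CARD('d) * eps powr s) \<le> exp (-8) \<longrightarrow>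
    (\<forall>L\<ge>Lt. \<forall>x0 :: real ^ 'd. 1 - exp (- (L powr \<xi>))
      \<le> measure P {w. m_localizing \<beta> \<tau> eps w ((2 * s - 1) / (16 * s)) L x0})"
proof -
  define m where "m = (2 * s - 1) / (8 * s)"
  define c1 where "c1 = (2 * s - 1) / 2"
  define B where "B = c + 1"
  let ?d = "CARD('d)"
  have pos: "0 < m" "0 < c1" "0 \<le> B" using s c by (simp_all add: m_def c1_def B_def)
  have "\<forall>\<^sub>F L in at_top. ((2 * B + 5) * 3 * C\<^sup>2 * exp 8) * (L + 1) ^ (4 * ?d) * exp (- (c1 / 4) * L powr \<tau>) \<le> exp (- (L powr \<xi>)) / 2"
    using pos C exponents by (intro stretched_exponential_eventually_le) auto
  \<comment> \<open>The added 1 makes the prefactor positive even if \<open>K = 0\<close>.\<close>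
  moreover have "\<forall>\<^sub>F L in at_top. ((2 * B + 5) * 64 * K\<^sup>2 + 1) * (L + 1) ^ (4 * ?d) * exp (- (2 * \<alpha> - 1) * L powr \<beta>) \<le> exp (- (L powr \<xi>)) / 2"
    using pos alpha exponents by (intro stretched_exponential_eventually_le) (auto intro!: add_nonneg_pos)
  moreover have "\<forall>\<^sub>F L in at_top. 2 * (L + 1) ^ ?d * exp (- (m / 4) * L powr \<tau>) \<le> exp (- (L powr \<xi>)) / 2"
    using pos exponents by (intro stretched_exponential_eventually_le) auto
  moreover have "\<forall>\<^sub>F L in at_top. 8 * (L + 1) ^ ?d * exp (- 1 * L powr \<beta>) \<le> exp (- (L powr \<xi>)) / 2"
    using exponents by (intro stretched_exponential_eventually_le) auto
  moreover have "\<forall>\<^sub>F L::real in at_top. 2 \<le> L powr \<tau>"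
  proof -
    have "0 < \<tau>" using exponents by simp
    then have "filterlim (\<lambda>L::real. L powr \<tau>) at_top at_top" by real_asymp
    then show ?thesis by (simp add: filterlim_at_top)
  qed
  moreover have "\<forall>\<^sub>F L::real in at_top. 0 \<le> L" by (rule eventually_ge_at_top)
  ultimately have "\<forall>\<^sub>F L in at_top.
      ((2 * B + 5) * 3 * C\<^sup>2 * exp 8) * (L + 1) ^ (4 * ?d) * exp (- (c1 / 4) * L powr \<tau>) \<le> exp (- (L powr \<xi>)) / 2 \<and>
      ((2 * B + 5) * 64 * K\<^sup>2 + 1) * (L + 1) ^ (4 * ?d) * exp (- (2 * \<alpha> - 1) * L powr \<beta>) \<le> exp (- (L powr \<xi>)) / 2 \<and>
      2 * (L + 1) ^ ?d * exp (- (m / 4) * L powr \<tau>) \<le> exp (- (L powr \<xi>)) / 2 \<and>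
      8 * (L + 1) ^ ?d * exp (- 1 * L powr \<beta>) \<le> exp (- (L powr \<xi>)) / 2 \<and> 2 \<le> L powr \<tau> \<and> 0 \<le> L"
    by eventually_elim simp
  then obtain Lt where Lt: "\<And>L. Lt \<le> L \<Longrightarrow>
      ((2 * B + 5) * 3 * C\<^sup>2 * exp 8) * (L + 1) ^ (4 * ?d) * exp (- (c1 / 4) * L powr \<tau>) \<le> exp (- (L powr \<xi>)) / 2 \<and>
      ((2 * B + 5) * 64 * K\<^sup>2 + 1) * (L + 1) ^ (4 * ?d) * exp (- (2 * \<alpha> - 1) * L powr \<beta>) \<le> exp (- (L powr \<xi>)) / 2 \<and>
      2 * (L + 1) ^ ?d * exp (- (m / 4) * L powr \<tau>) \<le> exp (- (L powr \<xi>)) / 2 \<and>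
      8 * (L + 1) ^ ?d * exp (- 1 * L powr \<beta>) \<le> exp (- (L powr \<xi>)) / 2 \<and> 2 \<le> L powr \<tau> \<and> 0 \<le> L"
    unfolding eventually_at_top_linorder by blast
  show ?thesis
  proof (intro exI[of _ Lt] allI impI, elim conjE)
    fix eps L :: real and x0 :: "real ^ 'd"
    assume eps: "0 < eps" "eps \<le> 1" "C * (3 ^ CARD('d) * eps powr s) \<le> exp (-8)" and L: "Lt \<le> L"
    interpret P: prob_space "P :: (int ^ 'd \<Rightarrow> real) measure" by (rule prob_P)
    define N where "N = (L + 1) ^ ?d"
    define n where "n = card (box L x0)"
    define R where "R = real_of_int \<lfloor>L powr \<tau>\<rfloor> / 2"
    have N4: "(L + 1) ^ (4 * ?d) = N ^ 4" by (simp add: N_def power_mult[symmetric] mult.commute)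
    note Lt = Lt[OF L, unfolded N4, folded N_def]
    have L0: "0 \<le> L" using Lt by simp
    have N: "real n \<le> N" "1 \<le> N" using card_box_le[OF L0, of x0] L0 by (simp_all add: n_def N_def)
    have "2 \<le> L powr \<tau>" using Lt by simp
    \<comment> \<open>For \<open>L powr \<tau> \<ge> 2\<close> rounding down loses at most
      half.\<close>
    then have R: "L powr \<tau> / 4 \<le> R" "0 < R" unfolding R_def by linarith+
    have "exp (- (L powr \<xi>)) \<le> 1" by simp
    then have half: "exp (- (L powr \<xi>)) / 2 \<le> 1" by linarith
    have cond1: "2 * real n * exp (- m * R) \<le> 1"
    proof -
      have "m * (L powr \<tau> / 4) \<le> m * R" using pos R by (intro mult_left_mono) auto
      then have "2 * real n * exp (- m * R) \<le> 2 * N * exp (- (m / 4) * L powr \<tau>)"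
        using N by (intro mult_mono) auto
      then show ?thesis using Lt half by linarith
    qed
    have cond2: "8 * exp (- (L powr \<beta>)) * real n \<le> 1"
    proof -
      have "8 * exp (- (L powr \<beta>)) * real n \<le> 8 * exp (- (L powr \<beta>)) * N" using N by (intro mult_left_mono) auto
      also have "\<dots> = 8 * N * exp (- 1 * L powr \<beta>)" by simp
      finally show ?thesis using Lt half by linarith
    qed
    let ?bad = "{w. \<not> m_localizing \<beta> \<tau> eps w (m / 2) L x0}"
    have "emeasure P ?bad \<le> ennreal ((real n)\<^sup>2 * ((2 * B + 5) * (2 * real n * C * exp 8 + (real n)\<^sup>2 * C\<^sup>2) * exp (- c1 * R))
       + (2 * B / exp (- (L powr \<beta>)) + 5) * (real n)\<^sup>2 * (K * (8 * exp (- (L powr \<beta>)) * n) powr \<alpha>)\<^sup>2)"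
      unfolding m_def R_def B_def n_def c1_def
      by (rule emeasure_not_localizing_le[OF C s c eps]) (use cond1 cond2 R in \<open>simp_all add: m_def R_def n_def\<close>)
    also have "\<dots> \<le> ennreal (exp (- (L powr \<xi>)))"
    proof (rule ennreal_leI)
      have "(real n)\<^sup>2 * ((2 * B + 5) * (2 * real n * C * exp 8 + (real n)\<^sup>2 * C\<^sup>2) * exp (- c1 * R))
          \<le> (2 * B + 5) * 3 * C\<^sup>2 * exp 8 * N ^ 4 * exp (- (c1 / 4) * L powr \<tau>)"
        using N C pos R by (intro first_error_le) auto
      also have "\<dots> \<le> exp (- (L powr \<xi>)) / 2" using Lt by simp
      finally have 1: "(real n)\<^sup>2 * ((2 * B + 5) * (2 * real n * C * exp 8 + (real n)\<^sup>2 * C\<^sup>2) * exp (- c1 * R)) \<le> exp (- (L powr \<xi>)) / 2" .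
      have "(2 * B / exp (- (L powr \<beta>)) + 5) * (real n)\<^sup>2 * (K * (8 * exp (- (L powr \<beta>)) * n) powr \<alpha>)\<^sup>2
          \<le> (2 * B + 5) * 64 * K\<^sup>2 * N ^ 4 * exp (- (2 * \<alpha> - 1) * L powr \<beta>)"
        using N pos by (intro second_error_le) auto
      also have "\<dots> \<le> ((2 * B + 5) * 64 * K\<^sup>2 + 1) * N ^ 4 * exp (- (2 * \<alpha> - 1) * L powr \<beta>)"
        using N by (intro mult_right_mono) auto
      also have "\<dots> \<le> exp (- (L powr \<xi>)) / 2" using Lt by simp
      finally show "(real n)\<^sup>2 * ((2 * B + 5) * (2 * real n * C * exp 8 + (real n)\<^sup>2 * C\<^sup>2) * exp (- c1 * R))
        + (2 * B / exp (- (L powr \<beta>)) + 5) * (real n)\<^sup>2 * (K * (8 * exp (- (L powr \<beta>)) * n) powr \<alpha>)\<^sup>2 \<le> exp (- (L powr \<xi>))"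
        using 1 by linarith
    qed
    finally have bad: "measure P ?bad \<le> exp (- (L powr \<xi>))"
      by (simp add: P.emeasure_eq_measure)
    let ?good = "{w. m_localizing \<beta> \<tau> eps w (m / 2) L x0}"
    \<comment> \<open>Measurability is what turns the bound on the bad set into a lower bound on its
      complement.\<close>
    have good: "?good \<in> sets P" unfolding sets_P_borel by (intro borel_closed closed_m_localizing)
    have "measure P ?bad = 1 - measure P ?good"
      using P.prob_compl[OF good] by (simp add: space_P Compl_eq_Diff_UNIV[symmetric] Collect_neg_eq)
    then have "1 - exp (- (L powr \<xi>)) \<le> measure P ?good" using bad by linarith
    moreover have "m / 2 = (2 * s - 1) / (16 * s)" by (simp add: m_def)
    ultimately show "1 - exp (- (L powr \<xi>)) \<le> measure P {w. m_localizing \<beta> \<tau> eps w ((2 * s - 1) / (16 * s)) L x0}"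
      by (simp only:)
  qed
qed

end

theorem theorem1p7:
  fixes \<mu> :: "real measure" and K \<alpha> \<theta> q p \<gamma>\<^sub>1 :: real
  assumes prob: "prob_space \<mu>" and sets_mu: "sets \<mu> = sets borel"
    and bounded_supp: "\<exists>C. measure \<mu> {-C..C} = 1"
    and nondegenerate: "\<forall>c. measure \<mu> {c} < 1"
    and alpha: "1/2 < \<alpha>" "\<alpha> \<le> 1"
    and hoelder: "\<forall>a. \<forall>t\<in>{0..1}. measure \<mu> {a..a+t} \<le> K * t powr \<alpha>"
    and theta: "\<theta> > (6 / (2*\<alpha> - 1) + 9/2) * real CARD('d)"
    and q: "3 * real CARD('d) / (2*\<alpha> - 1) < q" "q < (\<theta> - 9/2 * real CARD('d)) / 2"
    and p: "0 < p" "p < (2*\<alpha> - 1) * q - 3 * real CARD('d)"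
    and gamma1: "1 < \<gamma>\<^sub>1" "\<gamma>\<^sub>1 < min (1 + p / (p + 2 * real CARD('d)))
                       ((2*\<theta> - 4 * real CARD('d)) / (5 * real CARD('d) + 4*q))"
  shows "\<exists>\<epsilon>\<^sub>0 > 0. \<forall>\<xi> \<zeta> \<beta> \<gamma> \<tau> :: real.
     0 < \<xi> \<and> \<xi> < \<zeta> \<and> \<zeta> < \<beta> \<and> \<beta> < 1/\<gamma> \<and> 1/\<gamma> < 1 \<and> 1 < \<gamma> \<and> \<gamma> < sqrt (\<zeta>/\<xi>) \<and>
     max ((1 + \<gamma>\<^sub>1) / (2*\<gamma>\<^sub>1)) (max ((1 + \<gamma>*\<beta>) / 2) (((\<gamma> - 1)*\<beta> + 1) / \<gamma>)) < \<tau> \<and> \<tau> < 1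
     \<longrightarrow> (\<exists>Lt m. m > 0 \<and>
          (\<forall>\<epsilon>. 0 < \<epsilon> \<and> \<epsilon> \<le> \<epsilon>\<^sub>0 \<longrightarrow> (\<forall>L \<ge> Lt. \<forall>x :: real ^ 'd.
             measure (PiM UNIV (\<lambda>_ :: int ^ 'd. \<mu>))
               {\<omega> \<in> space (PiM UNIV (\<lambda>_ :: int ^ 'd. \<mu>)). m_localizing \<beta> \<tau> \<epsilon> \<omega> m L x}
             \<ge> 1 - exp (- (L powr \<xi>)))))"
proof -
  interpret iid_potential \<mu> K \<alpha>
    by (rule iid_potential.intro[OF prob sets_mu alpha]) (use hoelder in auto)
  obtain c where c: "measure \<mu> {-c..c} = 1" using bounded_supp by blast
  have c0: "0 \<le> c"
  proof (rule ccontr)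
    assume "\<not> 0 \<le> c"
    then have "{-c..c} = {}" by simp
    then show False using c by simp
  qed
  \<comment> \<open>The midpoint of 1/2 and \<alpha>: below \<alpha> for finite moments, above 1/2
    for the square to beat the net.\<close>
  define s where "s = (1/2 + \<alpha>) / 2"
  have s: "0 < s" "1/2 < s" "s \<le> 1" "s < \<alpha>" using alpha by (simp_all add: s_def field_simps)
  obtain C where C: "1 \<le> C" "\<And>a. (\<integral>\<^sup>+t. ennreal (\<bar>t - a\<bar> powr (-s)) \<partial>\<mu>) \<le> ennreal C"
    using fractional_moment_bound[OF s(1,4)] by blast
  define D where "D = C * 3 ^ CARD('d)"
  have D: "1 \<le> D" unfolding D_def using C(1) mult_mono[of 1 C 1 "3 ^ CARD('d)"] by simp
  \<comment> \<open>The value at which the hopping condition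
    \<open>D * eps powr s \<le> exp (-8)\<close> becomes an equality.\<close>
  define e0 where "e0 = (exp (-8) / D) powr (1 / s)"
  have "exp (-8 :: real) \<le> 1" by simp
  then have "exp (-8) \<le> D" using D by linarith
  then have "exp (-8) / D \<le> 1" using D by simp
  then have e0: "0 < e0" "e0 \<le> 1" "e0 powr s = exp (-8) / D"
    using D s by (simp_all add: e0_def powr_powr powr_le1)
  show ?thesis
  proof (rule exI[of _ e0], intro conjI e0(1) allI impI, elim conjE)
    fix \<xi> \<zeta> \<beta> \<gamma> \<tau> :: real
    assume "0 < \<xi>" "\<xi> < \<zeta>" "\<zeta> < \<beta>" "\<beta> < 1/\<gamma>" "1/\<gamma> < 1" "1 < \<gamma>"
      and less: "max ((1 + \<gamma>\<^sub>1) / (2*\<gamma>\<^sub>1)) (max ((1 + \<gamma>*\<beta>) / 2) (((\<gamma> - 1)*\<beta> + 1) / \<gamma>)) < \<tau>"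
    then have \<beta>: "\<xi> < \<beta>" "\<beta> < 1" "0 < \<beta>" by linarith+
    \<comment> \<open>From \<gamma> > 1 and \<beta> < 1 one gets \<beta> <
      \<open>(1 + \<beta>) / 2\<close> < \<open>(1 + \<gamma> * \<beta>) / 2\<close> <
      \<tau>.\<close>
    have "1 * \<beta> < \<gamma> * \<beta>" using \<open>1 < \<gamma>\<close> \<beta>(3) by (rule mult_strict_right_mono)
    moreover have "(1 + \<gamma>*\<beta>) / 2 < \<tau>" using less unfolding max_less_iff_conj by blast
    ultimately have "\<beta> < \<tau>" using \<beta>(2) by (simp add: field_simps)
    then have exponents: "0 < \<xi>" "\<xi> < \<beta>" "\<xi> < \<tau>" using \<open>0 < \<xi>\<close> \<beta>(1) by linarith+
    obtain Lt where Lt: "\<And>eps L x. 0 < eps \<Longrightarrow> eps \<le> 1 \<Longrightarrow> C * (3 ^ CARD('d) * eps powr s) \<le> exp (-8) \<Longrightarrow> Lt \<le> L \<Longrightarrow>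
        1 - exp (- (L powr \<xi>)) \<le> measure P {w. m_localizing \<beta> \<tau> eps w ((2 * s - 1) / (16 * s)) L (x :: real ^ 'd)}"
      using localization_probability[where 'd = 'd, OF C(2,1) s(2,3) c c0 exponents] by blast
    show "\<exists>Lt m. m > 0 \<and>
          (\<forall>\<epsilon>. 0 < \<epsilon> \<and> \<epsilon> \<le> e0 \<longrightarrow> (\<forall>L \<ge> Lt. \<forall>x :: real ^ 'd.
             measure (PiM UNIV (\<lambda>_ :: int ^ 'd. \<mu>))
               {\<omega> \<in> space (PiM UNIV (\<lambda>_ :: int ^ 'd. \<mu>)). m_localizing \<beta> \<tau> \<epsilon> \<omega> m L x}
             \<ge> 1 - exp (- (L powr \<xi>))))"
    proof (rule exI[of _ Lt], rule exI[of _ "(2 * s - 1) / (16 * s)"], intro conjI allI impI, goal_cases)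
      case 1
      then show ?case using s by simp
    next
      case (2 eps L x)
      then have "eps powr s \<le> exp (-8) / D" unfolding e0(3)[symmetric] using s by (intro powr_mono2) auto
      then have "C * (3 ^ CARD('d) * eps powr s) \<le> exp (-8)" using D by (simp add: D_def field_simps)
      then show ?case using Lt[of eps L x] 2 e0(2) by (simp add: P_def space_PiM space_mu)
    qed
  qed
qed

end
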